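(* Let $m,n\ge 2$ be integers and let $k\in\{1,\ldots,mn-1\}$. A linear map $\phi: M_{mn}\to M_{mn}$ satisfies $$W_k(\phi(A\otimes B)) = W_k(A\otimes B)\quad\text{for all } A\in M_m \text{ and } B\in M_n$$ if and only if there is a unitary $U\in M_{mn}$ such that one of the following holds: (i) for all $A\in M_m$, $B\in M_n$, $$\phi(A\otimes B)=U(\varphi(A\otimes B))U^*;$$ (ii) $mn=2k$ and for all $A\in M_m$, $B\in M_n$, $$\phi(A\otimes B)=(\operatorname{tr}(A\otimes B)/k)\,I_{mn}-U(\varphi(A\otimes B))U^*;$$ where $\varphi: M_{mn}\to M_{mn}$ is a linear map such that either (1) $\varphi$ is the identity map $A\otimes B\mapsto A\otimes B$ or the transposition map $A\otimes B\mapsto (A\otimes B)^t$, or (2) $\min\{m,n\}\le 2$ and $\varphi$ has the form $A\otimes B\mapsto A\otimes B^t$ or $A\otimes B\mapsto A^t\otimes B$ (each form holding for all $A\in M_m$, $B\in M_n$).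
   Context: $M_n$ denotes the set of $n\times n$ complex matrices, and linear means complex linear. $A\otimes B\in M_{mn}$ is the Kronecker (tensor) product of $A\in M_m$ and $B\in M_n$. $A^t$ is the transpose and $A^*$ the conjugate transpose. For $A\in M_N$ and $k\in\{1,\ldots,N\}$, the $k$-numerical range is $$W_k(A)=\{\operatorname{tr}(X^*AX)/k : X \text{ is a complex } N\times k \text{ matrix with } X^*X=I_k\}\subseteq\mathbb{C}.$$ *)

theory Defs
  imports
    "Jordan_Normal_Form.Schur_Decomposition"
    "Jordan_Normal_Form.VS_Connect"
begin

definition mat_trace :: "'a::comm_monoid_add mat \<Rightarrow> 'a" where
  "mat_trace A = (\<Sum>i<dim_row A. A $$ (i, i))"

(* Row and column indices of the product enumerate pairs lexicographically, the index
   into the second factor varying fastest: A \<otimes> B is the block matrix (a_ij B). *)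
definition kronecker :: "'a::times mat \<Rightarrow> 'a mat \<Rightarrow> 'a mat" where
  "kronecker A B = mat (dim_row A * dim_row B) (dim_col A * dim_col B)
     (\<lambda>(i, j). A $$ (i div dim_row B, j div dim_col B) * B $$ (i mod dim_row B, j mod dim_col B))"

(* C-linear maps M_N \<rightarrow> M_N. A map is a function on the type of matrices of all sizes;
   only its restriction to N x N matrices is constrained. *)
definition linear_mat_map :: "nat \<Rightarrow> (complex mat \<Rightarrow> complex mat) \<Rightarrow> bool" where
  "linear_mat_map N f \<longleftrightarrow>
     f \<in> LinearCombinations.module_hom class_ring (module_mat TYPE(complex) N N) (module_mat TYPE(complex) N N)"

definition unitary_mat :: "nat \<Rightarrow> complex mat \<Rightarrow> bool" where
  "unitary_mat N U \<longleftrightarrow> U \<in> carrier_mat N N \<and> mat_adjoint U * U = 1\<^sub>m N"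

(* Intended for square A and 1 \<le> k \<le> dim_row A. *)
definition k_numerical_range :: "nat \<Rightarrow> complex mat \<Rightarrow> complex set" where
  "k_numerical_range k A =
     {mat_trace (mat_adjoint X * A * X) / of_nat k | X.
        X \<in> carrier_mat (dim_row A) k \<and> mat_adjoint X * X = 1\<^sub>m k}"

end

theory Submission
  imports Defs "Jordan_Normal_Form.Spectral_Radius"
begin

text \<open>A matrix \<open>X\<close> with \<open>X\<^sup>* X = I\<close> is the same datum, up to a unitary of size \<open>k\<close>, as the projection
  \<open>R = X X\<^sup>*\<close> of rank \<open>k\<close>, so \<open>k W\<^sub>k(A)\<close> is the set of all \<open>tr (R A)\<close> with \<open>R\<close> a projection of rank \<open>k\<close>
  (\<open>k_numerical_range_krange\<close>).  Write \<open>N = mn\<close>.  This set decides whether \<open>A\<close> is Hermitian and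
  determines a scalar matrix, so a linear map \<open>\<phi>\<close> preserving it on products sends Hermitian
  products to Hermitian matrices and \<open>I\<close> to \<open>I\<close>.

  The heart of the argument is that \<open>\<phi>\<close>, possibly after replacement by \<open>A \<mapsto> (tr A / k) I - \<phi>(A)\<close>, sends
  product states to rank one projections (\<open>atom_preserver_cases\<close>).  Let \<open>p\<^sub>1, ..., p\<^sub>m\<close> and
  \<open>q\<^sub>1, ..., q\<^sub>n\<close> be the rank one projections onto two orthonormal bases, and
  \<open>Q\<^sub>i\<^sub>j = \<phi>(p\<^sub>i \<otimes> q\<^sub>j)\<close>.  The numbers \<open>tr (R Q\<^sub>i\<^sub>j)\<close> lie in \<open>[0, 1]\<close> and reach both ends,
  which is a statement about the sums of \<open>k\<close> eigenvalues of \<open>Q\<^sub>i\<^sub>j\<close>.  It bounds the trace of \<open>Q\<^sub>i\<^sub>j\<close> by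
  \<open>1\<close> from below or from above, according to the sign of \<open>N - 2k\<close>; as the \<open>N\<close> matrices \<open>Q\<^sub>i\<^sub>j\<close> add up to \<open>I\<close>,
  all these traces are \<open>1\<close>, and for \<open>N \<noteq> 2k\<close> this forces \<open>Q\<^sub>i\<^sub>j\<close> to be positive (\<open>extreme_sums\<close>).
  Evaluating the range on real combinations of the \<open>p\<^sub>i \<otimes> q\<^sub>j\<close> with coefficients \<open>f\<^sub>i g\<^sub>j \<in> {-1, 0, 1}\<close> gives
  projections \<open>R\<close> of rank \<open>k\<close> with \<open>tr (R Q\<^sub>x) = 1\<close> and \<open>tr (R Q\<^sub>y) = 0\<close> (\<open>sign_projection\<close>, \<open>separate\<close>).  Then
  \<open>R\<close> contains the range of \<open>Q\<^sub>x\<close> and annihilates \<open>Q\<^sub>y\<close>, so the \<open>Q\<^sub>x\<close> are mutually orthogonal, and together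
  with \<open>\<Sum> Q\<^sub>x = I\<close> this makes them rank one projections.  For \<open>N = 2k\<close> the \<open>Q\<^sub>x\<close> need not be positive; they
  are cut in the middle of the spectrum, \<open>Q\<^sub>x = g\<^sub>x I + M\<^sub>x - K\<^sub>x\<close>, all the parts are mutually orthogonal, and
  \<open>\<Sum> Q\<^sub>x = I\<close> leaves two cases: all \<open>Q\<^sub>x\<close> are rank one projections, or all \<open>I / k - Q\<^sub>x\<close> are
  (\<open>resolution_half\<close>).  Which case occurs cannot depend on the two bases (\<open>type_uniform\<close>).

  If \<open>\<phi>\<close> sends product states to rank one projections, set \<open>\<alpha>(A) = \<phi>(A \<otimes> I)\<close> and \<open>\<beta>(B) = \<phi>(I \<otimes> B)\<close>.
  Orthogonality gives \<open>\<phi>(A \<otimes> B) = \<alpha>(A) \<beta>(B) = \<beta>(B) \<alpha>(A)\<close>, and \<open>\<alpha>\<close>, \<open>\<beta>\<close> are Jordan homomorphisms by the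
  spectral theorem.  Each of them is a homomorphism or an antihomomorphism (\<open>hom_or_antihom\<close>,
  \<open>alpha_hom_or_antihom\<close>), hence a homomorphism after a transposition of the factor concerned, and two
  commuting homomorphisms of this kind are implemented by one unitary \<open>U\<close> (\<open>unitary_implementation\<close>).  So
  \<open>\<phi>(A \<otimes> B) = U (s(A) \<otimes> t(B)) U\<^sup>*\<close>, with \<open>s\<close> and \<open>t\<close> the identity or the transposition
  (\<open>product_structure\<close>).

  Transposing one factor only is harmless if a factor has size two, as every two by two matrix is
  unitarily similar to its transpose (\<open>two_by_two_transpose\<close>).  If both factors have size at least three,
  an explicit pair of weighted shifts shows that it changes the range
  (\<open>partial_transpose_not_preserving\<close>).  Conversely the range is invariant under unitary similarity
  and transposition, and for \<open>N = 2k\<close> under \<open>A \<mapsto> (tr A / k) I - A\<close>, as \<open>R \<mapsto> I - R\<close> permutes the projections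
  of rank \<open>k\<close>.\<close>


section \<open>The algebra of finitely supported matrices\<close>

text \<open>The matrix algebras \<open>M\<^sub>m\<close>, \<open>M\<^sub>n\<close> and \<open>M\<^sub>m\<^sub>n\<close>, the rectangular matrices between them and the column
  vectors are all subsets of one ring, the infinite matrices with finitely many nonzero entries.
  Products are then total and associative, and a size is a membership condition.  The ring has no
  unit; the identity of size \<open>N\<close> is the idempotent \<open>Idm N\<close>.\<close>

typedef fmat = "{f :: nat \<Rightarrow> nat \<Rightarrow> complex. \<exists>N. \<forall>i j. f i j \<noteq> 0 \<longrightarrow> i < N \<and> j < N}"
  morphisms ent Abs_fmat
  by (rule exI[of _ "\<lambda>_ _. 0"]) auto

setup_lifting type_definition_fmat

lemma fmat_eqI: "(\<And>i j. ent A i j = ent B i j) \<Longrightarrow> A = B"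
  by (metis ent_inject ext)

text \<open>The \<open>M \<times> N\<close> matrices; a column vector of size \<open>N\<close> is an element of \<open>rect N 1\<close>, and an inner
  product is then a multiple of \<open>E 0 0\<close>.\<close>

definition rect :: "nat \<Rightarrow> nat \<Rightarrow> fmat set" where
  "rect M N = {A. \<forall>i j. ent A i j \<noteq> 0 \<longrightarrow> i < M \<and> j < N}"

abbreviation corner :: "nat \<Rightarrow> fmat set" where "corner N \<equiv> rect N N"

lemma rectD: "A \<in> rect M N \<Longrightarrow> ent A i j \<noteq> 0 \<Longrightarrow> i < M \<and> j < N"
  by (auto simp: rect_def)

lemma rectI: "(\<And>i j. ent A i j \<noteq> 0 \<Longrightarrow> i < M \<and> j < N) \<Longrightarrow> A \<in> rect M N"
  by (auto simp: rect_def)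

lemma corner_mono: "A \<in> corner M \<Longrightarrow> M \<le> N \<Longrightarrow> A \<in> corner N"
  unfolding rect_def by force

lemma corner_ex: obtains N where "A \<in> corner N"
  using ent[of A] by (auto simp: rect_def)

lemma corner_ex2: obtains N where "A \<in> corner N" "B \<in> corner N"
proof -
  obtain M where "A \<in> corner M" by (rule corner_ex)
  moreover obtain N where "B \<in> corner N" by (rule corner_ex)
  ultimately show ?thesis by (intro that[of "max M N"]) (auto intro: corner_mono)
qed

instantiation fmat :: ring
begin

lift_definition zero_fmat :: fmat is "\<lambda>_ _. 0" by auto

lift_definition plus_fmat :: "fmat \<Rightarrow> fmat \<Rightarrow> fmat" is "\<lambda>f g i j. f i j + g i j"
proof -
  fix f g :: "nat \<Rightarrow> nat \<Rightarrow> complex"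
  assume "\<exists>N. \<forall>i j. f i j \<noteq> 0 \<longrightarrow> i < N \<and> j < N" "\<exists>N. \<forall>i j. g i j \<noteq> 0 \<longrightarrow> i < N \<and> j < N"
  then obtain M N where MN: "\<forall>i j. f i j \<noteq> 0 \<longrightarrow> i < M \<and> j < M" "\<forall>i j. g i j \<noteq> 0 \<longrightarrow> i < N \<and> j < N" by blast
  show "\<exists>N. \<forall>i j. f i j + g i j \<noteq> 0 \<longrightarrow> i < N \<and> j < N"
  proof (intro exI allI impI)
    fix i j assume "f i j + g i j \<noteq> 0"
    then have "f i j \<noteq> 0 \<or> g i j \<noteq> 0" by auto
    then show "i < max M N \<and> j < max M N" using MN by (auto simp: less_max_iff_disj)
  qed
qed

lift_definition uminus_fmat :: "fmat \<Rightarrow> fmat" is "\<lambda>f i j. - f i j" by auto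

definition minus_fmat :: "fmat \<Rightarrow> fmat \<Rightarrow> fmat" where "minus_fmat A B = A + (- B)"

lift_definition times_fmat :: "fmat \<Rightarrow> fmat \<Rightarrow> fmat"
  is "\<lambda>f g i j. \<Sum>l | f i l \<noteq> 0. f i l * g l j"
proof -
  fix f g :: "nat \<Rightarrow> nat \<Rightarrow> complex"
  assume "\<exists>N. \<forall>i j. f i j \<noteq> 0 \<longrightarrow> i < N \<and> j < N" "\<exists>N. \<forall>i j. g i j \<noteq> 0 \<longrightarrow> i < N \<and> j < N"
  then obtain M N where MN: "\<forall>i j. f i j \<noteq> 0 \<longrightarrow> i < M \<and> j < M" "\<forall>i j. g i j \<noteq> 0 \<longrightarrow> i < N \<and> j < N" by blast
  show "\<exists>N. \<forall>i j. (\<Sum>l | f i l \<noteq> 0. f i l * g l j) \<noteq> 0 \<longrightarrow> i < N \<and> j < N"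
  proof (intro exI allI impI)
    fix i j assume "(\<Sum>l | f i l \<noteq> 0. f i l * g l j) \<noteq> 0"
    then obtain l where "f i l * g l j \<noteq> 0" by (rule sum.not_neutral_contains_not_neutral)
    then have "f i l \<noteq> 0" "g l j \<noteq> 0" by auto
    then show "i < max M N \<and> j < max M N" using MN by (auto simp: less_max_iff_disj)
  qed
qed

lemma ent_mult:
  assumes "A \<in> rect M N"
  shows "ent (A * B) i j = (\<Sum>l<N. ent A i l * ent B l j)"
proof -
  have "(\<Sum>l<N. ent A i l * ent B l j) = (\<Sum>l | ent A i l \<noteq> 0. ent A i l * ent B l j)"
    by (rule sum.mono_neutral_right) (use rectD[OF assms] in auto)
  then show ?thesis by (simp add: times_fmat.rep_eq)
qed

lemma ent_mult_nz:
  assumes "ent (A * B) i j \<noteq> 0" obtains l where "ent A i l \<noteq> 0" "ent B l j \<noteq> 0"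
proof -
  have "(\<Sum>l | ent A i l \<noteq> 0. ent A i l * ent B l j) \<noteq> 0" using assms by (simp add: times_fmat.rep_eq)
  then obtain l where "ent A i l * ent B l j \<noteq> 0" by (rule sum.not_neutral_contains_not_neutral)
  then show ?thesis using that[of l] by simp
qed

lemma rect_mult: "A \<in> rect M K \<Longrightarrow> B \<in> rect L N \<Longrightarrow> A * B \<in> rect M N"
  by (rule rectI, erule ent_mult_nz) (auto dest: rectD)

instance
proof
  fix a b c :: fmat
  show "a + b + c = a + (b + c)" "a + b = b + a" "0 + a = a" "- a + a = 0"
    by (auto intro!: fmat_eqI simp: plus_fmat.rep_eq zero_fmat.rep_eq uminus_fmat.rep_eq)
  show "a - b = a + - b" by (rule minus_fmat_def)
  obtain N where N: "a \<in> corner N" "b \<in> corner N" by (rule corner_ex2)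
  have ab: "a * b \<in> corner N" using N by (rule rect_mult)
  have ab': "a + b \<in> corner N"
  proof (rule rectI)
    fix i j assume "ent (a + b) i j \<noteq> 0"
    then have "ent a i j \<noteq> 0 \<or> ent b i j \<noteq> 0" by (auto simp: plus_fmat.rep_eq)
    then show "i < N \<and> j < N" using N by (auto dest: rectD)
  qed
  show "a * b * c = a * (b * c)"
  proof (rule fmat_eqI)
    fix i j
    have "ent (a * b * c) i j = (\<Sum>l<N. \<Sum>k<N. ent a i k * ent b k l * ent c l j)"
      by (simp add: ent_mult[OF ab] ent_mult[OF N(1)] sum_distrib_right)
    also have "\<dots> = (\<Sum>k<N. \<Sum>l<N. ent a i k * ent b k l * ent c l j)" by (rule sum.swap)
    also have "\<dots> = ent (a * (b * c)) i j"
      by (simp add: ent_mult[OF N(1)] ent_mult[OF N(2)] sum_distrib_left mult.assoc)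
    finally show "ent (a * b * c) i j = ent (a * (b * c)) i j" .
  qed
  show "(a + b) * c = a * c + b * c"
    by (rule fmat_eqI) (simp add: ent_mult[OF ab'] ent_mult[OF N(1)] ent_mult[OF N(2)] plus_fmat.rep_eq distrib_right sum.distrib)
  show "a * (b + c) = a * b + a * c"
    by (rule fmat_eqI) (simp add: ent_mult[OF N(1)] plus_fmat.rep_eq distrib_left sum.distrib)
qed

end

lemma ent_simps [simp]:
  "ent 0 i j = 0" "ent (A + B) i j = ent A i j + ent B i j" "ent (- A) i j = - ent A i j"
  "ent (A - B) i j = ent A i j - ent B i j"
  by (simp_all add: zero_fmat.rep_eq plus_fmat.rep_eq uminus_fmat.rep_eq diff_conv_add_uminus[of A B] del: add_uminus_conv_diff)

lemma ent_sum: "ent (\<Sum>x\<in>S. f x) i j = (\<Sum>x\<in>S. ent (f x) i j)"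
  by (induction S rule: infinite_finite_induct) auto

lift_definition smul :: "complex \<Rightarrow> fmat \<Rightarrow> fmat" (infixr "*\<^sub>C" 75) is "\<lambda>c f i j. c * f i j"
  by auto

lift_definition adj :: "fmat \<Rightarrow> fmat" is "\<lambda>f i j. cnj (f j i)" by auto

lift_definition trn :: "fmat \<Rightarrow> fmat" is "\<lambda>f i j. f j i" by auto

lift_definition E :: "nat \<Rightarrow> nat \<Rightarrow> fmat" is "\<lambda>p q i j. if i = p \<and> j = q then 1 else 0"
proof -
  fix p q :: nat
  show "\<exists>N. \<forall>i j. (if i = p \<and> j = q then 1 else 0 :: complex) \<noteq> 0 \<longrightarrow> i < N \<and> j < N"
    by (rule exI[of _ "Suc (max p q)"]) auto
qed

definition tr :: "fmat \<Rightarrow> complex" where "tr A = (\<Sum>i | ent A i i \<noteq> 0. ent A i i)"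

definition Idm :: "nat \<Rightarrow> fmat" where "Idm N = (\<Sum>i<N. E i i)"

lemma ent_more [simp]:
  "ent (c *\<^sub>C A) i j = c * ent A i j" "ent (adj A) i j = cnj (ent A j i)" "ent (trn A) i j = ent A j i"
  "ent (E p q) i j = (if i = p \<and> j = q then 1 else 0)"
  by (simp_all add: smul.rep_eq adj.rep_eq trn.rep_eq E.rep_eq)

lemma ent_Idm [simp]: "ent (Idm N) i j = (if i = j \<and> i < N then 1 else 0)"
proof -
  have "ent (Idm N) i j = (\<Sum>k<N. if k = i then (if i = j then 1 else 0) else 0)"
    unfolding Idm_def ent_sum by (rule sum.cong) auto
  then show ?thesis by simp
qed

lemma rect_closed [intro, simp]:
  "0 \<in> rect M N" "A \<in> rect M N \<Longrightarrow> B \<in> rect M N \<Longrightarrow> A + B \<in> rect M N"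
  "A \<in> rect M N \<Longrightarrow> B \<in> rect M N \<Longrightarrow> A - B \<in> rect M N" "A \<in> rect M N \<Longrightarrow> - A \<in> rect M N"
  "A \<in> rect M N \<Longrightarrow> c *\<^sub>C A \<in> rect M N" "A \<in> rect M N \<Longrightarrow> adj A \<in> rect N M"
  "A \<in> rect M N \<Longrightarrow> trn A \<in> rect N M"
  "i < M \<Longrightarrow> j < N \<Longrightarrow> E i j \<in> rect M N"  "Idm N \<in> rect N N"
  by ((auto simp: rect_def split: if_splits)[1]; metis add.right_neutral diff_zero)+

lemma corner_mult [simp]: "A \<in> corner N \<Longrightarrow> B \<in> corner N \<Longrightarrow> A * B \<in> corner N"
  by (rule rect_mult)

lemma rect_sum [intro]: "(\<And>x. x \<in> S \<Longrightarrow> f x \<in> rect M N) \<Longrightarrow> (\<Sum>x\<in>S. f x) \<in> rect M N"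
  by (induction S rule: infinite_finite_induct) auto

interpretation fm: vector_space smul
  by unfold_locales (auto intro!: fmat_eqI simp: algebra_simps)

lemma smul_mult [simp]: "(c *\<^sub>C A) * B = c *\<^sub>C (A * B)" "A * (c *\<^sub>C B) = c *\<^sub>C (A * B)"
proof -
  obtain N where N: "A \<in> corner N" by (rule corner_ex)
  have cN: "c *\<^sub>C A \<in> corner N" using N by simp
  show "(c *\<^sub>C A) * B = c *\<^sub>C (A * B)"
    by (rule fmat_eqI) (simp add: ent_mult[OF N] ent_mult[OF cN] sum_distrib_left mult.assoc)
  show "A * (c *\<^sub>C B) = c *\<^sub>C (A * B)"
    by (rule fmat_eqI) (simp add: ent_mult[OF N] sum_distrib_left algebra_simps)
qed

lemma smul_neg [simp]: "c *\<^sub>C (- A) = - (c *\<^sub>C A)" "(- c) *\<^sub>C A = - (c *\<^sub>C A)"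
  by (auto intro!: fmat_eqI)

lemmas smul_simps = fm.scale_left_distrib fm.scale_right_distrib fm.scale_left_diff_distrib
  fm.scale_right_diff_distrib fm.scale_scale

lemma adj_simps [simp]: "adj (A + B) = adj A + adj B" "adj (A - B) = adj A - adj B" "adj (- A) = - adj A"
  "adj 0 = 0" "adj (c *\<^sub>C A) = cnj c *\<^sub>C adj A" "adj (adj A) = A" "adj (E i j) = E j i" "adj (Idm N) = Idm N"
  by (auto intro!: fmat_eqI)

lemma trn_simps [simp]: "trn (A + B) = trn A + trn B" "trn (A - B) = trn A - trn B" "trn (- A) = - trn A"
  "trn 0 = 0" "trn (c *\<^sub>C A) = c *\<^sub>C trn A" "trn (trn A) = A" "trn (E i j) = E j i" "trn (Idm N) = Idm N"
  "trn (adj A) = adj (trn A)"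
  by (auto intro!: fmat_eqI)

lemma adj_sum: "adj (\<Sum>x\<in>S. f x) = (\<Sum>x\<in>S. adj (f x))"
  by (induction S rule: infinite_finite_induct) auto

lemma adj_mult [simp]: "adj (A * B) = adj B * adj A"
proof -
  obtain N where N: "A \<in> corner N" "B \<in> corner N" by (rule corner_ex2)
  have B: "adj B \<in> corner N" using N by simp
  show ?thesis by (rule fmat_eqI) (simp add: ent_mult[OF N(1)] ent_mult[OF B] mult.commute)
qed

lemma trn_mult [simp]: "trn (A * B) = trn B * trn A"
proof -
  obtain N where N: "A \<in> corner N" "B \<in> corner N" by (rule corner_ex2)
  have B: "trn B \<in> corner N" using N by simp
  show ?thesis by (rule fmat_eqI) (simp add: ent_mult[OF N(1)] ent_mult[OF B] mult.commute)
qed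

lemma tr_corner: "A \<in> corner N \<Longrightarrow> tr A = (\<Sum>i<N. ent A i i)"
  unfolding tr_def by (rule sum.mono_neutral_left) (auto dest: rectD)

lemma tr_lin [simp]: "tr (A + B) = tr A + tr B" "tr (c *\<^sub>C A) = c * tr A" "tr (adj A) = cnj (tr A)"
  "tr (trn A) = tr A" "tr 0 = 0" "tr (- A) = - tr A" "tr (A - B) = tr A - tr B"
proof -
  obtain N where N: "A \<in> corner N" "B \<in> corner N" by (rule corner_ex2)
  show "tr (A + B) = tr A + tr B" "tr (A - B) = tr A - tr B" "tr (c *\<^sub>C A) = c * tr A"
    "tr (adj A) = cnj (tr A)" "tr (trn A) = tr A" "tr (- A) = - tr A"
    using N by (simp_all add: tr_corner[of _ N] sum.distrib sum_subtractf sum_negf sum_distrib_left)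
  show "tr 0 = 0" by (simp add: tr_def)
qed

lemma tr_sum: "tr (\<Sum>x\<in>S. f x) = (\<Sum>x\<in>S. tr (f x))"
  by (induction S rule: infinite_finite_induct) auto

lemma tr_mult: "tr (A * B) = tr (B * A)"
proof -
  obtain N where N: "A \<in> corner N" "B \<in> corner N" by (rule corner_ex2)
  have "tr (A * B) = (\<Sum>i<N. \<Sum>l<N. ent A i l * ent B l i)" using N by (simp add: tr_corner[of _ N] ent_mult[OF N(1)])
  also have "\<dots> = (\<Sum>l<N. \<Sum>i<N. ent A i l * ent B l i)" by (rule sum.swap)
  also have "\<dots> = tr (B * A)" using N by (simp add: tr_corner[of _ N] ent_mult[OF N(2)] mult.commute)
  finally show ?thesis .
qed

lemma tr_E [simp]: "tr (E i j) = (if i = j then 1 else 0)"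
proof -
  have "E i j \<in> corner (Suc (max i j))" by simp
  then have "tr (E i j) = (\<Sum>k<Suc (max i j). if k = i then (if i = j then 1 else 0) else 0)"
    by (simp only: tr_corner) (rule sum.cong, auto)
  then show ?thesis by simp
qed

lemma tr_Idm [simp]: "tr (Idm N) = of_nat N"
  unfolding Idm_def tr_sum by simp

lemma ent_E_mult: "ent (E i j * A) a b = (if a = i then ent A j b else 0)"
proof -
  have "E i j \<in> rect (Suc i) (Suc j)" by simp
  from ent_mult[OF this] have "ent (E i j * A) a b = (\<Sum>l<Suc j. if l = j then (if a = i then ent A j b else 0) else 0)"
    by simp
  then show ?thesis by simp
qed

lemma E_mult [simp]: "E i j * E k l = (if j = k then E i l else 0)"
  by (rule fmat_eqI) (auto simp: ent_E_mult)

lemma E_mult_assoc [simp]: "E i j * (E k l * A) = (if j = k then E i l * A else 0)"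
  by (simp add: mult.assoc[symmetric])

lemma ent_mult_E: "ent (A * E k l) a b = (if b = l then ent A a k else 0)"
proof -
  have "ent (A * E k l) a b = ent (trn (A * E k l)) b a" by (simp only: ent_more)
  also have "\<dots> = ent (E l k * trn A) b a" by (simp only: trn_mult trn_simps)
  finally show ?thesis by (simp add: ent_E_mult)
qed

lemma E_mid: "E i j * A * E k l = ent A j k *\<^sub>C E i l"
  by (rule fmat_eqI) (auto simp: ent_mult_E ent_E_mult)

lemma corner_expand: "A \<in> corner N \<Longrightarrow> A = (\<Sum>i<N. \<Sum>j<N. ent A i j *\<^sub>C E i j)"
proof (rule fmat_eqI)
  fix a b assume A: "A \<in> corner N"
  have "ent (\<Sum>i<N. \<Sum>j<N. ent A i j *\<^sub>C E i j) a b = (\<Sum>i<N. \<Sum>j<N. if i = a \<and> j = b then ent A a b else 0)"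
    unfolding ent_sum by (intro sum.cong) auto
  also have "\<dots> = (\<Sum>i<N. if i = a then (\<Sum>j<N. if j = b then ent A a b else 0) else 0)"
    by (intro sum.cong) auto
  also have "\<dots> = ent A a b" using rectD[OF A, of a b] by auto
  finally show "ent A a b = ent (\<Sum>i<N. \<Sum>j<N. ent A i j *\<^sub>C E i j) a b" ..
qed

lemma ent_Idm_mult: "ent (Idm M * A) i j = (if i < M then ent A i j else 0)"
proof -
  have "ent (Idm M * A) i j = (\<Sum>l<M. if l = i then ent A i j else 0)"
    unfolding Idm_def sum_distrib_right ent_sum by (rule sum.cong) (auto simp: ent_E_mult)
  then show ?thesis by simp
qed

lemma ent_mult_Idm: "ent (A * Idm N) i j = (if j < N then ent A i j else 0)"
proof -
  have "ent (A * Idm N) i j = ent (trn (A * Idm N)) j i" by (simp only: ent_more)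
  also have "\<dots> = ent (Idm N * trn A) j i" by (simp only: trn_mult trn_simps)
  finally show ?thesis by (simp add: ent_Idm_mult)
qed

lemma rect_iff: "A \<in> rect M N \<longleftrightarrow> Idm M * A = A \<and> A * Idm N = A"
proof
  assume "A \<in> rect M N"
  then show "Idm M * A = A \<and> A * Idm N = A" by (auto intro!: fmat_eqI simp: ent_Idm_mult ent_mult_Idm dest: rectD)
next
  assume A: "Idm M * A = A \<and> A * Idm N = A"
  show "A \<in> rect M N"
  proof (rule rectI)
    fix i j assume "ent A i j \<noteq> 0"
    then have "ent (Idm M * A) i j \<noteq> 0" "ent (A * Idm N) i j \<noteq> 0" using A by auto
    then show "i < M \<and> j < N" by (auto simp: ent_Idm_mult ent_mult_Idm split: if_splits)
  qed
qed

lemma corner_Idm [simp]: "A \<in> corner N \<Longrightarrow> Idm N * A = A" "A \<in> corner N \<Longrightarrow> A * Idm N = A"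
  "A \<in> corner N \<Longrightarrow> Idm N * (A * B) = A * B" "A \<in> corner N \<Longrightarrow> A * (Idm N * B) = A * B"
  by (metis mult.assoc rect_iff)+

lemma rect_Idm [simp]: "A \<in> rect M N \<Longrightarrow> Idm M * A = A" "A \<in> rect M N \<Longrightarrow> A * Idm N = A"
  by (metis rect_iff)+

lemma rect_Idm_assoc [simp]: "A \<in> rect M N \<Longrightarrow> Idm M * (A * B) = A * B" "A \<in> rect M N \<Longrightarrow> A * (Idm N * B) = A * B"
  by (metis mult.assoc rect_iff)+

subsection \<open>Positivity of the trace\<close>

lemma tr_adj_mult:
  assumes "A \<in> corner N" shows "tr (adj A * A) = of_real (\<Sum>i<N. \<Sum>j<N. (cmod (ent A j i))\<^sup>2)"
proof -
  have A: "adj A \<in> corner N" using assms by simp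
  then have "tr (adj A * A) = (\<Sum>i<N. ent (adj A * A) i i)" using assms by (intro tr_corner) simp
  then show ?thesis by (simp add: ent_mult[OF A] complex_norm_square mult.commute del: of_real_power)
qed

lemma tr_adj_pos: "Re (tr (adj A * A)) \<ge> 0" "Im (tr (adj A * A)) = 0"
  by (rule corner_ex[of A], simp add: tr_adj_mult sum_nonneg)+

lemma tr_adj_eq_0: assumes "tr (adj A * A) = 0" shows "A = 0"
proof (rule fmat_eqI)
  fix a b
  obtain N where N: "A \<in> corner N" by (rule corner_ex)
  have "(\<Sum>i<N. \<Sum>j<N. (cmod (ent A j i))\<^sup>2) = 0" using tr_adj_mult[OF N] assms of_real_eq_0_iff by metis
  then have "\<And>i j. i < N \<Longrightarrow> j < N \<Longrightarrow> ent A j i = 0"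
    by (simp add: sum_nonneg_eq_0_iff sum_nonneg)
  then show "ent A a b = ent 0 a b" using rectD[OF N, of a b] by auto
qed

subsection \<open>Projections and atoms\<close>

definition proj :: "fmat \<Rightarrow> bool" where "proj R \<longleftrightarrow> adj R = R \<and> R * R = R"

text \<open>For projections the trace is the rank, so an atom is the projection onto a line.\<close>

definition atom :: "fmat \<Rightarrow> bool" where "atom P \<longleftrightarrow> proj P \<and> tr P = 1"

lemma proj_assoc [simp]: "proj R \<Longrightarrow> R * R = R" "proj R \<Longrightarrow> R * (R * A) = R * A" "proj R \<Longrightarrow> adj R = R"
  by (auto simp: proj_def mult.assoc[symmetric])

lemma atomD [simp]: "atom P \<Longrightarrow> proj P" "atom P \<Longrightarrow> tr P = 1" by (auto simp: atom_def)

lemma proj_E [simp]: "proj (E i i)" and atom_E [simp]: "atom (E i i)" and proj_Idm [simp]: "proj (Idm N)"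
  and proj_0 [simp]: "proj 0"
  by (auto simp: proj_def atom_def)

lemma proj_commute: "proj R \<Longrightarrow> proj P \<Longrightarrow> R * P = P \<longleftrightarrow> P * R = P"
  by (metis adj_mult proj_def)

lemma proj_orth_commute: "proj R \<Longrightarrow> proj P \<Longrightarrow> R * P = 0 \<longleftrightarrow> P * R = 0"
  by (metis adj_mult proj_def adj_simps(4))

lemma tr_proj_proj:
  assumes "proj R" "proj P"
  shows "Re (tr (R * P)) \<ge> 0" "Im (tr (R * P)) = 0" "tr (R * P) = 0 \<longleftrightarrow> R * P = 0"
    "tr (R * P) = of_real (Re (tr (R * P)))"
proof -
  have e: "tr (R * P) = tr (adj (R * P) * (R * P))"
    using assms tr_mult[of "P" "R * P"] by (simp add: mult.assoc)
  show "Re (tr (R * P)) \<ge> 0" and im: "Im (tr (R * P)) = 0" unfolding e by (rule tr_adj_pos)+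
  show "tr (R * P) = 0 \<longleftrightarrow> R * P = 0" using e tr_adj_eq_0[of "R * P"] by auto
  show "tr (R * P) = of_real (Re (tr (R * P)))" using im by (simp add: complex_eq_iff)
qed

lemma tr_proj: assumes "proj R" shows "Re (tr R) \<ge> 0" "Im (tr R) = 0" "tr R = 0 \<longleftrightarrow> R = 0"
  using tr_proj_proj(1-3)[OF assms assms] assms by auto

lemma proj_diff: assumes "proj R" "proj P" "R * P = P" shows "proj (R - P)"
proof -
  have "P * R = P" using assms proj_commute by blast
  then show ?thesis using assms unfolding proj_def by (simp add: left_diff_distrib right_diff_distrib)
qed

lemma proj_compl: "proj R \<Longrightarrow> R \<in> corner N \<Longrightarrow> proj (Idm N - R)"
  by (rule proj_diff) auto

lemma proj_add: assumes "proj R" "proj P" "R * P = 0" shows "proj (R + P)"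
proof -
  have "P * R = 0" using assms proj_orth_commute by blast
  then show ?thesis using assms unfolding proj_def by (simp add: distrib_left distrib_right)
qed

lemma conj_mult:
  assumes "adj X * X = Idm k" "A \<in> corner k"
  shows "X * A * adj X * (X * B * adj X) = X * (A * B) * adj X"
proof -
  have "X * A * adj X * (X * B * adj X) = X * (A * (adj X * X) * B) * adj X" by (simp only: mult.assoc)
  then show ?thesis using assms by simp
qed

lemma proj_conj: "adj X * X = Idm k \<Longrightarrow> proj P \<Longrightarrow> P \<in> corner k \<Longrightarrow> proj (X * P * adj X)"
  unfolding proj_def by (simp only: conj_mult) (simp add: mult.assoc)

lemma tr_conj:
  assumes "adj X * X = Idm k" "P \<in> corner k" shows "tr (X * P * adj X) = tr P"
proof -
  have "tr (X * P * adj X) = tr (adj X * X * P)" using tr_mult[of "X * P" "adj X"] by (simp only: mult.assoc)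
  then show ?thesis using assms by simp
qed

text \<open>A projection of trace \<open>k\<close> is \<open>X X\<^sup>*\<close> for an isometry \<open>X\<close>: a nonzero diagonal
  entry gives a column of \<open>R\<close>, hence a rank one projection below \<open>R\<close>, which is split off.\<close>

lemma proj_isometry:
  assumes "proj R" "R \<in> corner N" "tr R = of_nat k"
  obtains X where "X \<in> rect N k" "adj X * X = Idm k" "X * adj X = R"
proof -
  have "\<exists>X \<in> rect N k. adj X * X = Idm k \<and> X * adj X = R" using assms
  proof (induction k arbitrary: R)
    case 0
    then have "R = 0" using tr_proj(3) by simp
    then show ?case by (intro bexI[of _ 0]) (auto simp: Idm_def)
  next
    case (Suc k)
    note R = Suc.prems
    have "tr R = (\<Sum>i<N. ent R i i)" by (rule tr_corner) (rule R(2))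
    with R(3) obtain j where j: "j < N" "ent R j j \<noteq> 0"
      using sum.neutral[of "{..<N}" "\<lambda>i. ent R i i"] by (metis lessThan_iff of_nat_eq_0_iff nat.distinct(1))
    have e: "ent R j j = tr (E j j * R)"
      using arg_cong[OF E_mid[of j j R j], of tr] tr_mult[of "E j j * R" "E j j"]
      by (simp)
    define r where "r = Re (ent R j j)"
    have r: "r > 0" "ent R j j = of_real r"
      using tr_proj_proj[OF proj_E[of j] R(1)] j(2) unfolding r_def e
      by (auto simp: complex_eq_iff)
    have sr: "complex_of_real (sqrt r) * complex_of_real (sqrt r) = of_real r"
      using r by (simp flip: of_real_mult)
    (* the j-th column of R, normalized and placed in column k *)
    define K where "K = (1 / of_real (sqrt r)) *\<^sub>C (R * E j k)"
    have KK: "adj K * K = E k k"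
      using R(1) r sr by (simp add: K_def mult.assoc[symmetric])
        (simp add: mult.assoc E_mid[unfolded mult.assoc])
    have KE: "K * E k k = K" by (simp add: K_def mult.assoc)
    have EK: "E k k * adj K = adj K" using arg_cong[OF KE, of adj] by simp
    define P where "P = K * adj K"
    have RK: "R * K = K" using R(1) by (simp add: K_def)
    have RP: "R * P = P" by (simp add: P_def mult.assoc[symmetric] RK)
    have "P * P = K * (adj K * K) * adj K" by (simp only: P_def mult.assoc)
    then have "P * P = P" by (simp only: KK KE) (simp only: P_def)
    then have P: "proj P" unfolding proj_def by (simp add: P_def)
    have trP: "tr P = 1" unfolding P_def by (subst tr_mult) (simp add: KK)
    have Kr: "K \<in> rect N (Suc k)" unfolding K_def using R(2) j(1) by (auto intro: rect_mult)
    have PN: "P \<in> corner N" unfolding P_def using Kr by (auto intro: rect_mult)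
    have "proj (R - P)" "R - P \<in> corner N" "tr (R - P) = of_nat k"
      using proj_diff[OF R(1) P RP] R PN trP by auto
    from Suc.IH[OF this] obtain X where X: "X \<in> rect N k" "adj X * X = Idm k" "X * adj X = R - P" by blast
    have XI: "Idm k * adj X = adj X" "X * Idm k = X" using X(1) rect_iff rect_closed(6)[OF X(1)] by blast+
    have "adj X * K = adj X * X * adj X * K" by (simp only: X(2) XI)
    also have "\<dots> = adj X * ((R - P) * K)" by (simp only: mult.assoc flip: X(3))
    also have "(R - P) * K = 0" by (simp add: left_diff_distrib RK P_def mult.assoc KK KE)
    finally have XK: "adj X * K = 0" by simp
    have KX: "adj K * X = 0" using arg_cong[OF XK, of adj] by simp
    have "X * adj K = X * Idm k * (E k k * adj K)" by (simp only: EK XI)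
    also have "\<dots> = X * (Idm k * E k k) * adj K" by (simp only: mult.assoc)
    also have "Idm k * E k k = 0"
      by (simp add: Idm_def sum_distrib_right)
    finally have XK': "X * adj K = 0" by simp
    have KX': "K * adj X = 0" using arg_cong[OF XK', of adj] by simp
    have "Idm (Suc k) = Idm k + E k k" by (simp add: Idm_def)
    moreover have "X \<in> rect N (Suc k)" using X(1) unfolding rect_def by force
    ultimately show ?case
      using Kr X XK KX XK' KX' KK
      by (intro bexI[of _ "X + K"]) (auto simp: algebra_simps P_def)
  qed
  then show ?thesis using that by blast
qed

lemma corner_1: "A \<in> corner 1 \<Longrightarrow> A = ent A 0 0 *\<^sub>C E 0 0"
  by (subst corner_expand) auto

lemma Idm_1: "Idm 1 = E 0 0" by (simp add: Idm_def)

text \<open>A rank one projection is \<open>x x\<^sup>*\<close> for a column \<open>x\<close>, and \<open>x\<^sup>* A x\<close> is a scalar.\<close>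

lemma atom_sandwich: assumes "atom Q" shows "Q * A * Q = tr (Q * A) *\<^sub>C Q"
proof -
  obtain N where N: "Q \<in> corner N" by (rule corner_ex)
  obtain X where X: "X \<in> rect N 1" "adj X * X = Idm 1" "X * adj X = Q"
    using proj_isometry[of Q N 1] assms N by auto
  have "adj X * A * X \<in> corner 1"
    using X(1) unfolding rect_iff by (simp add: mult.assoc[symmetric]) (metis X(1) adj_mult adj_simps(8) mult.assoc rect_iff)
  then obtain c where c: "adj X * A * X = c *\<^sub>C Idm 1" using corner_1 Idm_1 by metis
  have "Q * A * Q = X * (adj X * A * X) * adj X" by (simp add: X(3)[symmetric] mult.assoc)
  then have *: "Q * A * Q = c *\<^sub>C Q" using X(1,3) by (simp add: c)
  have "tr (Q * A) = tr (Q * A * Q)" using tr_mult[of "Q * A" Q] assms by (simp add: mult.assoc[symmetric])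
  with * have "c = tr (Q * A)" using assms by simp
  with * show ?thesis by simp
qed


subsection \<open>Passage between the two kinds of matrices\<close>

text \<open>\<open>T\<close> embeds the matrices of the statement into the infinite ones, forgetting the size, and \<open>J\<close>
  restores the size.\<close>

lift_definition T :: "complex mat \<Rightarrow> fmat"
  is "\<lambda>A i j. if i < dim_row A \<and> j < dim_col A then A $$ (i, j) else 0"
proof -
  fix A :: "complex mat"
  show "\<exists>N. \<forall>i j. (if i < dim_row A \<and> j < dim_col A then A $$ (i, j) else 0) \<noteq> 0 \<longrightarrow> i < N \<and> j < N"
    by (intro exI[of _ "max (dim_row A) (dim_col A)"]) (auto simp: less_max_iff_disj)
qed

definition J :: "nat \<Rightarrow> nat \<Rightarrow> fmat \<Rightarrow> complex mat" where
  "J nr nc A = mat nr nc (\<lambda>(i, j). ent A i j)"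

lemma ent_T [simp]: "ent (T A) i j = (if i < dim_row A \<and> j < dim_col A then A $$ (i, j) else 0)"
  by (rule T.rep_eq[THEN fun_cong, THEN fun_cong])

lemma J_carrier [simp]: "J nr nc A \<in> carrier_mat nr nc"
  by (simp add: J_def)

lemma T_rect [simp]: "A \<in> carrier_mat nr nc \<Longrightarrow> T A \<in> rect nr nc"
  by (auto intro!: rectI split: if_splits)

lemma T_J [simp]: "A \<in> rect nr nc \<Longrightarrow> T (J nr nc A) = A"
  by (rule fmat_eqI) (auto simp: J_def dest: rectD)

lemma J_T [simp]: "A \<in> carrier_mat nr nc \<Longrightarrow> J nr nc (T A) = A"
  by (rule eq_matI) (auto simp: J_def)

lemma T_inj: "A \<in> carrier_mat nr nc \<Longrightarrow> B \<in> carrier_mat nr nc \<Longrightarrow> T A = T B \<Longrightarrow> A = B"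
  by (metis J_T)

lemma T_mult:
  assumes "A \<in> carrier_mat nr n" "B \<in> carrier_mat n nc"
  shows "T (A * B) = T A * T B"
proof (rule fmat_eqI)
  fix i j
  have r: "T A \<in> rect nr n" using assms by simp
  show "ent (T (A * B)) i j = ent (T A * T B) i j"
    using assms by (auto simp: ent_mult[OF r] scalar_prod_def row_def col_def atLeast0LessThan intro!: sum.cong)
qed

lemma T_simps:
  "A \<in> carrier_mat nr nc \<Longrightarrow> B \<in> carrier_mat nr nc \<Longrightarrow> T (A + B) = T A + T B"
  "A \<in> carrier_mat nr nc \<Longrightarrow> B \<in> carrier_mat nr nc \<Longrightarrow> T (A - B) = T A - T B"
  "T (c \<cdot>\<^sub>m A) = c *\<^sub>C T A" "T (1\<^sub>m n) = Idm n" "T (transpose_mat A) = trn (T A)"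
  by (auto intro!: fmat_eqI)

lemma T_adj: "T (mat_adjoint A) = adj (T A)"
  by (rule fmat_eqI) (auto simp: mat_adjoint_def mat_of_rows_def conjugate_complex_def)

lemma mat_adjoint_carrier [simp]: "A \<in> carrier_mat nr nc \<Longrightarrow> mat_adjoint A \<in> carrier_mat nc nr"
  by (auto simp: mat_adjoint_def)

lemma T_trace: "A \<in> carrier_mat n n \<Longrightarrow> mat_trace A = tr (T A)"
  by (subst tr_corner[of _ n]) (auto simp: mat_trace_def)

subsection \<open>The spectral theorem\<close>

text \<open>An eigenvector is used through the projection onto the line that it spans.\<close>

lemma eigen_atom:
  assumes "K \<in> corner d" "d > 0"
  obtains P c where "atom P" "P \<in> corner d" "K * P = c *\<^sub>C P"
proof -
  define M where "M = J d d K"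
  have M: "M \<in> carrier_mat d d" by (simp add: M_def)
  from spectrum_non_empty[OF M assms(2)] obtain c where "eigenvalue M c" by (auto simp: spectrum_def)
  then obtain v where v: "v \<in> carrier_vec d" "v \<noteq> 0\<^sub>v d" "M *\<^sub>v v = c \<cdot>\<^sub>v v"
    using M by (auto simp: eigenvalue_def eigenvector_def)
  define V where "V = mat d 1 (\<lambda>(i, j). v $ i)"
  have V: "V \<in> carrier_mat d 1" by (simp add: V_def)
  have "M * V = c \<cdot>\<^sub>m V"
  proof (rule eq_matI)
    fix i j assume "i < dim_row (c \<cdot>\<^sub>m V)" "j < dim_col (c \<cdot>\<^sub>m V)"
    then have ij: "i < d" "j = 0" by (auto simp: V_def)
    have "col V 0 = v" using v(1) by (auto simp: V_def)
    then have "(M * V) $$ (i, j) = (M *\<^sub>v v) $ i" using ij M V by simp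
    then show "(M * V) $$ (i, j) = (c \<cdot>\<^sub>m V) $$ (i, j)" using ij v by (simp add: V_def)
  qed (use M V in auto)
  then have KV: "K * T V = c *\<^sub>C T V" using T_mult[OF M V] assms(1) by (simp add: T_simps M_def)
  have r: "T V \<in> rect d 1" using V by simp
  obtain i where "i < d" "v $ i \<noteq> 0" using v by (metis carrier_vecD eq_vecI index_zero_vec)
  then have "ent (T V) i 0 \<noteq> 0" by (simp add: V_def)
  then have nz: "T V \<noteq> 0" by (metis ent_simps(1))
  have "adj (T V) * T V \<in> corner 1" using r by (auto intro: rect_mult)
  then obtain a where a: "adj (T V) * T V = a *\<^sub>C Idm 1" using corner_1 Idm_1 by metis
  have "tr (adj (T V) * T V) = a" unfolding a by simp
  then have a0: "a \<noteq> 0" "cnj a = a" using tr_adj_eq_0[of "T V"] nz tr_adj_pos[of "T V"]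
    by (auto simp: complex_eq_iff)
  define P where "P = (1 / a) *\<^sub>C (T V * adj (T V))"
  have VI: "T V * Idm 1 = T V" using r rect_iff by blast
  have "T V * adj (T V) * (T V * adj (T V)) = T V * (adj (T V) * T V) * adj (T V)" by (simp only: mult.assoc)
  also have "\<dots> = a *\<^sub>C (T V * adj (T V))" by (simp only: a smul_mult VI)
  finally have "P * P = P" using a0 by (simp add: P_def)
  moreover have "adj P = P" using a0 by (simp add: P_def)
  ultimately have "proj P" unfolding proj_def by blast
  moreover have "tr P = 1"
    using tr_mult[of "T V" "adj (T V)"] a0 \<open>tr (adj (T V) * T V) = a\<close> by (simp add: P_def)
  moreover have "P \<in> corner d" unfolding P_def using r by (auto intro: rect_mult)
  moreover have "K * P = c *\<^sub>C P" by (simp add: P_def KV mult.assoc[symmetric] mult.commute)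
  ultimately show ?thesis using that unfolding atom_def by blast
qed

text \<open>An orthonormal basis enters only through the projections onto its lines.\<close>

definition frame :: "nat \<Rightarrow> (nat \<Rightarrow> fmat) \<Rightarrow> bool" where
  "frame N p \<longleftrightarrow> (\<forall>i<N. atom (p i) \<and> p i \<in> corner N) \<and> (\<forall>i<N. \<forall>j<N. i \<noteq> j \<longrightarrow> p i * p j = 0)
     \<and> (\<Sum>i<N. p i) = Idm N"

lemma frameD: assumes "frame N p"
  shows "i < N \<Longrightarrow> atom (p i)" "i < N \<Longrightarrow> p i \<in> corner N" "i < N \<Longrightarrow> j < N \<Longrightarrow> i \<noteq> j \<Longrightarrow> p i * p j = 0"
    "(\<Sum>i<N. p i) = Idm N"
  using assms by (auto simp: frame_def)

lemma frame_mult: "frame N p \<Longrightarrow> i < N \<Longrightarrow> j < N \<Longrightarrow> p i * p j = (if i = j then p i else 0)"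
  using frameD(1,3)[of N p i] by auto

lemma frame_E: "frame N (\<lambda>i. E i i)"
  by (auto simp: frame_def Idm_def)

lemma isometry_image:
  assumes "X \<in> rect N k" "adj X * X = Idm k" "P \<in> corner k"
  shows "X * P * adj X \<in> corner N" "proj P \<Longrightarrow> proj (X * P * adj X)" "atom P \<Longrightarrow> atom (X * P * adj X)"
    "X * adj X * (X * P * adj X) = X * P * adj X"
proof -
  show "X * P * adj X \<in> corner N" using assms(1,3) by (blast intro: rect_mult rect_closed)
  show "proj P \<Longrightarrow> proj (X * P * adj X)" "atom P \<Longrightarrow> atom (X * P * adj X)"
    using proj_conj[OF assms(2) _ assms(3)] tr_conj[OF assms(2,3)] unfolding atom_def by simp_all
  have "X * adj X * (X * P * adj X) = X * (adj X * X * P) * adj X" by (simp only: mult.assoc)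
  then show "X * adj X * (X * P * adj X) = X * P * adj X" using assms by simp
qed

text \<open>Splitting off an eigenprojection \<open>P\<close> and compressing to its complement by an isometry
  reduces the dimension by one.\<close>

lemma spectral:
  assumes "H \<in> corner d" "adj H = H"
  obtains p l where "frame d p" "H = (\<Sum>i<d. complex_of_real (l i) *\<^sub>C p i)"
proof -
  have "\<exists>p l. frame d p \<and> H = (\<Sum>i<d. complex_of_real (l i) *\<^sub>C p i)" using assms
  proof (induction d arbitrary: H)
    case 0
    then have "H = 0" using corner_expand by force
    then show ?case by (auto simp: frame_def Idm_def)
  next
    case (Suc d)
    let ?D = "Suc d"
    obtain P c where P: "atom P" "P \<in> corner ?D" "H * P = c *\<^sub>C P" using eigen_atom[OF Suc.prems(1)] by blast
    have pp: "proj P" "P * P = P" "adj P = P" "tr P = 1" using P(1) by auto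
    have PH: "P * H = cnj c *\<^sub>C P" using arg_cong[OF P(3), of adj] by (simp add: pp Suc.prems(2))
    have "c *\<^sub>C P = P * (H * P)" by (simp only: P(3) smul_mult pp)
    also have "\<dots> = cnj c *\<^sub>C P" by (simp only: PH smul_mult pp flip: mult.assoc)
    finally have "tr (c *\<^sub>C P) = tr (cnj c *\<^sub>C P)" by (rule arg_cong)
    then have cr: "cnj c = c" using pp(4) by simp
    define R where "R = Idm ?D - P"
    have R: "proj R" "R \<in> corner ?D" "tr R = of_nat d" using proj_compl[OF pp(1) P(2)] P by (auto simp: R_def)
    obtain X where X: "X \<in> rect ?D d" "adj X * X = Idm d" "X * adj X = R" using proj_isometry[OF R] .
    (* the compression of H to the complement of the eigenvector *)
    define H' where "H' = adj X * H * X"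
    have "H' \<in> corner d" unfolding H'_def using X(1) Suc.prems(1) by (blast intro: rect_mult rect_closed)
    moreover have "adj H' = H'" by (simp add: H'_def Suc.prems(2) mult.assoc)
    ultimately obtain q l where q: "frame d q" "H' = (\<Sum>i<d. complex_of_real (l i) *\<^sub>C q i)"
      using Suc.IH by blast
    define p where "p i = (if i < d then X * q i * adj X else P)" for i
    have RP: "R * P = 0" using P(2) by (simp add: R_def left_diff_distrib pp)
    have PR: "P * R = 0" using P(2) by (simp add: R_def right_diff_distrib pp)
    have XqX: "P * (X * q i * adj X) = 0" "X * q i * adj X * P = 0" if "i < d" for i
    proof -
      have "P * (X * q i * adj X) = P * (R * (X * q i * adj X))"
        using isometry_image(4)[OF X(1,2) frameD(2)[OF q(1) that]] by (simp only: X(3))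
      then show 1: "P * (X * q i * adj X) = 0" by (simp only: PR mult.assoc[symmetric]) simp
      have "adj (P * (X * q i * adj X)) = X * q i * adj X * P"
        using frameD(1)[OF q(1) that] by (simp add: pp mult.assoc)
      then show "X * q i * adj X * P = 0" using 1 by simp
    qed
    have sum: "(\<Sum>i<d. X * f i * adj X) = X * (\<Sum>i<d. f i) * adj X" for f
      by (simp add: sum_distrib_left sum_distrib_right)
    have "frame ?D p" unfolding frame_def
    proof (intro conjI allI impI)
      fix i assume i: "i < ?D"
      show "atom (p i)" "p i \<in> corner ?D"
        using P isometry_image(1,3)[OF X(1,2)] frameD(1,2)[OF q(1)] by (auto simp: p_def)
      fix j assume j: "j < ?D" "i \<noteq> j"
      show "p i * p j = 0"
        using conj_mult[OF X(2) frameD(2)[OF q(1)]] XqX frameD(3)[OF q(1)] i j by (auto simp: p_def)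
    next
      have "(\<Sum>i<?D. p i) = (\<Sum>i<d. X * q i * adj X) + P" by (simp add: p_def)
      also have "\<dots> = R + P" unfolding sum frameD(4)[OF q(1)] using X(1,3) unfolding rect_iff by (simp only:)
      finally show "(\<Sum>i<?D. p i) = Idm ?D" by (simp add: R_def)
    qed
    moreover have "H = (\<Sum>i<?D. complex_of_real ((l(d := Re c)) i) *\<^sub>C p i)"
    proof -
      have "(\<Sum>i<?D. complex_of_real ((l(d := Re c)) i) *\<^sub>C p i) =
        (\<Sum>i<d. X * (complex_of_real (l i) *\<^sub>C q i) * adj X) + c *\<^sub>C P"
        using cr by (simp add: p_def complex_eq_iff)
      also have "\<dots> = R * H * R + c *\<^sub>C P"
        unfolding sum q(2)[symmetric] H'_def by (simp only: X(3)[symmetric] mult.assoc)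
      also have "\<dots> = H" using Suc.prems(1) P(2) by (simp add: R_def left_diff_distrib right_diff_distrib mult.assoc P(3) PH cr pp)
      finally show ?thesis ..
    qed
    ultimately show ?case by blast
  qed
  then show ?thesis using that by blast
qed

text \<open>Every projection is a sum of orthogonal rank one projections, so orthogonal atoms
  can be completed to a frame.\<close>

lemma proj_atoms:
  assumes "proj R" "R \<in> corner N" "tr R = of_nat k"
  obtains q where "\<And>i. i < k \<Longrightarrow> atom (q i)" "\<And>i. i < k \<Longrightarrow> q i \<in> corner N" "\<And>i. i < k \<Longrightarrow> R * q i = q i"
    "\<And>i j. i < k \<Longrightarrow> j < k \<Longrightarrow> i \<noteq> j \<Longrightarrow> q i * q j = 0" "(\<Sum>i<k. q i) = R"
proof -
  obtain X where X: "X \<in> rect N k" "adj X * X = Idm k" "X * adj X = R" using proj_isometry[OF assms] .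
  show ?thesis
  proof (rule that[of "\<lambda>i. X * E i i * adj X"])
    fix i j assume i: "i < k"
    have Ei: "E i i \<in> corner k" using i by simp
    show "atom (X * E i i * adj X)" "X * E i i * adj X \<in> corner N" "R * (X * E i i * adj X) = X * E i i * adj X"
      using isometry_image[OF X(1,2) Ei] unfolding X(3) by auto
    assume "i \<noteq> j"
    then show "X * E i i * adj X * (X * E j j * adj X) = 0" by (simp add: conj_mult[OF X(2) Ei])
  next
    have "(\<Sum>i<k. X * E i i * adj X) = X * Idm k * adj X"
      by (simp add: Idm_def sum_distrib_left sum_distrib_right)
    then show "(\<Sum>i<k. X * E i i * adj X) = R" using X(1,3) unfolding rect_iff by (simp only:)
  qed
qed

lemma sub_projection:
  assumes "proj R" "R \<in> corner N" "tr R = of_nat k" "l \<le> k"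
  obtains S where "proj S" "S \<in> corner N" "tr S = of_nat l" "R * S = S"
proof -
  obtain X where X: "X \<in> rect N k" "adj X * X = Idm k" "X * adj X = R" using proj_isometry[OF assms(1-3)] .
  have c: "Idm l \<in> corner k" using assms(4) by (auto intro: corner_mono[of _ l])
  show ?thesis
    using that[of "X * Idm l * adj X"] isometry_image[OF X(1,2) c] tr_conj[OF X(2) c] by (simp add: X(3))
qed

lemma frame_extend:
  assumes "proj R" "R \<in> corner N" "tr R = of_nat k"
    and q: "\<And>i. i < k \<Longrightarrow> atom (q i)" "\<And>i. i < k \<Longrightarrow> q i \<in> corner N"
    "\<And>i j. i < k \<Longrightarrow> j < k \<Longrightarrow> i \<noteq> j \<Longrightarrow> q i * q j = 0" "(\<Sum>i<k. q i) = R" and "k \<le> N"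
  obtains p where "frame N p" "\<And>i. i < k \<Longrightarrow> p i = q i"
proof -
  define S where "S = Idm N - R"
  have S: "proj S" "S \<in> corner N" "tr S = of_nat (N - k)"
    using assms by (auto simp: S_def proj_compl of_nat_diff)
  from proj_atoms[OF this] obtain s where
    s: "\<And>i. i < N - k \<Longrightarrow> atom (s i)" "\<And>i. i < N - k \<Longrightarrow> s i \<in> corner N" "\<And>i. i < N - k \<Longrightarrow> S * s i = s i"
    "\<And>i j. i < N - k \<Longrightarrow> j < N - k \<Longrightarrow> i \<noteq> j \<Longrightarrow> s i * s j = 0" "(\<Sum>i<N - k. s i) = S" by blast
  have Rq: "q i * R = q i" if "i < k" for i
  proof -
    have "q i * R = (\<Sum>j<k. if j = i then q i else 0)"
      unfolding q(4)[symmetric] sum_distrib_left using that q(1,3) by (intro sum.cong) auto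
    then show ?thesis using that by simp
  qed
  have qs: "q i * s j = 0" "s j * q i = 0" if "i < k" "j < N - k" for i j
  proof -
    have "q i * s j = q i * R * (S * s j)" using that s(3) Rq by simp
    also have "\<dots> = q i * (R * S) * s j" by (simp only: mult.assoc)
    also have "R * S = 0" using assms(1,2) by (simp add: S_def right_diff_distrib)
    finally show "q i * s j = 0" by simp
    then show "s j * q i = 0" using q(1) s(1) that proj_orth_commute by auto
  qed
  define p where "p i = (if i < k then q i else s (i - k))" for i
  have "frame N p" unfolding frame_def
  proof (intro conjI allI impI)
    fix i assume i: "i < N"
    show "atom (p i)" "p i \<in> corner N" using i q s by (auto simp: p_def)
    fix j assume j: "j < N" "i \<noteq> j"
    show "p i * p j = 0" using i j q(3) s(4) qs by (auto simp: p_def)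
  next
    have "(\<Sum>i<N. p i) = (\<Sum>i<k. p i) + (\<Sum>i=k..<N. p i)"
      using \<open>k \<le> N\<close> by (metis atLeast0LessThan sum.atLeastLessThan_concat zero_le)
    also have "(\<Sum>i=k..<N. p i) = (\<Sum>i<N - k. p (i + k))"
      using sum.shift_bounds_nat_ivl[of p 0 k "N - k"] \<open>k \<le> N\<close> by (simp add: atLeast0LessThan)
    finally show "(\<Sum>i<N. p i) = Idm N" using q(4) s(5) by (simp add: p_def S_def)
  qed
  then show ?thesis using that by (auto simp: p_def)
qed

lemma frame_with_atom:
  assumes "atom P" "P \<in> corner N" "N > 0" obtains p where "frame N p" "p 0 = P"
proof -
  show ?thesis by (rule frame_extend[of P N 1 "\<lambda>_. P"]) (use assms that in auto)
qed

lemma frame_with_two_atoms: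
  assumes "atom P" "P \<in> corner N" "atom Q" "Q \<in> corner N" "P * Q = 0" "N \<ge> 2"
  obtains p where "frame N p" "p 0 = P" "p 1 = Q"
proof -
  have QP: "Q * P = 0" using assms(1,3,5) proj_orth_commute atomD(1) by blast
  define q where "q i = (if i = (0::nat) then P else Q)" for i
  have R: "proj (P + Q)" "P + Q \<in> corner N" "tr (P + Q) = of_nat 2"
    using assms by (auto intro: proj_add)
  have q: "atom (q i)" "q i \<in> corner N" for i using assms by (auto simp: q_def)
  have q2: "q i * q j = 0" if "i < 2" "j < 2" "i \<noteq> j" for i j
    using that assms(5) QP by (auto simp: q_def)
  have q3: "(\<Sum>i<2. q i) = P + Q" by (simp add: q_def numeral_2_eq_2)
  obtain p where p: "frame N p" "\<And>i. i < 2 \<Longrightarrow> p i = q i"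
    using frame_extend[OF R q q2 q3 assms(6)] by blast
  have "p 0 = P" "p 1 = Q" using p(2)[of 0] p(2)[of 1] by (auto simp: q_def)
  then show ?thesis using that p(1) by blast
qed


subsection \<open>Kronecker products\<close>

text \<open>As a matrix of any size has zeros outside, only the size \<open>n\<close> of the second factor has to be known
  in order to interleave the indices.\<close>

lift_definition kron :: "nat \<Rightarrow> fmat \<Rightarrow> fmat \<Rightarrow> fmat"
  is "\<lambda>n f g i j. if n = 0 then 0 else f (i div n) (j div n) * g (i mod n) (j mod n)"
proof -
  fix n and f g :: "nat \<Rightarrow> nat \<Rightarrow> complex"
  assume "\<exists>N. \<forall>i j. f i j \<noteq> 0 \<longrightarrow> i < N \<and> j < N"
  then obtain M where M: "\<And>i j. f i j \<noteq> 0 \<Longrightarrow> i < M \<and> j < M" by blast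
  show "\<exists>N. \<forall>i j. (if n = 0 then 0 else f (i div n) (j div n) * g (i mod n) (j mod n)) \<noteq> 0 \<longrightarrow> i < N \<and> j < N"
  proof (intro exI allI impI)
    fix i j assume "(if n = 0 then 0 else f (i div n) (j div n) * g (i mod n) (j mod n)) \<noteq> 0"
    then have "n > 0" "f (i div n) (j div n) \<noteq> 0" by (auto split: if_splits)
    then show "i < M * n \<and> j < M * n" using M by (simp flip: div_less_iff_less_mult)
  qed
qed

lemma ent_kron [simp]: "n > 0 \<Longrightarrow> ent (kron n A B) i j = ent A (i div n) (j div n) * ent B (i mod n) (j mod n)"
  by (simp add: kron.rep_eq)

lemma kron_lin:
  "kron n (A + A') B = kron n A B + kron n A' B" "kron n A (B + B') = kron n A B + kron n A B'"
  "kron n (c *\<^sub>C A) B = c *\<^sub>C kron n A B" "kron n A (c *\<^sub>C B) = c *\<^sub>C kron n A B"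
  "kron n 0 B = 0" "kron n A 0 = 0"
  by (auto intro!: fmat_eqI simp: kron.rep_eq algebra_simps)

lemma kron_sum_left: "kron n (\<Sum>x\<in>S. f x) B = (\<Sum>x\<in>S. kron n (f x) B)"
  by (induction S rule: infinite_finite_induct) (auto simp: kron_lin)

lemma kron_sum_right: "kron n A (\<Sum>x\<in>S. f x) = (\<Sum>x\<in>S. kron n A (f x))"
  by (induction S rule: infinite_finite_induct) (auto simp: kron_lin)

lemma kron_adj [simp]: "adj (kron n A B) = kron n (adj A) (adj B)"
  by (auto intro!: fmat_eqI simp: kron.rep_eq)

lemma kron_trn [simp]: "trn (kron n A B) = kron n (trn A) (trn B)"
  by (auto intro!: fmat_eqI simp: kron.rep_eq)

lemma kron_rect: "A \<in> corner m \<Longrightarrow> kron n A B \<in> corner (m * n)"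
  by (rule rectI) (auto simp: kron.rep_eq div_less_iff_less_mult split: if_splits dest!: rectD)

lemma sum_div_mod:
  fixes m n :: nat and f :: "nat \<Rightarrow> nat \<Rightarrow> 'a::comm_monoid_add"
  assumes "n > 0"
  shows "(\<Sum>l<m * n. f (l div n) (l mod n)) = (\<Sum>a<m. \<Sum>b<n. f a b)"
proof -
  have "(\<Sum>a<m. \<Sum>b<n. f a b) = (\<Sum>(a, b)\<in>{..<m} \<times> {..<n}. f a b)" by (rule sum.cartesian_product)
  also have "\<dots> = (\<Sum>l<m * n. f (l div n) (l mod n))"
  proof (rule sum.reindex_bij_witness[of _ "\<lambda>l. (l div n, l mod n)" "\<lambda>(a, b). a * n + b"])
    fix x assume "x \<in> {..<m} \<times> {..<n}"
    then obtain a b where x: "x = (a, b)" "a < m" "b < n" by auto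
    have "a * n + b < Suc a * n" using x by simp
    also have "\<dots> \<le> m * n" using x by (intro mult_le_mono1) simp
    finally show "(case x of (a, b) \<Rightarrow> a * n + b) \<in> {..<m * n}" using x by simp
  qed (use assms in \<open>auto simp: div_less_iff_less_mult\<close>)
  finally show ?thesis ..
qed

lemma kron_mult:
  assumes "n > 0" "B \<in> corner n"
  shows "kron n A B * kron n A' B' = kron n (A * A') (B * B')"
proof (rule fmat_eqI)
  fix i j
  obtain m where m: "A \<in> corner m" by (rule corner_ex)
  have "ent (kron n A B * kron n A' B') i j =
    (\<Sum>l<m * n. ent A (i div n) (l div n) * ent B (i mod n) (l mod n) * (ent A' (l div n) (j div n) * ent B' (l mod n) (j mod n)))"
    using assms by (simp add: ent_mult[OF kron_rect[OF m]])
  also have "\<dots> = (\<Sum>a<m. \<Sum>b<n. ent A (i div n) a * ent B (i mod n) b * (ent A' a (j div n) * ent B' b (j mod n)))"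
    by (rule sum_div_mod) (rule assms)
  also have "\<dots> = ent (kron n (A * A') (B * B')) i j"
    using assms by (simp add: ent_mult[OF m] ent_mult[OF assms(2)] sum_product algebra_simps)
  finally show "ent (kron n A B * kron n A' B') i j = ent (kron n (A * A') (B * B')) i j" .
qed

lemma tr_kron:
  assumes "n > 0" "B \<in> corner n" shows "tr (kron n A B) = tr A * tr B"
proof -
  obtain m where m: "A \<in> corner m" by (rule corner_ex)
  have "tr (kron n A B) = (\<Sum>l<m * n. ent A (l div n) (l div n) * ent B (l mod n) (l mod n))"
    using assms by (simp add: tr_corner[OF kron_rect[OF m]])
  also have "\<dots> = (\<Sum>a<m. \<Sum>b<n. ent A a a * ent B b b)" by (rule sum_div_mod) (rule assms)
  finally show ?thesis by (simp add: tr_corner[OF m] tr_corner[OF assms(2)] sum_product)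
qed

lemma kron_Idm: "n > 0 \<Longrightarrow> kron n (Idm m) (Idm n) = Idm (m * n)"
proof (rule fmat_eqI)
  fix i j assume n: "n > 0"
  have "i = j \<longleftrightarrow> i div n = j div n \<and> i mod n = j mod n" by (metis div_mult_mod_eq)
  then show "ent (kron n (Idm m) (Idm n)) i j = ent (Idm (m * n)) i j"
    using n by (auto simp: div_less_iff_less_mult)
qed

lemma kron_E: "c < n \<Longrightarrow> d < n \<Longrightarrow> kron n (E a b) (E c d) = E (a * n + c) (b * n + d)"
proof (rule fmat_eqI)
  fix i j assume cd: "c < n" "d < n"
  have "i = a * n + c \<longleftrightarrow> i div n = a \<and> i mod n = c" "j = b * n + d \<longleftrightarrow> j div n = b \<and> j mod n = d"
    using cd by auto
  then show "ent (kron n (E a b) (E c d)) i j = ent (E (a * n + c) (b * n + d)) i j"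
    using cd by auto
qed

lemma proj_kron:
  assumes "n > 0" "B \<in> corner n" "proj A" "proj B" shows "proj (kron n A B)"
  using assms unfolding proj_def by (simp add: kron_mult)

lemma atom_kron: "n > 0 \<Longrightarrow> B \<in> corner n \<Longrightarrow> atom A \<Longrightarrow> atom B \<Longrightarrow> atom (kron n A B)"
  using proj_kron[of n B A] tr_kron[of n B A] unfolding atom_def by simp

lemma T_kronecker:
  assumes "A \<in> carrier_mat m m" "B \<in> carrier_mat n n" "n > 0"
  shows "T (kronecker A B) = kron n (T A) (T B)"
proof (rule fmat_eqI)
  fix i j
  have "i < m * n \<longleftrightarrow> i div n < m" "j < m * n \<longleftrightarrow> j div n < m" "i mod n < n" "j mod n < n"
    using assms(3) by (simp_all add: div_less_iff_less_mult)
  then show "ent (T (kronecker A B)) i j = ent (kron n (T A) (T B)) i j"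
    using assms by (simp add: kronecker_def)
qed

section \<open>Projections of fixed rank\<close>

text \<open>The sets of compression traces \<open>tr (R A)\<close>, with \<open>R\<close> a projection of rank \<open>k\<close>, are \<open>k\<close> times the
  \<open>k\<close>-numerical ranges; projections behave better than isometries here because they can be added,
  complemented and multiplied.\<close>

definition kproj :: "nat \<Rightarrow> nat \<Rightarrow> fmat \<Rightarrow> bool" where
  "kproj N k R \<longleftrightarrow> proj R \<and> R \<in> corner N \<and> tr R = of_nat k"

definition krange :: "nat \<Rightarrow> nat \<Rightarrow> fmat \<Rightarrow> complex set" where
  "krange N k A = {tr (R * A) | R. kproj N k R}"

lemma kprojD: "kproj N k R \<Longrightarrow> proj R" "kproj N k R \<Longrightarrow> R \<in> corner N" "kproj N k R \<Longrightarrow> tr R = of_nat k"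
  by (auto simp: kproj_def)

lemma kproj_compl: "kproj N k R \<Longrightarrow> k \<le> N \<Longrightarrow> kproj N (N - k) (Idm N - R)"
  by (auto simp: kproj_def proj_compl of_nat_diff)

lemma tr_proj_le:
  assumes "kproj N k R" "proj P" "P \<in> corner N"
  shows "Re (tr (R * P)) \<le> Re (tr P)" "tr (R * P) = tr P \<Longrightarrow> R * P = P"
proof -
  have c: "proj (Idm N - R)" using assms by (auto simp: kproj_def proj_compl)
  have e: "(Idm N - R) * P = P - R * P" using assms(3) by (simp add: left_diff_distrib)
  show "Re (tr (R * P)) \<le> Re (tr P)" using tr_proj_proj(1)[OF c assms(2)] by (simp add: e)
  show "tr (R * P) = tr P \<Longrightarrow> R * P = P" using tr_proj_proj(3)[OF c assms(2)] by (simp add: e)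
qed

text \<open>Orthonormal families are indexed by arbitrary finite sets, since product bases are indexed by
  pairs.\<close>

definition orthofam :: "nat \<Rightarrow> 'a set \<Rightarrow> ('a \<Rightarrow> fmat) \<Rightarrow> bool" where
  "orthofam N I p \<longleftrightarrow> finite I \<and> (\<forall>i\<in>I. atom (p i) \<and> p i \<in> corner N) \<and> (\<forall>i\<in>I. \<forall>j\<in>I. i \<noteq> j \<longrightarrow> p i * p j = 0)"

lemma orthofamD: assumes "orthofam N I p"
  shows "finite I" "i \<in> I \<Longrightarrow> atom (p i)" "i \<in> I \<Longrightarrow> p i \<in> corner N" "i \<in> I \<Longrightarrow> j \<in> I \<Longrightarrow> i \<noteq> j \<Longrightarrow> p i * p j = 0"
  using assms by (auto simp: orthofam_def)

lemma orthofam_frame: "frame N p \<Longrightarrow> orthofam N {..<N} p"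
  by (auto simp: orthofam_def frame_def)

lemma orthofam_sum:
  assumes p: "orthofam N I p" and S: "S \<subseteq> I"
  shows "kproj N (card S) (\<Sum>i\<in>S. p i)" "i \<in> I \<Longrightarrow> (\<Sum>j\<in>S. p j) * p i = (if i \<in> S then p i else 0)"
proof -
  have fS: "finite S" using S orthofamD(1)[OF p] finite_subset by blast
  have *: "(\<Sum>j\<in>S. p j) * p i = (if i \<in> S then p i else 0)" if "i \<in> I" for i
  proof -
    have "(\<Sum>j\<in>S. p j) * p i = (\<Sum>j\<in>S. if j = i then p i else 0)"
      unfolding sum_distrib_right using that S orthofamD(2,4)[OF p] by (intro sum.cong) auto
    then show ?thesis using fS by simp
  qed
  show "i \<in> I \<Longrightarrow> (\<Sum>j\<in>S. p j) * p i = (if i \<in> S then p i else 0)" by (rule *)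
  have "(\<Sum>j\<in>S. p j) * (\<Sum>j\<in>S. p j) = (\<Sum>i\<in>S. p i)"
    unfolding sum_distrib_left using * S by (intro sum.cong) auto
  moreover have "adj (\<Sum>j\<in>S. p j) = (\<Sum>j\<in>S. p j)"
    unfolding adj_sum using S orthofamD(2)[OF p] by (intro sum.cong) auto
  moreover have "tr (\<Sum>j\<in>S. p j) = of_nat (card S)"
    unfolding tr_sum using S orthofamD(2)[OF p] by (simp add: subset_iff)
  moreover have "(\<Sum>j\<in>S. p j) \<in> corner N" using S orthofamD(3)[OF p] by blast
  ultimately show "kproj N (card S) (\<Sum>i\<in>S. p i)" unfolding kproj_def proj_def by blast
qed

text \<open>The diagonal of a projection of rank \<open>k\<close> in an orthonormal basis consists of numbers in \<open>[0, 1]\<close> with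
  sum \<open>k\<close>, which is what makes \<open>tr (R A)\<close> a weighted sum of eigenvalues.\<close>

lemma frame_coeffs:
  assumes p: "orthofam N I p" "(\<Sum>i\<in>I. p i) = Idm N" and R: "kproj N k R"
  shows "i \<in> I \<Longrightarrow> Re (tr (R * p i)) \<in> {0..1}" "(\<Sum>i\<in>I. Re (tr (R * p i))) = real k"
proof -
  show "Re (tr (R * p i)) \<in> {0..1}" if i: "i \<in> I"
    using tr_proj_proj(1)[OF kprojD(1)[OF R], of "p i"] tr_proj_le(1)[OF R, of "p i"] orthofamD(2,3)[OF p(1) i] by simp
  have "(\<Sum>i\<in>I. Re (tr (R * p i))) = Re (tr (R * (\<Sum>i\<in>I. p i)))" by (simp add: sum_distrib_left tr_sum)
  then show "(\<Sum>i\<in>I. Re (tr (R * p i))) = real k" using R by (simp add: p kproj_def)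
qed

lemma obtain_subset_between:
  assumes "finite I" "A \<subseteq> I" "B \<subseteq> I" "A \<inter> B = {}" "card A \<le> k" "card B \<le> card I - k" "k \<le> card I"
  obtains S where "A \<subseteq> S" "S \<subseteq> I" "S \<inter> B = {}" "card S = k"
proof -
  have fin: "finite A" "finite B" using assms(1-3) finite_subset by blast+
  have "card (I - B - A) = card I - card B - card A"
    using assms fin by (subst card_Diff_subset; force simp: card_Diff_subset)
  moreover have "card A + card B \<le> card I" using assms by linarith
  ultimately have "k - card A \<le> card (I - B - A)" using assms by linarith
  then obtain C where C: "C \<subseteq> I - B - A" "card C = k - card A" "finite C" by (rule obtain_subset_with_card_n)
  have "card (A \<union> C) = k" using C fin assms by (subst card_Un_disjoint) auto
  then show ?thesis using that[of "A \<union> C"] C assms by auto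
qed

text \<open>For Hermitian \<open>A\<close> all sums of \<open>k\<close> eigenvalues vanish; exchanging one index shows that the eigenvalues
  are equal, hence zero.  The general case follows by splitting \<open>A\<close> into its Hermitian parts.\<close>

lemma krange_eq_0:
  assumes A: "A \<in> corner N" and k: "1 \<le> k" "k < N" and R: "\<And>R. kproj N k R \<Longrightarrow> tr (R * A) = 0"
  shows "A = 0"
proof -
  have herm: "H = 0" if H: "H \<in> corner N" "adj H = H" and RH: "\<And>R. kproj N k R \<Longrightarrow> tr (R * H) = 0" for H
  proof -
    obtain p l where p: "frame N p" "H = (\<Sum>i<N. complex_of_real (l i) *\<^sub>C p i)" using spectral[OF H] by blast
    note o = orthofam_frame[OF p(1)]
    have S: "(\<Sum>i\<in>S. l i) = 0" if "S \<subseteq> {..<N}" "card S = k" for S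
    proof -
      have "0 = tr ((\<Sum>i\<in>S. p i) * H)" using RH orthofam_sum(1)[OF o that(1)] that(2) by simp
      also have "(\<Sum>i\<in>S. p i) * H = (\<Sum>i<N. if i \<in> S then complex_of_real (l i) *\<^sub>C p i else 0)"
        unfolding p(2) sum_distrib_left using orthofam_sum(2)[OF o that(1)] by (intro sum.cong) auto
      also have "\<dots> = (\<Sum>i\<in>S. complex_of_real (l i) *\<^sub>C p i)"
        using that(1) by (simp add: sum.If_cases Int_absorb1)
      also have "tr \<dots> = complex_of_real (\<Sum>i\<in>S. l i)"
        using that(1) frameD(1)[OF p(1)] by (auto simp: tr_sum intro!: sum.cong)
      finally show ?thesis by (metis of_real_eq_0_iff)
    qed
    have eq: "l i = l j" if ij: "i < N" "j < N" "i \<noteq> j" for i j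
    proof -
      obtain S where S': "{i} \<subseteq> S" "S \<subseteq> {..<N}" "S \<inter> {j} = {}" "card S = k"
        by (rule obtain_subset_between[of "{..<N}" "{i}" "{j}" k]) (use ij k in auto)
      have fS: "finite S" using S' finite_subset by blast
      have "card (insert j (S - {i})) = k" using S' fS k by (subst card_insert_disjoint) auto
      then have "(\<Sum>x\<in>insert j (S - {i}). l x) = 0" using S' ij by (intro S) auto
      moreover have "(\<Sum>x\<in>S. l x) = l i + (\<Sum>x\<in>S - {i}. l x)" using S' fS by (simp add: sum.remove)
      ultimately show ?thesis using S[OF S'(2,4)] S' fS by simp
    qed
    have "l i = 0" if "i < N" for i
    proof -
      have "(\<Sum>j<k. l j) = (\<Sum>j<k. l i)" using eq that k by (intro sum.cong refl) (metis lessThan_iff less_trans)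
      then show ?thesis using S[of "{..<k}"] k by auto
    qed
    then show ?thesis using p(2) by simp
  qed
  have tr_adj: "tr (R * adj A) = cnj (tr (R * A))" if "kproj N k R" for R
    using kprojD(1)[OF that] tr_mult[of R "adj A"] tr_lin(3)[of "R * A"] by simp
  have "A + adj A = 0" using A R tr_adj by (intro herm) (auto simp: distrib_left)
  moreover have "\<i> *\<^sub>C (A - adj A) = 0" using A R tr_adj
    by (intro herm) (auto simp: right_diff_distrib smul_simps)
  then have "A - adj A = 0" by simp
  ultimately have "A + A = 0" by simp
  then show ?thesis by (auto intro!: fmat_eqI dest: arg_cong[of _ _ "\<lambda>X. ent X _ _"])
qed

lemma krange_real_imp_hermitian:
  assumes A: "A \<in> corner N" and k: "1 \<le> k" "k < N" and R: "\<And>z. z \<in> krange N k A \<Longrightarrow> Im z = 0"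
  shows "adj A = A"
proof -
  have "A - adj A = 0"
  proof (rule krange_eq_0[OF _ k])
    fix P assume P: "kproj N k P"
    have "tr (P * adj A) = cnj (tr (P * A))"
      using kprojD(1)[OF P] tr_mult[of P "adj A"] tr_lin(3)[of "P * A"] by simp
    moreover have "Im (tr (P * A)) = 0" using R P unfolding krange_def by blast
    ultimately show "tr (P * (A - adj A)) = 0" by (simp add: right_diff_distrib complex_eq_iff)
  qed (use A in auto)
  then show ?thesis by simp
qed


subsection \<open>Positive matrices\<close>

text \<open>Positivity is stated as a factorization because then \<open>tr (R M)\<close> is the squared Hilbert-Schmidt norm of
  \<open>B R\<close>, so its vanishing gives \<open>R M = 0\<close>.\<close>

definition psd :: "nat \<Rightarrow> fmat \<Rightarrow> bool" where
  "psd N M \<longleftrightarrow> (\<exists>B \<in> corner N. M = adj B * B)"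

lemma psd_corner: "psd N M \<Longrightarrow> M \<in> corner N" and psd_adj: "psd N M \<Longrightarrow> adj M = M"
  by (auto simp: psd_def)

lemma psd_tr: assumes "psd N M" shows "Re (tr M) \<ge> 0" "Im (tr M) = 0" "tr M = 0 \<Longrightarrow> M = 0"
  using assms tr_adj_pos unfolding psd_def by (auto dest: tr_adj_eq_0)

lemma psd_tr_proj:
  assumes M: "psd N M" and R: "proj R"
  shows "Re (tr (R * M)) \<ge> 0" "Im (tr (R * M)) = 0" "tr (R * M) = 0 \<Longrightarrow> R * M = 0"
proof -
  obtain B where B: "B \<in> corner N" "M = adj B * B" using M by (auto simp: psd_def)
  have e: "tr (R * M) = tr (adj (B * R) * (B * R))"
    using R tr_mult[of "R * adj B * B" R] by (simp add: B mult.assoc)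
  show "Re (tr (R * M)) \<ge> 0" "Im (tr (R * M)) = 0" unfolding e by (rule tr_adj_pos)+
  assume "tr (R * M) = 0"
  then have "B * R = 0" using e tr_adj_eq_0 by metis
  then have "adj (B * R) = 0" by simp
  then have "R * adj B = 0" using R by simp
  then show "R * M = 0" by (simp add: B mult.assoc[symmetric])
qed

lemma psd_tr_compl:
  assumes M: "psd N M" and R: "kproj N k R"
  shows "Re (tr (R * M)) \<le> Re (tr M)" "tr (R * M) = tr M \<Longrightarrow> R * M = M"
proof -
  have c: "proj (Idm N - R)" using R by (auto simp: kproj_def proj_compl)
  have e: "(Idm N - R) * M = M - R * M" using psd_corner[OF M] by (simp add: left_diff_distrib)
  show "Re (tr (R * M)) \<le> Re (tr M)" using psd_tr_proj(1)[OF M c] by (simp add: e)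
  show "tr (R * M) = tr M \<Longrightarrow> R * M = M" using psd_tr_proj(3)[OF M c] by (simp add: e)
qed

lemma psd_combination:
  assumes p: "frame N p" and "S \<subseteq> {..<N}" "\<And>i. i \<in> S \<Longrightarrow> l i \<ge> 0"
  shows "psd N (\<Sum>i\<in>S. complex_of_real (l i) *\<^sub>C p i)"
proof -
  define B where "B = (\<Sum>i\<in>S. complex_of_real (sqrt (l i)) *\<^sub>C p i)"
  have fS: "finite S" using assms finite_subset by blast
  have SN: "i < N" if "i \<in> S" for i using that assms(2) by auto
  have "adj B = B" unfolding B_def adj_sum using assms(2) frameD(1)[OF p] by (intro sum.cong) auto
  moreover have "B * B = (\<Sum>i\<in>S. complex_of_real (l i) *\<^sub>C p i)"
  proof -
    have "B * p j = complex_of_real (sqrt (l j)) *\<^sub>C p j" if "j \<in> S" for j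
    proof -
      have "B * p j = (\<Sum>i\<in>S. if i = j then complex_of_real (sqrt (l j)) *\<^sub>C p j else 0)"
        unfolding B_def sum_distrib_right using that SN frame_mult[OF p] by (intro sum.cong refl) (simp add: SN)
      then show ?thesis using fS that by simp
    qed
    moreover have "B * B = (\<Sum>j\<in>S. complex_of_real (sqrt (l j)) *\<^sub>C (B * p j))"
      by (subst (2) B_def) (simp add: sum_distrib_left)
    ultimately show ?thesis using assms(3) by (auto intro!: sum.cong simp flip: of_real_mult)
  qed
  moreover have "B \<in> corner N" unfolding B_def using assms(2) frameD(2)[OF p] by (intro rect_sum) auto
  ultimately show ?thesis unfolding psd_def by metis
qed

subsection \<open>Partial sums of real numbers\<close>

lemma top_set:
  fixes l :: "'a \<Rightarrow> real"
  assumes "finite A" "s \<le> card A"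
  obtains S g where "S \<subseteq> A" "card S = s" "\<And>i. i \<in> S \<Longrightarrow> l i \<ge> g" "\<And>i. i \<in> A - S \<Longrightarrow> l i \<le> g"
proof -
  have "\<exists>S g. S \<subseteq> A \<and> card S = s \<and> (\<forall>i\<in>S. l i \<ge> g) \<and> (\<forall>i\<in>A - S. l i \<le> g)" using assms(2)
  proof (induction s)
    case 0
    have "\<forall>i\<in>A. l i \<le> Max (l ` A)" using assms(1) by auto
    then show ?case by (intro exI[of _ "{}"]) auto
  next
    case (Suc s)
    then obtain S g where S: "S \<subseteq> A" "card S = s" "\<forall>i\<in>S. l i \<ge> g" "\<forall>i\<in>A - S. l i \<le> g" by auto
    have fS: "finite S" using S assms finite_subset by blast
    have ne: "A - S \<noteq> {}"
    proof
      assume "A - S = {}"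
      then have "card A \<le> card S" using fS by (intro card_mono) auto
      then show False using Suc.prems S(2) by simp
    qed
    have "Max (l ` (A - S)) \<in> l ` (A - S)" using ne assms(1) by (intro Max_in) auto
    then obtain j where j: "j \<in> A - S" "l j = Max (l ` (A - S))" by auto
    have le: "\<forall>i\<in>A - S. l i \<le> l j" using j assms(1) by auto
    show ?case
    proof (intro exI conjI)
      show "insert j S \<subseteq> A" "card (insert j S) = Suc s" using S j fS by auto
      show "\<forall>i\<in>insert j S. l i \<ge> l j" using S j by force
      show "\<forall>i\<in>A - insert j S. l i \<le> l j" using le by auto
    qed
  qed
  then show ?thesis using that by blast
qed

text \<open>Weights in \<open>[0, 1]\<close> of total \<open>s\<close> cannot exceed the sum of the \<open>s\<close> largest values: after subtracting
  the threshold the weighted sum can only grow when the weights become the indicator of \<open>S\<close>.\<close>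

lemma top_set_bound:
  fixes l t :: "'a \<Rightarrow> real"
  assumes "finite A" "S \<subseteq> A" "\<And>i. i \<in> S \<Longrightarrow> l i \<ge> g" "\<And>i. i \<in> A - S \<Longrightarrow> l i \<le> g"
    and t: "\<And>i. i \<in> A \<Longrightarrow> t i \<in> {0..1}" "(\<Sum>i\<in>A. t i) = card S"
  shows "(\<Sum>i\<in>A. l i * t i) \<le> (\<Sum>i\<in>S. l i)"
proof -
  have fS: "finite S" using assms finite_subset by blast
  have "(\<Sum>i\<in>A. l i * t i) - g * card S = (\<Sum>i\<in>A. (l i - g) * t i)"
    by (simp add: t(2)[symmetric] left_diff_distrib sum_subtractf sum_distrib_left)
  also have "\<dots> \<le> (\<Sum>i\<in>A. if i \<in> S then l i - g else 0)"
  proof (rule sum_mono)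
    fix i assume i: "i \<in> A"
    show "(l i - g) * t i \<le> (if i \<in> S then l i - g else 0)"
      using assms(3)[of i] assms(4)[of i] t(1)[OF i] i
      by (auto simp: mult_left_le mult_nonpos_nonneg)
  qed
  also have "\<dots> = (\<Sum>i\<in>S. l i) - g * card S"
    using assms(1,2) by (simp add: sum.If_cases Int_absorb1 sum_subtractf)
  finally show ?thesis by simp
qed

text \<open>The arithmetic behind positivity.  If all sums of \<open>k\<close> of the eigenvalues lie in \<open>[0, 1]\<close>
  and both bounds are attained, then their total is at least or at most \<open>1\<close>, according to the
  sign of \<open>N - 2k\<close>; when it equals \<open>1\<close> and \<open>N \<noteq> 2k\<close>, the largest eigenvalues carry all of it
  and no eigenvalue is negative.\<close>

lemma extreme_sums:
  fixes l :: "'a \<Rightarrow> real"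
  assumes A: "finite A" "card A = N" and k: "1 \<le> k" "k < N"
    and b: "\<And>S. S \<subseteq> A \<Longrightarrow> card S = k \<Longrightarrow> 0 \<le> sum l S \<and> sum l S \<le> 1"
    and S: "S \<subseteq> A" "card S = k" "\<And>i. i \<in> S \<Longrightarrow> l i \<ge> g" "\<And>i. i \<in> A - S \<Longrightarrow> l i \<le> g" "sum l S = 1"
    and Z: "Z \<subseteq> A" "card Z = k" "\<And>i. i \<in> Z \<Longrightarrow> l i \<le> h" "\<And>i. i \<in> A - Z \<Longrightarrow> l i \<ge> h" "sum l Z = 0"
  shows "2 * k \<le> N \<Longrightarrow> sum l A \<ge> 1" "N \<le> 2 * k \<Longrightarrow> sum l A \<le> 1"
    "2 * k \<noteq> N \<Longrightarrow> sum l A = 1 \<Longrightarrow> i \<in> A \<Longrightarrow> l i \<ge> 0"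
proof -
  have fin: "finite S" "finite Z" using S(1) Z(1) A(1) finite_subset by blast+
  have cS: "card (A - S) = N - k" "card (A - Z) = N - k"
    using S(1,2) Z(1,2) A fin by (auto simp: card_Diff_subset)
  have sS: "sum l A = 1 + sum l (A - S)" "sum l A = sum l (A - Z)"
    using S(1,5) Z(1,5) A(1) sum.subset_diff[of S A l] sum.subset_diff[of Z A l] by auto
  have big: "sum l (A - S) \<ge> 0 \<and> (2 * k < N \<longrightarrow> sum l (A - S) = 0 \<longrightarrow> (\<forall>i\<in>A. l i \<ge> 0))" if kN: "2 * k \<le> N"
  proof -
    (* the k smallest eigenvalues outside the k largest ones; their sum is nonnegative, and so are the remaining ones *)
    obtain Y y where Y: "Y \<subseteq> A - S" "card Y = k" "\<And>i. i \<in> Y \<Longrightarrow> - l i \<ge> y" "\<And>i. i \<in> (A - S) - Y \<Longrightarrow> - l i \<le> y"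
      by (rule top_set[of "A - S" k "\<lambda>i. - l i"]) (use A cS kN in auto)
    have fY: "finite Y" using Y(1) A(1) finite_subset by blast
    have bY: "sum l Y \<ge> 0" using b[of Y] Y(1,2) by blast
    have "sum l Y \<le> (\<Sum>i\<in>Y. - y)" using Y(3) by (intro sum_mono) force
    then have "real k * y \<le> 0" using bY Y(2) by simp
    then have y: "y \<le> 0" using k by (simp add: mult_le_0_iff)
    have rest: "\<And>i. i \<in> (A - S) - Y \<Longrightarrow> l i \<ge> 0" using Y(4) y by force
    then have s: "sum l ((A - S) - Y) \<ge> 0" by (rule sum_nonneg)
    have split: "sum l (A - S) = sum l ((A - S) - Y) + sum l Y"
      using Y(1) A(1) by (intro sum.subset_diff) auto
    have "\<forall>i\<in>A. l i \<ge> 0" if *: "2 * k < N" "sum l (A - S) = 0"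
    proof -
      have z: "sum l ((A - S) - Y) = 0" "sum l Y = 0" using split s bY *(2) by auto
      have zr: "\<And>i. i \<in> (A - S) - Y \<Longrightarrow> l i = 0"
        using z(1) rest A(1) by (subst (asm) sum_nonneg_eq_0_iff) auto
      have "card ((A - S) - Y) = N - k - k" using Y(1,2) cS fY by (simp add: card_Diff_subset)
      then obtain j where j: "j \<in> (A - S) - Y" using *(1) by (metis card.empty diff_is_0_eq ex_in_conv mult_2 not_le le_diff_conv2 less_imp_le_nat add_leD1 diff_diff_left)
      then have "y = 0" using y zr[OF j] Y(4)[OF j] by simp
      then have nY: "\<And>i. i \<in> Y \<Longrightarrow> - l i \<ge> 0" using Y(3) by force
      have "(\<Sum>i\<in>Y. - l i) = 0" using z(2) by (simp add: sum_negf)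
      then have zY: "\<And>i. i \<in> Y \<Longrightarrow> l i = 0"
        using nY fY by (subst (asm) sum_nonneg_eq_0_iff) auto
      have "g \<ge> 0" using S(4)[of j] zr[OF j] j by simp
      then show ?thesis using S(3) zr zY by force
    qed
    then show ?thesis using s split bY by auto
  qed
  have small: "sum l (A - Z) \<le> 1 \<and> (sum l (A - Z) = 1 \<longrightarrow> N < 2 * k \<longrightarrow> (\<forall>i\<in>A. l i \<ge> 0))" if "N \<le> 2 * k"
  proof -
    let ?s = "2 * k - N"
    (* k exceeds N - k by ?s; adding the ?s largest of the k smallest eigenvalues to the others gives a sum of k of them *)
    obtain Y y where Y: "Y \<subseteq> Z" "card Y = ?s" "\<And>i. i \<in> Y \<Longrightarrow> l i \<ge> y" "\<And>i. i \<in> Z - Y \<Longrightarrow> l i \<le> y"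
      by (rule top_set[of Z ?s l]) (use fin Z k in auto)
    have fY: "finite Y" using Y(1) fin finite_subset by blast
    have split: "sum l Z = sum l (Z - Y) + sum l Y"
      using Y(1) fin by (intro sum.subset_diff) auto
    have Y0: "sum l Y \<ge> 0"
    proof (cases "y \<ge> 0")
      case True
      then show ?thesis using Y(3) by (intro sum_nonneg) force
    next
      case False
      then have "sum l (Z - Y) \<le> 0" using Y(4) by (intro sum_nonpos) force
      then show ?thesis using split Z(5) by simp
    qed
    have c: "card (A - Z \<union> Y) = k" using fY A(1) Y(1,2) cS k that
      by (subst card_Un_disjoint) auto
    have "sum l (A - Z \<union> Y) = sum l (A - Z) + sum l Y" using fY A(1) Y(1) by (intro sum.union_disjoint) auto
    moreover have "sum l (A - Z \<union> Y) \<le> 1" using b[of "A - Z \<union> Y"] c Y(1) Z(1) by blast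
    ultimately have le: "sum l (A - Z) + sum l Y \<le> 1" by simp
    have "\<forall>i\<in>A. l i \<ge> 0" if *: "N < 2 * k" "sum l (A - Z) = 1"
    proof -
      have Yz: "sum l Y = 0" using le Y0 * by simp
      have "(\<Sum>i\<in>Y. y) \<le> sum l Y" using Y(3) by (intro sum_mono) auto
      then have y: "y \<le> 0" using Yz Y(2) *(1) by (simp add: mult_le_0_iff)
      have nr: "\<And>i. i \<in> Z - Y \<Longrightarrow> - l i \<ge> 0" using Y(4) y by force
      have "(\<Sum>i\<in>Z - Y. - l i) = 0" using split Z(5) Yz by (simp add: sum_negf)
      then have zr: "\<And>i. i \<in> Z - Y \<Longrightarrow> l i = 0"
        using nr fin by (subst (asm) sum_nonneg_eq_0_iff) auto
      have "card (Z - Y) = k - ?s" using Y(1,2) Z(2) fY by (simp add: card_Diff_subset)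
      then have "card (Z - Y) > 0" using k by simp
      then obtain j where j: "j \<in> Z - Y" by (metis card_gt_0_iff ex_in_conv)
      then have "y = 0" using y zr[OF j] Y(4)[OF j] by simp
      then have "\<And>i. i \<in> Y \<Longrightarrow> l i \<ge> 0" using Y(3) by force
      then have zY: "\<And>i. i \<in> Y \<Longrightarrow> l i = 0"
        using Yz fY by (subst (asm) sum_nonneg_eq_0_iff) auto
      have "h \<ge> 0" using Z(3)[of j] zr[OF j] j by simp
      then show ?thesis using Z(4) zr zY by force
    qed
    then show ?thesis using le Y0 by auto
  qed
  show "2 * k \<le> N \<Longrightarrow> sum l A \<ge> 1" using big sS(1) by simp
  show "N \<le> 2 * k \<Longrightarrow> sum l A \<le> 1" using small sS(2) by simp
  show "l i \<ge> 0" if "2 * k \<noteq> N" "sum l A = 1" "i \<in> A"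
  proof (cases "2 * k < N")
    case True
    then show ?thesis using big sS(1) that by simp
  next
    case False
    then show ?thesis using small sS(2) that by simp
  qed
qed

subsection \<open>Matrices whose rank k compressions have traces filling the unit interval\<close>

text \<open>This is what is known at first about the image of a rank one projection: for \<open>1 \<le> k < N\<close> the numbers
  \<open>tr (R P)\<close> with \<open>P\<close> of rank one fill the interval \<open>[0, 1]\<close>.\<close>

definition unit_krange :: "nat \<Rightarrow> nat \<Rightarrow> fmat \<Rightarrow> bool" where
  "unit_krange N k Q \<longleftrightarrow> Q \<in> corner N \<and> adj Q = Q \<and>
     (\<forall>R. kproj N k R \<longrightarrow> Re (tr (R * Q)) \<in> {0..1}) \<and>
     (\<exists>R. kproj N k R \<and> tr (R * Q) = 1) \<and> (\<exists>R. kproj N k R \<and> tr (R * Q) = 0)"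

lemma unit_krange_spectrum:
  assumes Q: "unit_krange N k Q" and k: "1 \<le> k" "k < N"
  obtains p l S g Z h where "frame N p" "Q = (\<Sum>i<N. complex_of_real (l i) *\<^sub>C p i)"
    "S \<subseteq> {..<N}" "card S = k" "\<And>i. i \<in> S \<Longrightarrow> l i \<ge> g" "\<And>i. i \<in> {..<N} - S \<Longrightarrow> l i \<le> g" "sum l S = 1"
    "Z \<subseteq> {..<N}" "card Z = k" "\<And>i. i \<in> Z \<Longrightarrow> l i \<le> h" "\<And>i. i \<in> {..<N} - Z \<Longrightarrow> l i \<ge> h" "sum l Z = 0"
    "\<And>S. S \<subseteq> {..<N} \<Longrightarrow> card S = k \<Longrightarrow> 0 \<le> sum l S \<and> sum l S \<le> 1"
    "tr Q = of_real (sum l {..<N})"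
proof -
  have Q': "Q \<in> corner N" "adj Q = Q" using Q by (auto simp: unit_krange_def)
  obtain p l where p: "frame N p" "Q = (\<Sum>i<N. complex_of_real (l i) *\<^sub>C p i)" using spectral[OF Q'] by blast
  note o = orthofam_frame[OF p(1)]
  have trR: "Re (tr (R * Q)) = (\<Sum>i<N. l i * Re (tr (R * p i)))" for R
    unfolding p(2) by (simp add: sum_distrib_left tr_sum)
  have b: "0 \<le> sum l S \<and> sum l S \<le> 1" if S: "S \<subseteq> {..<N}" "card S = k" for S
  proof -
    have "Re (tr ((\<Sum>i\<in>S. p i) * Q)) = (\<Sum>i<N. if i \<in> S then l i else 0)"
      unfolding trR using orthofam_sum(2)[OF o S(1)] frameD(1)[OF p(1)] by (intro sum.cong) auto
    also have "\<dots> = sum l S" using S(1) by (simp add: sum.If_cases Int_absorb1)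
    finally show ?thesis using Q orthofam_sum(1)[OF o S(1)] S(2) unfolding unit_krange_def by fastforce
  qed
  obtain S g where S: "S \<subseteq> {..<N}" "card S = k" "\<And>i. i \<in> S \<Longrightarrow> l i \<ge> g" "\<And>i. i \<in> {..<N} - S \<Longrightarrow> l i \<le> g"
    using top_set[of "{..<N}" k l] k by auto
  obtain Z y where Z: "Z \<subseteq> {..<N}" "card Z = k" "\<And>i. i \<in> Z \<Longrightarrow> - l i \<ge> y" "\<And>i. i \<in> {..<N} - Z \<Longrightarrow> - l i \<le> y"
    using top_set[of "{..<N}" k "\<lambda>i. - l i"] k by auto
  have fr: "(\<Sum>i\<in>{..<N}. p i) = Idm N" by (rule frameD(4)[OF p(1)])
  obtain R1 where R1: "kproj N k R1" "tr (R1 * Q) = 1" using Q by (auto simp: unit_krange_def)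
  obtain R0 where R0: "kproj N k R0" "tr (R0 * Q) = 0" using Q by (auto simp: unit_krange_def)
  have "1 \<le> sum l S"
    using top_set_bound[of "{..<N}" S g l "\<lambda>i. Re (tr (R1 * p i))"] S frame_coeffs[OF o fr R1(1)] trR[of R1] R1(2)
    by simp
  then have S1: "sum l S = 1" using b[OF S(1,2)] by simp
  have "0 \<le> (\<Sum>i\<in>Z. - l i)"
    using top_set_bound[of "{..<N}" Z y "\<lambda>i. - l i" "\<lambda>i. Re (tr (R0 * p i))"] Z frame_coeffs[OF o fr R0(1)] trR[of R0] R0(2)
    by (simp add: sum_negf)
  then have Z0: "sum l Z = 0" using b[OF Z(1,2)] by (simp add: sum_negf)
  have "tr Q = of_real (sum l {..<N})" unfolding p(2) using frameD(1)[OF p(1)] by (simp add: tr_sum)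
  moreover have "l i \<le> - y" if "i \<in> Z" for i using Z(3)[OF that] by simp
  moreover have "l i \<ge> - y" if "i \<in> {..<N} - Z" for i using Z(4)[OF that] by simp
  ultimately show ?thesis using Z0 b by (intro that[OF p S S1 Z(1,2), of "- y"])
qed

lemma unit_krange_trace:
  assumes Q: "unit_krange N k Q" and k: "1 \<le> k" "k < N"
  shows "Im (tr Q) = 0" "2 * k \<le> N \<Longrightarrow> Re (tr Q) \<ge> 1" "N \<le> 2 * k \<Longrightarrow> Re (tr Q) \<le> 1"
    "2 * k \<noteq> N \<Longrightarrow> tr Q = 1 \<Longrightarrow> psd N Q"
proof -
  obtain p l S g Z h where p: "frame N p" "Q = (\<Sum>i<N. complex_of_real (l i) *\<^sub>C p i)"
    and S: "S \<subseteq> {..<N}" "card S = k" "\<And>i. i \<in> S \<Longrightarrow> l i \<ge> g" "\<And>i. i \<in> {..<N} - S \<Longrightarrow> l i \<le> g" "sum l S = 1"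
    and Z: "Z \<subseteq> {..<N}" "card Z = k" "\<And>i. i \<in> Z \<Longrightarrow> l i \<le> h" "\<And>i. i \<in> {..<N} - Z \<Longrightarrow> l i \<ge> h" "sum l Z = 0"
    and b: "\<And>S. S \<subseteq> {..<N} \<Longrightarrow> card S = k \<Longrightarrow> 0 \<le> sum l S \<and> sum l S \<le> 1"
    and tr: "tr Q = of_real (sum l {..<N})"
    by (rule unit_krange_spectrum[OF Q k]) (rule that)
  note e = extreme_sums[of "{..<N}" N k l S g Z h, OF finite_lessThan card_lessThan k b S Z]
  show "Im (tr Q) = 0" "2 * k \<le> N \<Longrightarrow> Re (tr Q) \<ge> 1" "N \<le> 2 * k \<Longrightarrow> Re (tr Q) \<le> 1"
    using e(1,2) unfolding tr by (simp_all only: Re_complex_of_real Im_complex_of_real)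
  assume k2: "2 * k \<noteq> N" and "tr Q = 1"
  then have "sum l {..<N} = 1" using tr by (metis of_real_eq_1_iff)
  then have "\<And>i. i \<in> {..<N} \<Longrightarrow> l i \<ge> 0" using e(3) k2 by blast
  then show "psd N Q" unfolding p(2) by (intro psd_combination[OF p(1)]) auto
qed

text \<open>When \<open>N = 2k\<close>, a cut \<open>g\<close> between the upper and the lower half of the spectrum gives the
  decomposition \<open>Q = g I + M - K\<close>; a rank \<open>k\<close> projection reaching the maximum \<open>1\<close> must contain
  the range of \<open>M\<close> and annihilate \<open>K\<close>, and its complement reaches the minimum \<open>0\<close>.\<close>

lemma unit_krange_half:
  assumes Q: "unit_krange N k Q" and k: "1 \<le> k" "N = 2 * k" and trQ: "tr Q = 1"
  obtains g M K where "Q = complex_of_real g *\<^sub>C Idm N + M - K" "psd N M" "psd N K" "M * K = 0" "K * M = 0"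
    "tr M = of_real (1 - k * g)" "tr K = of_real (k * g)"
    "\<And>R. kproj N k R \<Longrightarrow> tr (R * Q) = 1 \<Longrightarrow> R * M = M \<and> R * K = 0"
    "\<And>R. kproj N k R \<Longrightarrow> tr (R * Q) = 0 \<Longrightarrow> R * M = 0 \<and> R * K = K"
proof -
  have kN: "k < N" using k by simp
  obtain p l S g Z h where p: "frame N p" "Q = (\<Sum>i<N. complex_of_real (l i) *\<^sub>C p i)"
    and S: "S \<subseteq> {..<N}" "card S = k" "\<And>i. i \<in> S \<Longrightarrow> l i \<ge> g" "\<And>i. i \<in> {..<N} - S \<Longrightarrow> l i \<le> g" "sum l S = 1"
    and "Z \<subseteq> {..<N}" "card Z = k" "\<And>i. i \<in> Z \<Longrightarrow> l i \<le> h" "\<And>i. i \<in> {..<N} - Z \<Longrightarrow> l i \<ge> h" "sum l Z = 0"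
    and "\<And>S. S \<subseteq> {..<N} \<Longrightarrow> card S = k \<Longrightarrow> 0 \<le> sum l S \<and> sum l S \<le> 1"
    and tr: "tr Q = of_real (sum l {..<N})"
    by (rule unit_krange_spectrum[OF Q k(1) kN]) (rule that)
  define S' where "S' = {..<N} - S"
  have fS: "finite S" "finite S'" "S' \<subseteq> {..<N}" using S(1) finite_subset by (auto simp: S'_def)
  have cS': "card S' = k" using S(1,2) fS k by (simp add: S'_def card_Diff_subset)
  have sl: "sum l {..<N} = 1" using trQ tr by (metis of_real_eq_1_iff)
  have split: "sum f {..<N} = sum f S' + sum f S" for f :: "nat \<Rightarrow> 'z::comm_monoid_add"
    unfolding S'_def using S(1) by (intro sum.subset_diff) auto
  (* the parts of Q - g I above and below the threshold *)
  define M where "M = (\<Sum>i\<in>S. complex_of_real (l i - g) *\<^sub>C p i)"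
  define K where "K = (\<Sum>i\<in>S'. complex_of_real (g - l i) *\<^sub>C p i)"
  have M: "psd N M" unfolding M_def using S by (intro psd_combination[OF p(1)]) auto
  have K: "psd N K" unfolding K_def using S by (intro psd_combination[OF p(1)]) (auto simp: S'_def)
  have atoms: "\<And>i. i < N \<Longrightarrow> tr (p i) = 1" using frameD(1)[OF p(1)] by simp
  have "tr M = complex_of_real (\<Sum>i\<in>S. l i - g)"
    unfolding M_def using S(1) atoms by (auto simp: tr_sum intro!: sum.cong)
  then have trM: "tr M = of_real (1 - k * g)" using S by (simp add: sum_subtractf)
  have "tr K = complex_of_real (\<Sum>i\<in>S'. g - l i)"
    unfolding K_def using fS(3) atoms by (auto simp: tr_sum intro!: sum.cong)
  moreover have "(\<Sum>i\<in>S'. g - l i) = k * g" using split[of l] S(5) sl cS' by (simp add: sum_subtractf)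
  ultimately have trK: "tr K = of_real (k * g)" by (simp only:)
  have MK: "M * K = 0"
    unfolding M_def K_def sum_distrib_left sum_distrib_right
    using S(1) frame_mult[OF p(1)] by (intro sum.neutral ballI) (auto simp: S'_def subset_iff)
  have KM: "K * M = 0" using arg_cong[OF MK, of adj] psd_adj[OF M] psd_adj[OF K] by simp
  have "complex_of_real g *\<^sub>C Idm N + M - K
    = (\<Sum>i\<in>S'. complex_of_real g *\<^sub>C p i) + (\<Sum>i\<in>S. complex_of_real g *\<^sub>C p i) + M - K"
    using split[of "\<lambda>i. complex_of_real g *\<^sub>C p i"] frameD(4)[OF p(1)] by (simp flip: fm.scale_sum_right)
  also have "\<dots> = (\<Sum>i\<in>S'. complex_of_real g *\<^sub>C p i - complex_of_real (g - l i) *\<^sub>C p i)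
    + (\<Sum>i\<in>S. complex_of_real g *\<^sub>C p i + complex_of_real (l i - g) *\<^sub>C p i)"
    by (simp add: M_def K_def sum_subtractf sum.distrib)
  also have "\<dots> = Q" unfolding p(2) split by (simp add: smul_simps)
  finally have Qe: "Q = complex_of_real g *\<^sub>C Idm N + M - K" ..
  have top: "R * M = M \<and> R * K = 0" if R: "kproj N k R" "tr (R * Q) = 1" for R
  proof -
    have "tr (R * Q) = of_real (g * k) + tr (R * M) - tr (R * K)"
      using kprojD(2,3)[OF R(1)] by (simp add: Qe distrib_left right_diff_distrib)
    then have "tr (R * M) = 1 - of_real (g * k) + tr (R * K)" using R(2) by (simp add: algebra_simps)
    then have e: "tr (R * M) = tr M + tr (R * K)" using trM by (simp add: mult.commute)
    have ineq: "Re (tr (R * M)) \<le> Re (tr M)" "Re (tr (R * K)) \<ge> 0" "Im (tr (R * K)) = 0"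
      using psd_tr_compl(1)[OF M R(1)] psd_tr_proj(1,2)[OF K kprojD(1)[OF R(1)]] by auto
    then have "tr (R * K) = 0" using e by (simp add: complex_eq_iff)
    then show ?thesis using e psd_tr_compl(2)[OF M R(1)] psd_tr_proj(3)[OF K kprojD(1)[OF R(1)]] by simp
  qed
  have bot: "R * M = 0 \<and> R * K = K" if R: "kproj N k R" "tr (R * Q) = 0" for R
  proof -
    have "kproj N k (Idm N - R)" using kproj_compl[OF R(1)] k by simp
    moreover have "tr ((Idm N - R) * Q) = 1"
      using Q trQ R(2) by (simp add: left_diff_distrib unit_krange_def)
    ultimately have "(Idm N - R) * M = M \<and> (Idm N - R) * K = 0" by (rule top)
    then show ?thesis using psd_corner[OF M] psd_corner[OF K] by (simp add: left_diff_distrib)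
  qed
  show ?thesis by (rule that[OF Qe M K MK KM trM trK top bot])
qed

subsection \<open>Resolutions of the identity\<close>

lemma resolution_atoms:
  assumes I: "finite I" and Q: "\<And>p. p \<in> I \<Longrightarrow> adj (Q p) = Q p" "\<And>p. p \<in> I \<Longrightarrow> Q p \<in> corner N"
    "\<And>p. p \<in> I \<Longrightarrow> tr (Q p) = 1" "\<And>p q. p \<in> I \<Longrightarrow> q \<in> I \<Longrightarrow> p \<noteq> q \<Longrightarrow> Q p * Q q = 0"
    and sum: "(\<Sum>p\<in>I. Q p) = Idm N" and p: "p \<in> I"
  shows "atom (Q p)"
proof -
  have "Q p = Q p * (\<Sum>q\<in>I. Q q)" using Q(2)[OF p] by (simp add: sum)
  also have "\<dots> = (\<Sum>q\<in>I. if q = p then Q p * Q p else 0)"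
    unfolding sum_distrib_left using Q(4) p by (intro sum.cong) auto
  also have "\<dots> = Q p * Q p" using I p by simp
  finally show ?thesis using Q(1,3)[OF p] unfolding atom_def proj_def by simp
qed

text \<open>Multiplying \<open>\<Sum> Q\<^sub>p = I\<close> by \<open>M\<^sub>p\<close> and by \<open>K\<^sub>p\<close> gives \<open>M\<^sub>p\<^sup>2 = c M\<^sub>p\<close> and \<open>K\<^sub>p\<^sup>2 = -c K\<^sub>p\<close> with
  \<open>c = 1 - \<Sum> g\<^sub>p\<close>.  By positivity all \<open>K\<^sub>p\<close> vanish if \<open>c > 0\<close> and all \<open>M\<^sub>p\<close> vanish if \<open>c < 0\<close>; the traces then give
  \<open>g\<^sub>p = 0\<close>, respectively \<open>g\<^sub>p = 1 / k\<close>, and so \<open>c = 1\<close>, respectively \<open>c = -1\<close>.\<close>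

lemma resolution_half:
  assumes I: "finite I" "card I = N" "N = 2 * k" "1 \<le> k"
    and Q: "\<And>p. p \<in> I \<Longrightarrow> Q p = complex_of_real (g p) *\<^sub>C Idm N + M p - K p"
    and M: "\<And>p. p \<in> I \<Longrightarrow> psd N (M p)" "\<And>p. p \<in> I \<Longrightarrow> tr (M p) = of_real (1 - k * g p)"
    and K: "\<And>p. p \<in> I \<Longrightarrow> psd N (K p)" "\<And>p. p \<in> I \<Longrightarrow> tr (K p) = of_real (k * g p)"
    and orth: "\<And>p q. p \<in> I \<Longrightarrow> q \<in> I \<Longrightarrow> M p * K q = 0" "\<And>p q. p \<in> I \<Longrightarrow> q \<in> I \<Longrightarrow> K p * M q = 0"
      "\<And>p q. p \<in> I \<Longrightarrow> q \<in> I \<Longrightarrow> p \<noteq> q \<Longrightarrow> M p * M q = 0" "\<And>p q. p \<in> I \<Longrightarrow> q \<in> I \<Longrightarrow> p \<noteq> q \<Longrightarrow> K p * K q = 0"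
    and sum: "(\<Sum>p\<in>I. Q p) = Idm N"
  shows "(\<forall>p\<in>I. atom (Q p)) \<or> (\<forall>p\<in>I. atom ((1 / of_nat k) *\<^sub>C Idm N - Q p))"
proof -
  define c where "c = 1 - (\<Sum>p\<in>I. g p)"
  have Isum: "Idm N = complex_of_real (1 - c) *\<^sub>C Idm N + (\<Sum>p\<in>I. M p) - (\<Sum>p\<in>I. K p)"
  proof -
    have "(\<Sum>p\<in>I. Q p) = (\<Sum>p\<in>I. complex_of_real (g p) *\<^sub>C Idm N) + (\<Sum>p\<in>I. M p) - (\<Sum>p\<in>I. K p)"
      using Q by (simp add: sum_subtractf sum.distrib)
    moreover have "(\<Sum>p\<in>I. complex_of_real (g p) *\<^sub>C Idm N) = complex_of_real (1 - c) *\<^sub>C Idm N"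
      by (simp add: c_def flip: fm.scale_sum_left)
    ultimately show ?thesis using sum by simp
  qed
  have MM: "M p * M p = complex_of_real c *\<^sub>C M p" and KK: "K p * K p = - (complex_of_real c *\<^sub>C K p)" if p: "p \<in> I" for p
  proof -
    have "(\<Sum>q\<in>I. M p * M q) = (\<Sum>q\<in>I. if q = p then M p * M p else 0)" using orth(3) p by (intro sum.cong) auto
    then have a: "(\<Sum>q\<in>I. M p * M q) = M p * M p" using I p by simp
    have b: "(\<Sum>q\<in>I. M p * K q) = 0" "(\<Sum>q\<in>I. K p * M q) = 0" using orth(1,2) p by auto
    have "(\<Sum>q\<in>I. K p * K q) = (\<Sum>q\<in>I. if q = p then K p * K p else 0)" using orth(4) p by (intro sum.cong) auto
    then have d: "(\<Sum>q\<in>I. K p * K q) = K p * K p" using I p by simp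
    have "M p = M p * Idm N" using psd_corner[OF M(1)[OF p]] by simp
    also have "\<dots> = complex_of_real (1 - c) *\<^sub>C M p + M p * M p"
      using psd_corner[OF M(1)[OF p]] by (subst Isum) (simp add: distrib_left right_diff_distrib sum_distrib_left a b)
    finally show "M p * M p = complex_of_real c *\<^sub>C M p" by (simp add: smul_simps)
    have "K p = K p * Idm N" using psd_corner[OF K(1)[OF p]] by simp
    also have "\<dots> = complex_of_real (1 - c) *\<^sub>C K p - K p * K p"
      using psd_corner[OF K(1)[OF p]] by (subst Isum) (simp add: distrib_left right_diff_distrib sum_distrib_left b d)
    finally show "K p * K p = - (complex_of_real c *\<^sub>C K p)" by (simp add: smul_simps eq_neg_iff_add_eq_0 algebra_simps)
  qed
  have pos: "c * (1 - k * g p) \<ge> 0" "c * (k * g p) \<le> 0" and z: "c * (1 - k * g p) = 0 \<Longrightarrow> M p = 0" "c * (k * g p) = 0 \<Longrightarrow> K p = 0"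
    if p: "p \<in> I" for p
  proof -
    have sq: "adj (M p) * M p = complex_of_real c *\<^sub>C M p" "adj (K p) * K p = - (complex_of_real c *\<^sub>C K p)"
      using MM[OF p] KK[OF p] psd_adj[OF M(1)[OF p]] psd_adj[OF K(1)[OF p]] by auto
    have t: "tr (adj (M p) * M p) = of_real (c * (1 - k * g p))" "tr (adj (K p) * K p) = of_real (- (c * (k * g p)))"
      unfolding sq using M(2)[OF p] K(2)[OF p] by simp_all
    show "c * (1 - k * g p) \<ge> 0" using tr_adj_pos(1)[of "M p"] unfolding t Re_complex_of_real .
    show "c * (k * g p) \<le> 0" using tr_adj_pos(1)[of "K p"] unfolding t Re_complex_of_real by simp
    show "M p = 0" if "c * (1 - k * g p) = 0" using tr_adj_eq_0[of "M p"] t(1) that by simp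
    show "K p = 0" if "c * (k * g p) = 0" using tr_adj_eq_0[of "K p"] t(2) that by simp
  qed
  have gp: "0 \<le> k * g p" "k * g p \<le> 1" if p: "p \<in> I" for p
    using psd_tr(1)[OF K(1)[OF p]] psd_tr(1)[OF M(1)[OF p]] unfolding K(2)[OF p] M(2)[OF p] Re_complex_of_real by simp_all
  have c0: "c \<noteq> 0"
  proof
    assume "c = 0"
    moreover obtain p where "p \<in> I" using I by (metis card.empty ex_in_conv mult_is_0 not_one_le_zero zero_neq_numeral)
    ultimately have "M p = 0" "K p = 0" "p \<in> I" using z by auto
    then have "1 - k * g p = 0" "k * g p = 0" using M(2) K(2) by (metis of_real_eq_0_iff tr_lin(5))+
    then show False by simp
  qed
  show ?thesis
  proof (cases "c > 0")
    case True
    have g0: "g p = 0" if p: "p \<in> I" for p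
    proof -
      have "k * g p \<le> 0" using pos(2)[OF p] True by (simp add: mult_le_0_iff)
      then show ?thesis using gp(1)[OF p] I(4) by (simp add: mult_le_0_iff zero_le_mult_iff)
    qed
    have "c = 1" using g0 by (simp add: c_def)
    have "atom (Q p)" if p: "p \<in> I" for p
    proof -
      have "K p = 0" using z(2)[OF p] g0[OF p] by simp
      then have "Q p = M p" using Q[OF p] g0[OF p] by simp
      then show ?thesis using MM[OF p] \<open>c = 1\<close> M(2)[OF p] g0[OF p] psd_adj[OF M(1)[OF p]]
        unfolding atom_def proj_def by simp
    qed
    then show ?thesis by blast
  next
    case False
    then have neg: "c < 0" using c0 by simp
    have g1: "k * g p = 1" if p: "p \<in> I" for p
    proof -
      have "1 - k * g p \<le> 0" using pos(1)[OF p] neg by (simp add: zero_le_mult_iff)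
      then show ?thesis using gp(2)[OF p] by simp
    qed
    then have g: "g p = 1 / k" if "p \<in> I" for p using that I(4) by (simp add: field_simps)
    have "(\<Sum>p\<in>I. g p) = (\<Sum>p\<in>I. 1 / k)" by (rule sum.cong) (auto simp: g)
    then have c: "c = -1" using I by (simp add: c_def)
    have "atom ((1 / of_nat k) *\<^sub>C Idm N - Q p)" if p: "p \<in> I" for p
    proof -
      have "M p = 0" using z(1)[OF p] g1[OF p] by simp
      then have "(1 / of_nat k) *\<^sub>C Idm N - Q p = K p" using Q[OF p] g[OF p] by simp
      then show ?thesis using KK[OF p] c K(2)[OF p] g1[OF p] psd_adj[OF K(1)[OF p]]
        unfolding atom_def proj_def by simp
    qed
    then show ?thesis by blast
  qed
qed


section \<open>Bilinear maps that preserve the ranges\<close>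

text \<open>The values of a linear map at the products \<open>A \<otimes> B\<close> are a bilinear function \<open>F\<close> of the two factors; the
  two sizes are then on an equal footing, and exchanging the arguments gives a map of the same kind.\<close>

locale bilinear_on =
  fixes m n N :: nat and F :: "fmat \<Rightarrow> fmat \<Rightarrow> fmat"
  assumes closed: "a \<in> corner m \<Longrightarrow> b \<in> corner n \<Longrightarrow> F a b \<in> corner N"
    and add1: "a \<in> corner m \<Longrightarrow> a' \<in> corner m \<Longrightarrow> b \<in> corner n \<Longrightarrow> F (a + a') b = F a b + F a' b"
    and add2: "a \<in> corner m \<Longrightarrow> b \<in> corner n \<Longrightarrow> b' \<in> corner n \<Longrightarrow> F a (b + b') = F a b + F a b'"
    and smul1: "a \<in> corner m \<Longrightarrow> b \<in> corner n \<Longrightarrow> F (c *\<^sub>C a) b = c *\<^sub>C F a b"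
    and smul2: "a \<in> corner m \<Longrightarrow> b \<in> corner n \<Longrightarrow> F a (c *\<^sub>C b) = c *\<^sub>C F a b"
begin

lemma zero1: "b \<in> corner n \<Longrightarrow> F 0 b = 0" and zero2: "a \<in> corner m \<Longrightarrow> F a 0 = 0"
  using smul1[of 0 b 0] smul2[of a 0 0] by auto

lemma diff1: "a \<in> corner m \<Longrightarrow> a' \<in> corner m \<Longrightarrow> b \<in> corner n \<Longrightarrow> F (a - a') b = F a b - F a' b"
  using add1[of "a - a'" a' b] by simp

lemma diff2: "a \<in> corner m \<Longrightarrow> b \<in> corner n \<Longrightarrow> b' \<in> corner n \<Longrightarrow> F a (b - b') = F a b - F a b'"
  using add2[of a "b - b'" b'] by simp

lemma sum1: "(\<And>x. x \<in> S \<Longrightarrow> f x \<in> corner m) \<Longrightarrow> b \<in> corner n \<Longrightarrow> F (\<Sum>x\<in>S. f x) b = (\<Sum>x\<in>S. F (f x) b)"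
proof (induction S rule: infinite_finite_induct)
  case (insert x S)
  then have "(\<Sum>x\<in>S. f x) \<in> corner m" by blast
  then show ?case using insert by (simp add: add1)
qed (auto simp: zero1)

lemma sum2: "(\<And>x. x \<in> S \<Longrightarrow> f x \<in> corner n) \<Longrightarrow> a \<in> corner m \<Longrightarrow> F a (\<Sum>x\<in>S. f x) = (\<Sum>x\<in>S. F a (f x))"
proof (induction S rule: infinite_finite_induct)
  case (insert x S)
  then have "(\<Sum>x\<in>S. f x) \<in> corner n" by blast
  then show ?case using insert by (simp add: add2)
qed (auto simp: zero2)

end

text \<open>The traces \<open>tr (P\<^sub>i P\<^sub>l)\<close> are nonnegative and, because of \<open>P\<^sub>i = \<Sum>\<^sub>l P\<^sub>i P\<^sub>l\<close>, those with \<open>l \<noteq> i\<close> add up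
  to zero.\<close>

lemma projections_sum_orthogonal:
  assumes I: "finite I" and P: "\<And>i. i \<in> I \<Longrightarrow> proj (P i)" "\<And>i. i \<in> I \<Longrightarrow> P i \<in> corner N"
    and sum: "(\<Sum>i\<in>I. P i) = Idm N" and ij: "i \<in> I" "j \<in> I" "i \<noteq> j"
  shows "P i * P j = 0"
proof -
  have nn: "\<And>l. l \<in> I \<Longrightarrow> Re (tr (P i * P l)) \<ge> 0" using P ij tr_proj_proj(1) by blast
  have "(\<Sum>l\<in>I. Re (tr (P i * P l))) = Re (tr (P i * (\<Sum>l\<in>I. P l)))" by (simp add: sum_distrib_left tr_sum)
  also have "\<dots> = Re (tr (P i * P i))" using P ij by (simp add: sum)
  also have "(\<Sum>l\<in>I. Re (tr (P i * P l))) = Re (tr (P i * P i)) + (\<Sum>l\<in>I - {i}. Re (tr (P i * P l)))"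
    using I ij by (simp add: sum.remove)
  finally have "(\<Sum>l\<in>I - {i}. Re (tr (P i * P l))) = 0" by simp
  then have "Re (tr (P i * P j)) = 0" using nn ij I by (subst (asm) sum_nonneg_eq_0_iff) auto
  then show ?thesis using tr_proj_proj(2,3)[OF P(1)[OF ij(1)] P(1)[OF ij(2)]] by (simp add: complex_eq_iff)
qed

lemma kproj_above_atom:
  assumes "atom P" "P \<in> corner N" "1 \<le> k" "k \<le> N"
  obtains R where "kproj N k R" "R * P = P"
proof -
  obtain p where p: "frame N p" "p 0 = P" using frame_with_atom[OF assms(1,2)] assms by auto
  have S: "{..<k} \<subseteq> {..<N}" using assms by auto
  show ?thesis
    using that orthofam_sum(1)[OF orthofam_frame[OF p(1)] S] orthofam_sum(2)[OF orthofam_frame[OF p(1)] S, of 0] p assms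
    by simp
qed

text \<open>The join of two rank one projections has rank at most two: the part of \<open>Y\<close> orthogonal to
  \<open>X\<close> is, up to scaling, again a rank one projection.\<close>

lemma kproj_above_two_atoms:
  assumes X: "atom X" "X \<in> corner N" and Y: "atom Y" "Y \<in> corner N" and k: "2 \<le> k" "k \<le> N"
  obtains R where "kproj N k R" "R * X = X" "R * Y = Y"
proof -
  define C where "C = Idm N - X"
  have C: "proj C" "C \<in> corner N" using X by (auto simp: C_def proj_compl)
  define d where "d = tr (C * Y)"
  have XC: "X * C = 0" using X by (simp add: C_def right_diff_distrib)
  show ?thesis
  proof (cases "d = 0")
    case True
    then have "C * Y = 0" using tr_proj_proj(3)[OF C(1), of Y] Y(1) by (simp add: d_def)
    then have XY: "X * Y = Y" using Y(2) by (simp add: C_def left_diff_distrib)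
    obtain R where R: "kproj N k R" "R * X = X" using kproj_above_atom[OF X] k by (metis le_trans one_le_numeral)
    then have "R * Y = Y" using XY by (metis mult.assoc)
    then show ?thesis using that R by blast
  next
    case False
    (* the projection onto the component of Y orthogonal to X *)
    define P where "P = (1 / d) *\<^sub>C (C * Y * C)"
    have dr: "cnj d = d" using tr_proj_proj(2)[OF C(1), of Y] Y(1) by (simp add: d_def complex_eq_iff)
    have "C * Y * C * (C * Y * C) = C * (Y * C * Y) * C" using C(1) by (simp add: mult.assoc)
    also have "Y * C * Y = d *\<^sub>C Y" using atom_sandwich[OF Y(1), of C] tr_mult[of Y C] by (simp add: d_def)
    finally have "P * P = P" using False by (simp add: P_def)
    moreover have "adj P = P" using C(1) Y(1) dr by (simp add: P_def mult.assoc)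
    moreover have "tr (C * Y * C) = d" using tr_mult[of "C * Y" C] C(1) by (simp add: d_def mult.assoc[symmetric])
    then have "tr P = 1" using False by (simp add: P_def)
    ultimately have P: "atom P" unfolding atom_def proj_def by blast
    have PN: "P \<in> corner N" using C Y by (auto simp: P_def)
    have "X * P = (1 / d) *\<^sub>C (X * C * Y * C)" by (simp add: P_def mult.assoc)
    then have XP: "X * P = 0" by (simp add: XC)
    obtain p where p: "frame N p" "p 0 = X" "p 1 = P" using frame_with_two_atoms[OF X P PN XP] k by auto
    have S: "{..<k} \<subseteq> {..<N}" using k by auto
    define R where "R = (\<Sum>i<k. p i)"
    have R: "kproj N k R" "R * X = X" "R * P = P"
      using orthofam_sum(1)[OF orthofam_frame[OF p(1)] S] orthofam_sum(2)[OF orthofam_frame[OF p(1)] S, of 0]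
        orthofam_sum(2)[OF orthofam_frame[OF p(1)] S, of 1] p k by (auto simp: R_def)
    define D where "D = Idm N - R"
    have D: "proj D" "D \<in> corner N" using R(1) by (auto simp: D_def kproj_def proj_compl)
    have DX: "D * X = 0" using X R(2) by (simp add: D_def left_diff_distrib)
    then have XD: "X * D = 0" using proj_orth_commute[OF D(1), of X] X(1) by simp
    have CD: "D * C = D" "C * D = D" using D(2) by (simp_all add: C_def right_diff_distrib left_diff_distrib DX XD)
    have "D * P = 0" using PN R(3) by (simp add: D_def left_diff_distrib)
    then have "D * (C * Y * C) * D = 0" using False by (simp add: P_def)
    moreover have "D * (C * Y * C) * D = D * Y * D"
    proof -
      have "D * (C * Y * C) * D = D * C * Y * (C * D)" by (simp only: mult.assoc)
      then show ?thesis by (simp only: CD)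
    qed
    ultimately have "tr (D * Y * D) = 0" by simp
    then have "tr (D * Y) = 0" using tr_mult[of "D * Y" D] D(1) by (simp add: mult.assoc[symmetric])
    then have "D * Y = 0" using tr_proj_proj(3)[OF D(1), of Y] Y(1) by simp
    then have "R * Y = Y" using Y(2) by (simp add: D_def left_diff_distrib)
    then show ?thesis using that R by blast
  qed
qed

locale range_preserver = bilinear_on m n "m * n" F for m n F +
  fixes k :: nat
  assumes m2: "2 \<le> m" and n2: "2 \<le> n" and k1: "1 \<le> k" and kN: "k < m * n"
    and krange_F: "a \<in> corner m \<Longrightarrow> b \<in> corner n \<Longrightarrow> krange (m * n) k (F a b) = krange (m * n) k (kron n a b)"
begin

abbreviation "N \<equiv> m * n"

lemma n0: "n > 0" using n2 by simp

lemma N4: "N \<ge> 4" using mult_le_mono[OF m2 n2] by simp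

text \<open>Hermitian matrices are recognized by their range being real.\<close>

lemma hermitian_F:
  assumes "a \<in> corner m" "b \<in> corner n" "adj a = a" "adj b = b"
  shows "adj (F a b) = F a b"
proof (rule krange_real_imp_hermitian[OF closed k1 kN])
  fix z assume "z \<in> krange N k (F a b)"
  then have "z \<in> krange N k (kron n a b)" using krange_F[OF assms(1,2)] by simp
  then obtain R where R: "kproj N k R" "z = tr (R * kron n a b)" by (auto simp: krange_def)
  then have "cnj z = z" using tr_lin(3)[of "R * kron n a b"] tr_mult[of R "kron n a b"] assms kprojD(1)[OF R(1)] by simp
  then show "Im z = 0" by (simp add: complex_eq_iff)
qed (use assms in auto)

lemma unital_F: "F (Idm m) (Idm n) = Idm N"
proof -
  have "F (Idm m) (Idm n) - Idm N = 0"
  proof (rule krange_eq_0[OF _ k1 kN])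
    fix R assume R: "kproj N k R"
    then have "tr (R * F (Idm m) (Idm n)) \<in> krange N k (kron n (Idm m) (Idm n))"
      using krange_F[of "Idm m" "Idm n"] by (auto simp: krange_def)
    then have "tr (R * F (Idm m) (Idm n)) = of_nat k" by (auto simp: krange_def kron_Idm[OF n0] kproj_def)
    then show "tr (R * (F (Idm m) (Idm n) - Idm N)) = 0" using R by (simp add: right_diff_distrib kproj_def)
  qed (simp add: closed)
  then show ?thesis by simp
qed

lemma unit_krange_F:
  assumes "a \<in> corner m" "b \<in> corner n" "atom a" "atom b"
  shows "unit_krange N k (F a b)"
proof -
  let ?P = "kron n a b"
  have P: "atom ?P" "?P \<in> corner N" using assms by (auto simp: atom_kron n0 kron_rect)
  have rk: "\<exists>R'. kproj N k R' \<and> tr (R * F a b) = tr (R' * ?P)" if "kproj N k R" for R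
    using krange_F[OF assms(1,2)] that by (auto simp: krange_def)
  have rk': "\<exists>R'. kproj N k R' \<and> tr (R' * F a b) = tr (R * ?P)" if "kproj N k R" for R
  proof -
    have "tr (R * ?P) \<in> krange N k (F a b)" unfolding krange_F[OF assms(1,2)] using that by (auto simp: krange_def)
    then show ?thesis by (auto simp: krange_def)
  qed
  have bd: "Re (tr (R * F a b)) \<in> {0..1}" if R: "kproj N k R" for R
  proof -
    obtain R' where R': "kproj N k R'" "tr (R * F a b) = tr (R' * ?P)" using rk[OF R] by blast
    then show ?thesis
      using tr_proj_proj(1)[OF kprojD(1)[OF R'(1)], of ?P] tr_proj_le(1)[OF R'(1), of ?P] P by simp
  qed
  obtain R where R: "kproj N k R" "R * ?P = ?P" using kproj_above_atom[OF P k1] kN by auto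
  have one: "\<exists>R. kproj N k R \<and> tr (R * F a b) = 1" using rk'[OF R(1)] R(2) P by simp
  have "1 \<le> N - k" using kN by simp
  then obtain R0 where R0: "kproj N (N - k) R0" "R0 * ?P = ?P" by (rule kproj_above_atom[OF P]) simp
  have "kproj N k (Idm N - R0)" using kproj_compl[OF R0(1)] kN by simp
  moreover have "(Idm N - R0) * ?P = 0" using P R0(2) by (simp add: left_diff_distrib)
  ultimately have zero: "\<exists>R. kproj N k R \<and> tr (R * F a b) = 0" using rk'[of "Idm N - R0"] by auto
  have "adj (F a b) = F a b" using assms by (intro hermitian_F) auto
  then show ?thesis unfolding unit_krange_def using closed[OF assms(1,2)] bd one zero by blast
qed

context
  fixes p q assumes p: "frame m p" and q: "frame n q"
begin

abbreviation "I \<equiv> {..<m} \<times> {..<n}"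

abbreviation "P x \<equiv> kron n (p (fst x)) (q (snd x))"

abbreviation "Q x \<equiv> F (p (fst x)) (q (snd x))"

lemma card_I: "finite I" "card I = N" by auto

lemma in_corner: "x \<in> I \<Longrightarrow> p (fst x) \<in> corner m" "x \<in> I \<Longrightarrow> q (snd x) \<in> corner n"
  "x \<in> I \<Longrightarrow> atom (p (fst x))" "x \<in> I \<Longrightarrow> atom (q (snd x))"
  using frameD(1,2)[OF p] frameD(1,2)[OF q] by auto

lemma orthofam_P: "orthofam N I P"
  unfolding orthofam_def
proof (intro conjI ballI impI)
  fix x y assume x: "x \<in> I" and y: "y \<in> I"
  show "atom (P x)" "P x \<in> corner N" using in_corner[OF x] by (auto simp: atom_kron n0 kron_rect)
  assume "x \<noteq> y"
  then have "p (fst x) * p (fst y) = 0 \<or> q (snd x) * q (snd y) = 0"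
    using frameD(3)[OF p] frameD(3)[OF q] x y by (cases x; cases y) auto
  then show "P x * P y = 0" using in_corner[OF x] by (auto simp: kron_mult n0 kron_lin)
qed auto

lemma F_combination:
  "F (\<Sum>i<m. complex_of_real (f i) *\<^sub>C p i) (\<Sum>j<n. complex_of_real (g j) *\<^sub>C q j)
    = (\<Sum>x\<in>I. complex_of_real (f (fst x) * g (snd x)) *\<^sub>C Q x)"
proof -
  define b where "b = (\<Sum>j<n. complex_of_real (g j) *\<^sub>C q j)"
  have c: "b \<in> corner n" using frameD(2)[OF q] by (auto simp: b_def)
  have "F (\<Sum>i<m. complex_of_real (f i) *\<^sub>C p i) b = (\<Sum>i<m. complex_of_real (f i) *\<^sub>C F (p i) b)"
    using c frameD(2)[OF p] by (subst sum1) (auto simp: smul1)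
  also have "\<dots> = (\<Sum>i<m. \<Sum>j<n. complex_of_real (f i * g j) *\<^sub>C F (p i) (q j))"
  proof (rule sum.cong)
    fix i assume "i \<in> {..<m}"
    then have "F (p i) b = (\<Sum>j<n. complex_of_real (g j) *\<^sub>C F (p i) (q j))"
      unfolding b_def using frameD(2)[OF p] frameD(2)[OF q] by (subst sum2) (auto simp: smul2)
    then show "complex_of_real (f i) *\<^sub>C F (p i) b = (\<Sum>j<n. complex_of_real (f i * g j) *\<^sub>C F (p i) (q j))"
      by (simp add: fm.scale_sum_right)
  qed simp
  finally show ?thesis by (simp add: sum.cartesian_product case_prod_beta b_def)
qed

lemma sum_Q: "(\<Sum>x\<in>I. Q x) = Idm N"
  using F_combination[of "\<lambda>_. 1" "\<lambda>_. 1"] by (simp add: frameD(4)[OF p] frameD(4)[OF q] unital_F)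

lemma unit_krange_Q: "x \<in> I \<Longrightarrow> unit_krange N k (Q x)"
  using in_corner by (intro unit_krange_F)

text \<open>The traces add up to \<open>N\<close> and are all at least \<open>1\<close> or all at most \<open>1\<close>.\<close>

lemma tr_Q: assumes "x \<in> I" shows "tr (Q x) = 1"
proof -
  have s: "(\<Sum>x\<in>I. Re (tr (Q x))) = real N"
    using arg_cong[OF sum_Q, of "\<lambda>X. Re (tr X)"] by (simp add: tr_sum)
  have c: "(\<Sum>x\<in>I. (1::real)) = real N" by simp
  have "Re (tr (Q x)) = 1"
  proof (cases "2 * k \<le> N")
    case True
    then have "\<And>x. x \<in> I \<Longrightarrow> Re (tr (Q x)) - 1 \<ge> 0" using unit_krange_trace(2)[OF unit_krange_Q k1 kN] by force
    moreover have "(\<Sum>x\<in>I. Re (tr (Q x)) - 1) = 0" using s c by (simp add: sum_subtractf)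
    ultimately have "Re (tr (Q x)) - 1 = 0" using assms by (subst (asm) sum_nonneg_eq_0_iff) auto
    then show ?thesis by simp
  next
    case False
    then have "\<And>x. x \<in> I \<Longrightarrow> 1 - Re (tr (Q x)) \<ge> 0" using unit_krange_trace(3)[OF unit_krange_Q k1 kN] by force
    moreover have "(\<Sum>x\<in>I. 1 - Re (tr (Q x))) = 0" using s c by (simp add: sum_subtractf)
    ultimately have "1 - Re (tr (Q x)) = 0" using assms by (subst (asm) sum_nonneg_eq_0_iff) auto
    then show ?thesis by simp
  qed
  then show ?thesis using unit_krange_trace(1)[OF unit_krange_Q[OF assms] k1 kN] by (simp add: complex_eq_iff)
qed

lemma Q_coeffs:
  assumes R: "kproj N k R"
  shows "x \<in> I \<Longrightarrow> Re (tr (R * Q x)) \<in> {0..1}" "x \<in> I \<Longrightarrow> tr (R * Q x) = of_real (Re (tr (R * Q x)))"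
    "(\<Sum>x\<in>I. Re (tr (R * Q x))) = real k"
proof -
  show "Re (tr (R * Q x)) \<in> {0..1}" if "x \<in> I" using unit_krange_Q[OF that] R unfolding unit_krange_def by blast
  show "tr (R * Q x) = of_real (Re (tr (R * Q x)))" if "x \<in> I"
  proof -
    have "adj (Q x) = Q x" using unit_krange_Q[OF that] by (simp add: unit_krange_def)
    then have "cnj (tr (R * Q x)) = tr (R * Q x)"
      using tr_lin(3)[of "R * Q x"] tr_mult[of R "Q x"] kprojD(1)[OF R] by simp
    then show ?thesis by (simp add: complex_eq_iff)
  qed
  have "(\<Sum>x\<in>I. Re (tr (R * Q x))) = Re (tr (R * (\<Sum>x\<in>I. Q x)))" by (simp add: sum_distrib_left tr_sum)
  then show "(\<Sum>x\<in>I. Re (tr (R * Q x))) = real k" unfolding sum_Q using R by (simp add: kproj_def)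
qed

text \<open>If few of the products \<open>f i * g j\<close> are positive and few are negative, the sum of the \<open>k\<close>
  largest ones is the sum of the positive ones, and a projection realizing this sum on the side
  of \<open>F\<close> must take the value \<open>1\<close> where the product is positive and \<open>0\<close> where it is negative.\<close>

lemma sign_projection:
  fixes f g :: "nat \<Rightarrow> real"
  assumes A: "finite A" "{x \<in> I. f (fst x) * g (snd x) > 0} \<subseteq> A" "card A \<le> k"
    and B: "finite B" "{x \<in> I. f (fst x) * g (snd x) < 0} \<subseteq> B" "card B \<le> N - k"
  obtains R where "kproj N k R" "\<And>x. x \<in> I \<Longrightarrow> f (fst x) * g (snd x) > 0 \<Longrightarrow> tr (R * Q x) = 1"
    "\<And>x. x \<in> I \<Longrightarrow> f (fst x) * g (snd x) < 0 \<Longrightarrow> tr (R * Q x) = 0"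
proof -
  define v where "v x = f (fst x) * g (snd x)" for x :: "nat \<times> nat"
  let ?A = "{x \<in> I. v x > 0}" and ?B = "{x \<in> I. v x < 0}"
  have AB: "card ?A \<le> k" "card ?B \<le> N - k"
    using card_mono[OF A(1,2)] card_mono[OF B(1,2)] A(3) B(3) by (auto simp: v_def)
  have sub: "?A \<subseteq> I" "?B \<subseteq> I" "?A \<inter> ?B = {}" by auto
  have cI: "card ?B \<le> card I - k" "k \<le> card I" using AB(2) kN unfolding card_I(2) by simp_all
  obtain S where S: "?A \<subseteq> S" "S \<subseteq> I" "S \<inter> ?B = {}" "card S = k"
    by (rule obtain_subset_between[OF card_I(1) sub AB(1) cI]) (rule that)
  define a where "a = (\<Sum>i<m. complex_of_real (f i) *\<^sub>C p i)"
  define b where "b = (\<Sum>j<n. complex_of_real (g j) *\<^sub>C q j)"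
  have ab: "a \<in> corner m" "b \<in> corner n" using frameD(2)[OF p] frameD(2)[OF q] by (auto simp: a_def b_def)
  (* S contains all places with positive and none with negative coefficient, so this rank k projection collects the maximum *)
  let ?R = "\<Sum>x\<in>S. P x"
  have R: "kproj N k ?R" using orthofam_sum(1)[OF orthofam_P S(2)] S(4) by simp
  have "kron n a b = (\<Sum>i<m. \<Sum>j<n. complex_of_real (f i * g j) *\<^sub>C kron n (p i) (q j))"
    unfolding a_def b_def kron_sum_left[of n _ "{..<m}"] by (simp add: kron_sum_right kron_lin fm.scale_sum_right mult.commute)
  then have K: "kron n a b = (\<Sum>x\<in>I. complex_of_real (v x) *\<^sub>C P x)"
    by (simp add: sum.cartesian_product case_prod_beta v_def)
  have "tr (?R * kron n a b) = (\<Sum>x\<in>I. complex_of_real (if x \<in> S then v x else 0))"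
    unfolding K sum_distrib_left tr_sum
    using orthofam_sum(2)[OF orthofam_P S(2)] orthofamD(2)[OF orthofam_P] by (intro sum.cong) auto
  moreover have "tr (?R * kron n a b) \<in> krange N k (F a b)"
    unfolding krange_F[OF ab] using R by (auto simp: krange_def)
  ultimately obtain R' where R': "kproj N k R'" "tr (R' * F a b) = (\<Sum>x\<in>I. complex_of_real (if x \<in> S then v x else 0))"
    by (auto simp: krange_def)
  define t where "t x = Re (tr (R' * Q x))" for x
  note t = Q_coeffs[OF R'(1), folded t_def]
  have "tr (R' * F a b) = (\<Sum>x\<in>I. complex_of_real (v x) * tr (R' * Q x))"
    unfolding a_def b_def F_combination by (simp add: sum_distrib_left tr_sum v_def)
  also have "\<dots> = complex_of_real (\<Sum>x\<in>I. v x * t x)" using t(2) by (simp add: t_def)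
  finally have "(\<Sum>x\<in>I. v x * t x) = (\<Sum>x\<in>I. if x \<in> S then v x else 0)"
    using R'(2) by (simp only: of_real_sum[symmetric] of_real_eq_iff)
  then have z: "(\<Sum>x\<in>I. (if x \<in> S then v x else 0) - v x * t x) = 0" by (simp add: sum_subtractf)
  have nn: "(if x \<in> S then v x else 0) - v x * t x \<ge> 0" if x: "x \<in> I" for x
  proof (cases "x \<in> S")
    case True
    then have "v x \<ge> 0" using S x by force
    then show ?thesis using True t(1)[OF x] by (simp add: mult_left_le)
  next
    case False
    then have "v x \<le> 0" using S x by force
    then show ?thesis using False t(1)[OF x] by (simp add: mult_nonpos_nonneg)
  qed
  have e: "(if x \<in> S then v x else 0) - v x * t x = 0" if x: "x \<in> I" for x
    by (rule sum_nonneg_0[OF card_I(1) nn z x])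
  show ?thesis
  proof (rule that[OF R'(1)])
    fix x assume x: "x \<in> I"
    show "tr (R' * Q x) = 1" if "f (fst x) * g (snd x) > 0"
    proof -
      have "x \<in> S" "v x > 0" using that x S(1) by (auto simp: v_def)
      then have "t x = 1" using e[OF x] by simp
      then show ?thesis using t(2)[OF x] by simp
    qed
    show "tr (R' * Q x) = 0" if "f (fst x) * g (snd x) < 0"
    proof -
      have "x \<notin> S" "v x < 0" using that x S(3) by (auto simp: v_def)
      then have "t x = 0" using e[OF x] by simp
      then show ?thesis using t(2)[OF x] by simp
    qed
  qed
qed

lemma card_pair: "card {x, y} \<le> 2" by (simp add: card_insert_if)

text \<open>If \<open>x\<close> and \<open>y\<close> differ in one index only, one plus sign and one minus sign suffice.  If they differ in
  both, the signs \<open>f\<close> constant and \<open>g\<close> alternating have two positive and two negative products,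
  so that \<open>k\<close> and \<open>N - k\<close> have to be at least two.  For \<open>k = 1\<close> or \<open>N - k = 1\<close> a projection fixed at one of the two
  places is determined at all the others, as the values lie in \<open>[0, 1]\<close> and add up to \<open>k\<close>.\<close>

lemma separate:
  assumes "x \<in> I" "y \<in> I" "x \<noteq> y"
  obtains R where "kproj N k R" "tr (R * Q x) = 1" "tr (R * Q y) = 0"
proof -
  obtain i j i' j' where xy: "x = (i, j)" "y = (i', j')" "i < m" "j < n" "i' < m" "j' < n" using assms by auto
  consider "i = i'" "j \<noteq> j'" | "i \<noteq> i'" "j = j'" | "i \<noteq> i'" "j \<noteq> j'" "2 \<le> k" "2 \<le> N - k" | "k = 1" | "N - k = 1"
  proof -
    have "k = 1 \<or> N - k = 1 \<or> 2 \<le> k \<and> 2 \<le> N - k" using k1 kN by linarith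
    moreover have "i \<noteq> i' \<or> j \<noteq> j'" using assms(3) xy by blast
    ultimately show ?thesis using that by blast
  qed
  then show ?thesis
  proof cases
    case 1
    show ?thesis
      by (rule sign_projection[of "{x}" "\<lambda>l. if l = i then 1 else 0" "\<lambda>l. if l = j then 1 else if l = j' then -1 else 0" "{y}"])
         (use that[of R for R] xy 1 k1 kN in \<open>auto split: if_splits\<close>)
  next
    case 2
    show ?thesis
      by (rule sign_projection[of "{x}" "\<lambda>l. if l = i then 1 else if l = i' then -1 else 0" "\<lambda>l. if l = j then 1 else 0" "{y}"])
         (use that xy 2 k1 kN in \<open>auto split: if_splits\<close>)
  next
    case 3
    have c: "card {x, (i', j)} \<le> k" "card {y, (i, j')} \<le> N - k" 
      by (rule le_trans[OF card_pair 3(3)]) (rule le_trans[OF card_pair 3(4)])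
    show ?thesis
      by (rule sign_projection[OF _ _ c(1) _ _ c(2), of "\<lambda>l. if l = i \<or> l = i' then 1 else 0" "\<lambda>l. if l = j then 1 else if l = j' then -1 else 0"])
         (use that xy 3 in \<open>auto split: if_splits\<close>)
  next
    case 4
    obtain R where R: "kproj N k R" "tr (R * Q x) = 1"
      by (rule sign_projection[of "{x}" "\<lambda>l. if l = i then 1 else 0" "\<lambda>l. if l = j then 1 else 0" "{}"])
         (use xy k1 in \<open>auto split: if_splits\<close>)
    have "(\<Sum>z\<in>I. Re (tr (R * Q z))) = Re (tr (R * Q x)) + (\<Sum>z\<in>I - {x}. Re (tr (R * Q z)))"
      using assms by (intro sum.remove) auto
    then have "(\<Sum>z\<in>I - {x}. Re (tr (R * Q z))) = 0" using Q_coeffs(3)[OF R(1)] R(2) 4 by simp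
    then have "Re (tr (R * Q y)) = 0"
      using Q_coeffs(1)[OF R(1)] assms by (subst (asm) sum_nonneg_eq_0_iff) auto
    then show ?thesis using that R Q_coeffs(2)[OF R(1) assms(2)] by simp
  next
    case 5
    obtain R where R: "kproj N k R" "tr (R * Q y) = 0"
      by (rule sign_projection[of "{}" "\<lambda>l. if l = i' then 1 else 0" "\<lambda>l. if l = j' then -1 else 0" "{y}"])
         (use xy 5 in \<open>auto split: if_splits\<close>)
    have nn: "\<And>z. z \<in> I - {y} \<Longrightarrow> 1 - Re (tr (R * Q z)) \<ge> 0" using Q_coeffs(1)[OF R(1)] by force
    have "(\<Sum>z\<in>I. Re (tr (R * Q z))) = Re (tr (R * Q y)) + (\<Sum>z\<in>I - {y}. Re (tr (R * Q z)))"
      using assms by (intro sum.remove) auto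
    then have "(\<Sum>z\<in>I - {y}. Re (tr (R * Q z))) = real k" using Q_coeffs(3)[OF R(1)] R(2) by simp
    moreover have "card (I - {y}) = k" using assms(2) 5 kN by simp
    ultimately have "(\<Sum>z\<in>I - {y}. 1 - Re (tr (R * Q z))) = 0" by (simp add: sum_subtractf)
    then have "1 - Re (tr (R * Q x)) = 0"
      using nn assms by (subst (asm) sum_nonneg_eq_0_iff) auto
    then show ?thesis using that R Q_coeffs(2)[OF R(1) assms(1)] by simp
  qed
qed

text \<open>For indices that differ in both places, \<open>f\<close> and \<open>g\<close> both alternate, so that the products at \<open>x\<close> and at
  \<open>y\<close> are positive and the two mixed ones negative.\<close>

lemma together:
  assumes "x \<in> I" "y \<in> I" "x \<noteq> y" "2 \<le> k" "2 \<le> N - k"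
  obtains R where "kproj N k R" "tr (R * Q x) = 1" "tr (R * Q y) = 1"
proof -
  obtain i j i' j' where xy: "x = (i, j)" "y = (i', j')" "i < m" "j < n" "i' < m" "j' < n" using assms by auto
  consider "i = i'" "j \<noteq> j'" | "i \<noteq> i'" "j = j'" | "i \<noteq> i'" "j \<noteq> j'"
    using assms(3) xy by blast
  then show ?thesis
  proof cases
    case 1
    show ?thesis
      by (rule sign_projection[of "{x, y}" "\<lambda>l. if l = i then 1 else 0" "\<lambda>l. if l = j \<or> l = j' then 1 else 0" "{}"])
         (use that xy 1 assms in \<open>auto split: if_splits intro: le_trans[OF card_pair]\<close>)
  next
    case 2
    show ?thesis
      by (rule sign_projection[of "{x, y}" "\<lambda>l. if l = i \<or> l = i' then 1 else 0" "\<lambda>l. if l = j then 1 else 0" "{}"])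
         (use that xy 2 assms in \<open>auto split: if_splits intro: le_trans[OF card_pair]\<close>)
  next
    case 3
    show ?thesis
      by (rule sign_projection[of "{x, y}" "\<lambda>l. if l = i then 1 else if l = i' then -1 else 0" "\<lambda>l. if l = j then 1 else if l = j' then -1 else 0" "{(i, j'), (i', j)}"])
         (use that xy 3 assms in \<open>auto split: if_splits intro: le_trans[OF card_pair]\<close>)
  qed
qed

end

end


text \<open>If \<open>P - P'\<close> and \<open>X + Y - I / k\<close> have the same ranges, the join of \<open>X\<close> and \<open>Y\<close> shows that
  some projection takes the value \<open>1\<close> at \<open>P\<close> and \<open>0\<close> at \<open>P'\<close>.\<close>

lemma orthogonal_of_opposite:
  assumes P: "atom P" "P \<in> corner N" "atom P'" "P' \<in> corner N" and X: "atom X" "X \<in> corner N" "atom Y" "Y \<in> corner N"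
    and k: "2 \<le> k" "k \<le> N"
    and krange: "krange N k (X + Y - (1 / of_nat k) *\<^sub>C Idm N) = krange N k (P - P')"
  shows "P' * P = 0"
proof -
  obtain R where R: "kproj N k R" "R * X = X" "R * Y = Y" using kproj_above_two_atoms[OF X k] .
  have "tr (R * (X + Y - (1 / of_nat k) *\<^sub>C Idm N)) = 1"
    using R X k by (simp add: distrib_left right_diff_distrib kproj_def)
  then have "1 \<in> krange N k (P - P')" unfolding krange[symmetric] using R(1) by (force simp: krange_def)
  then obtain S where S: "kproj N k S" "tr (S * (P - P')) = 1" by (auto simp: krange_def)
  have t: "tr (S * P) = 1 + tr (S * P')" using S(2) by (simp add: right_diff_distrib algebra_simps)
  have "Re (tr (S * P)) \<le> 1" using tr_proj_le(1)[OF S(1), of P] P by simp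
  moreover have "Re (tr (S * P')) \<ge> 0" "Im (tr (S * P')) = 0"
    using tr_proj_proj(1,2)[OF kprojD(1)[OF S(1)], of P'] P by simp_all
  ultimately have z: "tr (S * P') = 0" using t by (simp add: complex_eq_iff)
  then have "S * P' = 0" using tr_proj_proj(3)[OF kprojD(1)[OF S(1)], of P'] P by simp
  then have "P' * S = 0" using proj_orth_commute[OF kprojD(1)[OF S(1)], of P'] P by simp
  moreover have "S * P = P" using tr_proj_le(2)[OF S(1), of P] P t z by simp
  ultimately show ?thesis by (metis mult.assoc mult_zero_left)
qed

text \<open>Otherwise \<open>tr (X (I / k - X)) = 1 / k - 1\<close> would be nonnegative.\<close>

lemma atom_not_both:
  assumes "atom X" "X \<in> corner N" "2 \<le> k" shows "\<not> atom ((1 / of_nat k) *\<^sub>C Idm N - X)"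
proof
  let ?Y = "(1 / of_nat k) *\<^sub>C Idm N - X"
  assume "atom ?Y"
  then have "Re (tr (X * ?Y)) \<ge> 0" using assms tr_proj_proj(1)[of X ?Y] by simp
  moreover have "X * ?Y = (1 / of_nat k) *\<^sub>C X - X" using assms by (simp add: right_diff_distrib)
  then have "tr (X * ?Y) = of_real (1 / k - 1)" using assms by simp
  then have "Re (tr (X * ?Y)) = 1 / k - 1" by (simp only: Re_complex_of_real)
  moreover have "1 / real k < 1" using assms(3) by simp
  ultimately show False by simp
qed

context range_preserver
begin

text \<open>For \<open>N \<noteq> 2k\<close> the images are positive, and a projection separating two of them makes them orthogonal.
  For \<open>N = 2k\<close>, separating projections give \<open>M\<^sub>x M\<^sub>y = 0 = K\<^sub>x K\<^sub>y\<close>, and those with value \<open>1\<close> at both places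
  give \<open>M\<^sub>x K\<^sub>y = 0\<close>.\<close>

lemma resolution_Q:
  assumes p: "frame m p" and q: "frame n q"
  shows "(\<forall>x\<in>{..<m} \<times> {..<n}. atom (F (p (fst x)) (q (snd x)))) \<or>
    N = 2 * k \<and> (\<forall>x\<in>{..<m} \<times> {..<n}. atom ((1 / of_nat k) *\<^sub>C Idm N - F (p (fst x)) (q (snd x))))"
proof -
  let ?I = "{..<m} \<times> {..<n}" and ?Q = "\<lambda>x. F (p (fst x)) (q (snd x))"
  note ur = unit_krange_Q[OF p q] and trQ = tr_Q[OF p q] and sumQ = sum_Q[OF p q]
  have QN: "?Q x \<in> corner N" "adj (?Q x) = ?Q x" if "x \<in> ?I" for x using ur[OF that] by (auto simp: unit_krange_def)
  show ?thesis
  proof (cases "2 * k = N")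
    case False
    have psd: "psd N (?Q x)" if "x \<in> ?I" for x
      using unit_krange_trace(4)[OF ur[OF that] k1 kN False trQ[OF that]] .
    have orth: "?Q x * ?Q y = 0" if xy: "x \<in> ?I" "y \<in> ?I" "x \<noteq> y" for x y
    proof -
      obtain R where R: "kproj N k R" "tr (R * ?Q x) = 1" "tr (R * ?Q y) = 0" using separate[OF p q xy] .
      have x: "R * ?Q x = ?Q x" using psd_tr_compl(2)[OF psd[OF xy(1)] R(1)] R(2) trQ[OF xy(1)] by simp
      have "adj (R * ?Q x) = ?Q x" using x QN(2)[OF xy(1)] by simp
      then have "?Q x * R = ?Q x" using QN(2)[OF xy(1)] kprojD(1)[OF R(1)] by simp
      moreover have "R * ?Q y = 0" using psd_tr_proj(3)[OF psd[OF xy(2)] kprojD(1)[OF R(1)] R(3)] .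
      ultimately show ?thesis by (metis mult.assoc mult_zero_right)
    qed
    have "atom (?Q x)" if "x \<in> ?I" for x
      by (rule resolution_atoms[of ?I ?Q N x]) (use QN trQ orth sumQ that in auto)
    then show ?thesis by blast
  next
    case True
    have k2: "2 \<le> k" "2 \<le> N - k" using True N4 by linarith+
    have ex: "\<forall>x\<in>?I. \<exists>(g::real) M K. ?Q x = complex_of_real g *\<^sub>C Idm N + M - K \<and> psd N M \<and> psd N K \<and> M * K = 0 \<and> K * M = 0 \<and>
      tr M = of_real (1 - k * g) \<and> tr K = of_real (k * g) \<and>
      (\<forall>R. kproj N k R \<longrightarrow> tr (R * ?Q x) = 1 \<longrightarrow> R * M = M \<and> R * K = 0) \<and>
      (\<forall>R. kproj N k R \<longrightarrow> tr (R * ?Q x) = 0 \<longrightarrow> R * M = 0 \<and> R * K = K)" (is "\<forall>x\<in>?I. \<exists>g M K. ?Z x g M K")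
    proof
      fix x assume x: "x \<in> ?I"
      show "\<exists>g M K. ?Z x g M K"
      proof (rule unit_krange_half[OF ur[OF x] k1 _ trQ[OF x]])
        show "N = 2 * k" using True by simp
        fix g :: real and M K
        assume "?Q x = complex_of_real g *\<^sub>C Idm N + M - K" "psd N M" "psd N K" "M * K = 0" "K * M = 0"
          "tr M = of_real (1 - k * g)" "tr K = of_real (k * g)"
          "\<And>R. kproj N k R \<Longrightarrow> tr (R * ?Q x) = 1 \<Longrightarrow> R * M = M \<and> R * K = 0"
          "\<And>R. kproj N k R \<Longrightarrow> tr (R * ?Q x) = 0 \<Longrightarrow> R * M = 0 \<and> R * K = K"
        then have "?Z x g M K" by blast
        then show "\<exists>g M K. ?Z x g M K" by blast
      qed
    qed
    obtain g where g: "\<forall>x\<in>?I. \<exists>M K. ?Z x (g x) M K" using bchoice[OF ex] by (elim exE) (rule that)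
    obtain M where M: "\<forall>x\<in>?I. \<exists>K. ?Z x (g x) (M x) K" using bchoice[OF g] by (elim exE) (rule that)
    obtain K where Z: "\<forall>x\<in>?I. ?Z x (g x) (M x) (K x)" using bchoice[OF M] by (elim exE) (rule that)
    have Qd: "?Q x = complex_of_real (g x) *\<^sub>C Idm N + M x - K x" and M: "psd N (M x)" "tr (M x) = of_real (1 - k * g x)"
      and K: "psd N (K x)" "tr (K x) = of_real (k * g x)" and same: "M x * K x = 0" "K x * M x = 0"
      if "x \<in> ?I" for x using bspec[OF Z that] by blast+
    have top: "R * M x = M x \<and> R * K x = 0" if "x \<in> ?I" "kproj N k R" "tr (R * ?Q x) = 1" for x R
      using bspec[OF Z that(1)] that(2,3) by blast
    have bot: "R * M x = 0 \<and> R * K x = K x" if "x \<in> ?I" "kproj N k R" "tr (R * ?Q x) = 0" for x R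
      using bspec[OF Z that(1)] that(2,3) by blast
    have absorb: "A * B = 0" if "R * A = A" "R * B = 0" "adj A = A" "proj R" for A B R
    proof -
      have "adj (R * A) = A" using that by simp
      then have "A * R = A" using that(3,4) by simp
      then show ?thesis using that(2) by (metis mult.assoc mult_zero_right)
    qed
    have orth: "M x * M y = 0" "K x * K y = 0" "M x * K y = 0" "K x * M y = 0"
      if xy: "x \<in> ?I" "y \<in> ?I" "x \<noteq> y" for x y
    proof -
      note aM = psd_adj[OF M(1)[OF xy(1)]] and aK = psd_adj[OF K(1)[OF xy(1)]]
      obtain R where R: "kproj N k R" "tr (R * ?Q x) = 1" "tr (R * ?Q y) = 0" using separate[OF p q xy] .
      show "M x * M y = 0" by (rule absorb[of R]) (use top[OF xy(1) R(1,2)] bot[OF xy(2) R(1,3)] aM kprojD(1)[OF R(1)] in auto)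
      obtain R' where R': "kproj N k R'" "tr (R' * ?Q y) = 1" "tr (R' * ?Q x) = 0" using separate[OF p q xy(2,1)] xy(3) by metis
      show "K x * K y = 0" by (rule absorb[of R']) (use bot[OF xy(1) R'(1,3)] top[OF xy(2) R'(1,2)] aK kprojD(1)[OF R'(1)] in auto)
      obtain S where S: "kproj N k S" "tr (S * ?Q x) = 1" "tr (S * ?Q y) = 1" using together[OF p q xy k2] .
      show MK: "M x * K y = 0" by (rule absorb[of S]) (use top[OF xy(1) S(1,2)] top[OF xy(2) S(1,3)] aM kprojD(1)[OF S(1)] in auto)
      have "M y * K x = 0" by (rule absorb[of S])
        (use top[OF xy(1) S(1,2)] top[OF xy(2) S(1,3)] psd_adj[OF M(1)[OF xy(2)]] kprojD(1)[OF S(1)] in auto)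
      from arg_cong[OF this, of adj] show "K x * M y = 0" using aK psd_adj[OF M(1)[OF xy(2)]] by simp
    qed
    have "(\<forall>x\<in>?I. atom (?Q x)) \<or> (\<forall>x\<in>?I. atom ((1 / of_nat k) *\<^sub>C Idm N - ?Q x))"
    proof (rule resolution_half[where I = ?I and N = N and k = k and Q = ?Q and g = g and M = M and K = K])
      show "M x * K y = 0" if "x \<in> ?I" "y \<in> ?I" for x y
        using orth(3)[OF that] same(1)[OF that(1)] by (cases "x = y") blast+
      show "K x * M y = 0" if "x \<in> ?I" "y \<in> ?I" for x y
        using orth(4)[OF that] same(2)[OF that(1)] by (cases "x = y") blast+
      show "finite ?I" "card ?I = N" by simp_all
      show "N = 2 * k" using True by simp
    qed (rule k1 Qd M K orth(1,2) sumQ; assumption?)+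
    then show ?thesis using True by simp
  qed
qed

definition pos_type :: "fmat \<Rightarrow> fmat \<Rightarrow> bool" where "pos_type a b \<longleftrightarrow> atom (F a b)"

definition neg_type :: "fmat \<Rightarrow> fmat \<Rightarrow> bool" where
  "neg_type a b \<longleftrightarrow> N = 2 * k \<and> atom ((1 / of_nat k) *\<^sub>C Idm N - F a b)"

lemma pos_not_neg:
  assumes "a \<in> corner m" "b \<in> corner n" "pos_type a b" shows "\<not> neg_type a b"
proof
  assume "neg_type a b"
  then have "N = 2 * k" by (simp add: neg_type_def)
  then have "2 \<le> k" using N4 by linarith
  then show False
    using atom_not_both[of "F a b" N k] closed[OF assms(1,2)] assms(3) \<open>neg_type a b\<close> by (simp add: pos_type_def neg_type_def)
qed

lemma frame_uniform:
  assumes p: "frame m p" and q: "frame n q" and ij: "i < m" "j < n" "i' < m" "j' < n"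
  shows "pos_type (p i) (q j) \<or> neg_type (p i) (q j)" "pos_type (p i) (q j) \<Longrightarrow> neg_type (p i') (q j') \<Longrightarrow> False"
proof -
  have c: "(\<forall>x\<in>{..<m} \<times> {..<n}. pos_type (p (fst x)) (q (snd x))) \<or> (\<forall>x\<in>{..<m} \<times> {..<n}. neg_type (p (fst x)) (q (snd x)))"
    using resolution_Q[OF p q] unfolding pos_type_def neg_type_def by blast
  have "pos_type (p i) (q j) \<and> pos_type (p i') (q j') \<or> neg_type (p i) (q j) \<and> neg_type (p i') (q j')"
    using c ij by fastforce
  moreover have "\<not> (pos_type (p i) (q j) \<and> neg_type (p i) (q j))" "\<not> (pos_type (p i') (q j') \<and> neg_type (p i') (q j'))"
    using pos_not_neg frameD(2)[OF p] frameD(2)[OF q] ij by blast+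
  ultimately show "pos_type (p i) (q j) \<or> neg_type (p i) (q j)" "pos_type (p i) (q j) \<Longrightarrow> neg_type (p i') (q j') \<Longrightarrow> False" by blast+
qed

lemma pos_or_neg:
  assumes a: "atom a" "a \<in> corner m" and b: "atom b" "b \<in> corner n"
  shows "pos_type a b \<or> neg_type a b"
proof -
  obtain p where p: "frame m p" "p 0 = a" using frame_with_atom[OF a] m2 by auto
  obtain q where q: "frame n q" "q 0 = b" using frame_with_atom[OF b] n2 by auto
  show ?thesis using frame_uniform(1)[OF p(1) q(1), of 0 0 0 0] p(2) q(2) m2 n2 by simp
qed

lemma neg_half: "neg_type a b \<Longrightarrow> N = 2 * k \<and> 2 \<le> k"
  using N4 by (simp add: neg_type_def)

text \<open>If \<open>F(a, b)\<close> and \<open>I / k - F(a', b)\<close> are rank one projections, the matrix \<open>F(a - a', b)\<close> has the shape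
  that makes \<open>a\<close> and \<open>a'\<close> orthogonal; but orthogonal rank one projections belong to a common orthonormal
  basis, where mixed types do not occur.\<close>

lemma same_type_left:
  assumes a: "atom a" "a \<in> corner m" and a': "atom a'" "a' \<in> corner m" and b: "atom b" "b \<in> corner n"
    and pm: "pos_type a b" "neg_type a' b"
  shows False
proof -
  let ?Y = "(1 / of_nat k) *\<^sub>C Idm N - F a' b"
  have k: "2 \<le> k" "k \<le> N" using neg_half[OF pm(2)] by auto
  have FN: "F a b \<in> corner N" "F a' b \<in> corner N" using a a' b by (auto intro: closed)
  have "F a b + ?Y - (1 / of_nat k) *\<^sub>C Idm N = F (a - a') b" using a a' b by (simp add: diff1)
  moreover have "kron n (a - a') b = kron n a b - kron n a' b"
    using kron_lin(1)[of n "a - a'" a' b] by (simp add: eq_diff_eq)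
  ultimately have "krange N k (F a b + ?Y - (1 / of_nat k) *\<^sub>C Idm N) = krange N k (kron n a b - kron n a' b)"
    using krange_F[of "a - a'" b] a a' b by simp
  then have "kron n a' b * kron n a b = 0"
  proof (rule orthogonal_of_opposite[OF _ _ _ _ _ _ _ _ k, rotated -1])
    show "atom (F a b)" "atom ?Y" using pm unfolding pos_type_def neg_type_def by blast+
  qed (simp_all only: atom_kron kron_rect n0 a a' b FN rect_closed)
  then have "tr (kron n (a' * a) (b * b)) = 0" using b by (simp add: kron_mult n0)
  then have "tr (a' * a) = 0" using b by (simp add: tr_kron n0)
  then have "a' * a = 0" using tr_proj_proj(3)[of a' a] a a' by simp
  then have "a * a' = 0" using proj_orth_commute[of a a'] a a' by simp
  then obtain p where p: "frame m p" "p 0 = a" "p 1 = a'" using frame_with_two_atoms[OF a a'] m2 by auto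
  obtain q where q: "frame n q" "q 0 = b" using frame_with_atom[OF b] n2 by auto
  show False using frame_uniform(2)[OF p(1) q(1), of 0 0 1 0] p q m2 n2 pm by simp
qed

lemma same_type_right:
  assumes a: "atom a" "a \<in> corner m" and b: "atom b" "b \<in> corner n" and b': "atom b'" "b' \<in> corner n"
    and pm: "pos_type a b" "neg_type a b'"
  shows False
proof -
  let ?Y = "(1 / of_nat k) *\<^sub>C Idm N - F a b'"
  have k: "2 \<le> k" "k \<le> N" using neg_half[OF pm(2)] by auto
  have FN: "F a b \<in> corner N" "F a b' \<in> corner N" using a b b' by (auto intro: closed)
  have "F a b + ?Y - (1 / of_nat k) *\<^sub>C Idm N = F a (b - b')" using a b b' by (simp add: diff2)
  moreover have "kron n a (b - b') = kron n a b - kron n a b'"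
    using kron_lin(2)[of n a "b - b'" b'] by (simp add: eq_diff_eq)
  ultimately have "krange N k (F a b + ?Y - (1 / of_nat k) *\<^sub>C Idm N) = krange N k (kron n a b - kron n a b')"
    using krange_F[of a "b - b'"] a b b' by simp
  then have "kron n a b' * kron n a b = 0"
  proof (rule orthogonal_of_opposite[OF _ _ _ _ _ _ _ _ k, rotated -1])
    show "atom (F a b)" "atom ?Y" using pm unfolding pos_type_def neg_type_def by blast+
  qed (simp_all only: atom_kron kron_rect n0 a b b' FN rect_closed)
  then have "tr (kron n (a * a) (b' * b)) = 0" using b' by (simp add: kron_mult n0)
  then have "tr (b' * b) = 0" using a b b' by (simp add: tr_kron n0)
  then have "b' * b = 0" using tr_proj_proj(3)[of b' b] b b' by simp
  then have "b * b' = 0" using proj_orth_commute[of b b'] b b' by simp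
  then obtain q where q: "frame n q" "q 0 = b" "q 1 = b'" using frame_with_two_atoms[OF b b'] n2 by auto
  obtain p where p: "frame m p" "p 0 = a" using frame_with_atom[OF a] m2 by auto
  show False using frame_uniform(2)[OF p(1) q(1), of 0 0 0 1] p q m2 n2 pm by simp
qed

text \<open>Two product states are connected by changing one factor at a time.\<close>

lemma type_uniform:
  "(\<forall>a b. atom a \<longrightarrow> a \<in> corner m \<longrightarrow> atom b \<longrightarrow> b \<in> corner n \<longrightarrow> pos_type a b) \<or>
   (\<forall>a b. atom a \<longrightarrow> a \<in> corner m \<longrightarrow> atom b \<longrightarrow> b \<in> corner n \<longrightarrow> neg_type a b)"
proof (rule ccontr)
  assume "\<not> ?thesis"
  then obtain a b a' b' where a: "atom a" "a \<in> corner m" and b: "atom b" "b \<in> corner n" and "\<not> neg_type a b"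
    and a': "atom a'" "a' \<in> corner m" and b': "atom b'" "b' \<in> corner n" and "\<not> pos_type a' b'" by blast
  then have "pos_type a b" "neg_type a' b'" using pos_or_neg by blast+
  show False
  proof (cases "pos_type a' b")
    case True
    then show False using same_type_right[OF a' b b'] \<open>neg_type a' b'\<close> by blast
  next
    case False
    then have "neg_type a' b" using pos_or_neg[OF a' b] by blast
    then show False using same_type_left[OF a a' b] \<open>pos_type a b\<close> by blast
  qed
qed

end

locale atom_preserver = bilinear_on m n N F for m n N F +
  assumes m0: "0 < m" and n0: "0 < n" and unital: "F (Idm m) (Idm n) = Idm N"
    and atoms: "atom a \<Longrightarrow> a \<in> corner m \<Longrightarrow> atom b \<Longrightarrow> b \<in> corner n \<Longrightarrow> atom (F a b)"

lemma (in range_preserver) atom_preserver_cases: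
  "atom_preserver m n N F \<or>
   N = 2 * k \<and> atom_preserver m n N (\<lambda>a b. (tr (kron n a b) / of_nat k) *\<^sub>C Idm N - F a b)"
  using type_uniform
proof
  assume p: "\<forall>a b. atom a \<longrightarrow> a \<in> corner m \<longrightarrow> atom b \<longrightarrow> b \<in> corner n \<longrightarrow> pos_type a b"
  have "atom_preserver m n N F"
    by unfold_locales (use p m2 n2 unital_F in \<open>auto simp: pos_type_def\<close>)
  then show ?thesis ..
next
  let ?G = "\<lambda>a b. (tr (kron n a b) / of_nat k) *\<^sub>C Idm N - F a b"
  assume p: "\<forall>a b. atom a \<longrightarrow> a \<in> corner m \<longrightarrow> atom b \<longrightarrow> b \<in> corner n \<longrightarrow> neg_type a b"
  have "E 0 0 \<in> corner m" "E 0 0 \<in> corner n" using m2 n2 by auto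
  then have "neg_type (E 0 0) (E 0 0)" using p by auto
  then have N2: "N = 2 * k" by (simp add: neg_type_def)
  have p': "atom ((1 / of_nat k) *\<^sub>C Idm N - F a b)"
    if "atom a" "a \<in> corner m" "atom b" "b \<in> corner n" for a b
    using p that unfolding neg_type_def by blast
  have "of_nat N = (2 * of_nat k :: complex)" using N2 by (metis of_nat_mult of_nat_numeral)
  then have t: "tr (kron n (Idm m) (Idm n)) / of_nat k = 2" using k1 by (simp add: kron_Idm n0 del: of_nat_mult)
  have "atom_preserver m n N ?G"
  proof unfold_locales
    show "?G (Idm m) (Idm n) = Idm N" unfolding t unital_F by (rule fmat_eqI) simp
    show "atom (?G a b)" if "atom a" "a \<in> corner m" "atom b" "b \<in> corner n" for a b
      using p'[OF that] that by (simp add: tr_kron n0)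
  qed (use m2 n2 in \<open>auto simp: closed add1 add2 smul1 smul2 kron_lin add_divide_distrib smul_simps\<close>)
  then show ?thesis using N2 by blast
qed


section \<open>Jordan homomorphisms\<close>

definition star_linear :: "nat \<Rightarrow> nat \<Rightarrow> (fmat \<Rightarrow> fmat) \<Rightarrow> bool" where
  "star_linear m N g \<longleftrightarrow> (\<forall>A\<in>corner m. g A \<in> corner N \<and> g (adj A) = adj (g A) \<and> (\<forall>c. g (c *\<^sub>C A) = c *\<^sub>C g A)
     \<and> (\<forall>B\<in>corner m. g (A + B) = g A + g B))"

definition jordan :: "nat \<Rightarrow> nat \<Rightarrow> (fmat \<Rightarrow> fmat) \<Rightarrow> bool" where
  "jordan m N g \<longleftrightarrow> star_linear m N g \<and> (\<forall>A\<in>corner m. g (A * A) = g A * g A)"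

lemma star_linearD:
  assumes "star_linear m N g"
  shows "A \<in> corner m \<Longrightarrow> g A \<in> corner N" "A \<in> corner m \<Longrightarrow> g (adj A) = adj (g A)"
    "A \<in> corner m \<Longrightarrow> g (c *\<^sub>C A) = c *\<^sub>C g A" "A \<in> corner m \<Longrightarrow> B \<in> corner m \<Longrightarrow> g (A + B) = g A + g B"
    "g 0 = 0" "A \<in> corner m \<Longrightarrow> B \<in> corner m \<Longrightarrow> g (A - B) = g A - g B"
proof -
  have sm: "\<And>A c. A \<in> corner m \<Longrightarrow> g (c *\<^sub>C A) = c *\<^sub>C g A"
    and ad: "\<And>A B. A \<in> corner m \<Longrightarrow> B \<in> corner m \<Longrightarrow> g (A + B) = g A + g B"
    using assms unfolding star_linear_def by blast+
  show "A \<in> corner m \<Longrightarrow> g A \<in> corner N" "A \<in> corner m \<Longrightarrow> g (adj A) = adj (g A)"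
    "A \<in> corner m \<Longrightarrow> g (c *\<^sub>C A) = c *\<^sub>C g A" "A \<in> corner m \<Longrightarrow> B \<in> corner m \<Longrightarrow> g (A + B) = g A + g B"
    using assms unfolding star_linear_def by blast+
  show "g 0 = 0" using sm[of 0 0] by simp
  show "A \<in> corner m \<Longrightarrow> B \<in> corner m \<Longrightarrow> g (A - B) = g A - g B"
    using ad[of "A - B" B] by simp
qed

lemma star_linear_sum:
  assumes g: "star_linear m N g" and f: "\<And>x. x \<in> S \<Longrightarrow> f x \<in> corner m"
  shows "g (\<Sum>x\<in>S. f x) = (\<Sum>x\<in>S. g (f x))"
  using f
proof (induction S rule: infinite_finite_induct)
  case (insert x S)
  then have "(\<Sum>x\<in>S. f x) \<in> corner m" by blast
  then show ?case using insert by (simp add: star_linearD(4)[OF g])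
qed (simp_all add: star_linearD(5)[OF g])

lemma hermitian_parts:
  assumes "A \<in> corner m"
  obtains H K where "H \<in> corner m" "K \<in> corner m" "adj H = H" "adj K = K" "A = H + \<i> *\<^sub>C K"
proof (rule that[of "(1/2) *\<^sub>C (A + adj A)" "(- \<i>/2) *\<^sub>C (A - adj A)"])
  show "A = (1/2) *\<^sub>C (A + adj A) + \<i> *\<^sub>C ((- \<i>/2) *\<^sub>C (A - adj A))"
    by (rule fmat_eqI) (simp add: field_simps)
  show "adj ((1/2) *\<^sub>C (A + adj A)) = (1/2) *\<^sub>C (A + adj A)" "adj ((- \<i>/2) *\<^sub>C (A - adj A)) = (- \<i>/2) *\<^sub>C (A - adj A)"
    by (rule fmat_eqI; simp add: field_simps)+
qed (use assms in auto)

text \<open>By the spectral theorem the rank one projections span the matrix algebra.\<close>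

lemma atom_induct:
  assumes A: "A \<in> corner m" and atoms: "\<And>a. atom a \<Longrightarrow> a \<in> corner m \<Longrightarrow> P a"
    and add: "\<And>A B. A \<in> corner m \<Longrightarrow> B \<in> corner m \<Longrightarrow> P A \<Longrightarrow> P B \<Longrightarrow> P (A + B)"
    and smul: "\<And>c A. A \<in> corner m \<Longrightarrow> P A \<Longrightarrow> P (c *\<^sub>C A)" and zero: "P 0"
  shows "P A"
proof -
  have sum: "P (\<Sum>x\<in>S. f x)" if "\<And>x. x \<in> S \<Longrightarrow> P (f x) \<and> f x \<in> corner m" for S :: "nat set" and f
    using that
  proof (induction S rule: infinite_finite_induct)
    case (insert x S)
    then have "(\<Sum>x\<in>S. f x) \<in> corner m" by blast
    then show ?case using insert add by simp
  qed (simp_all add: zero)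
  have herm: "P H" if H: "H \<in> corner m" "adj H = H" for H
  proof -
    obtain p l where p: "frame m p" "H = (\<Sum>i<m. complex_of_real (l i) *\<^sub>C p i)" using spectral[OF H] .
    show ?thesis unfolding p(2) using frameD(1,2)[OF p(1)] by (intro sum) (auto intro: smul atoms)
  qed
  obtain H K where HK: "H \<in> corner m" "K \<in> corner m" "adj H = H" "adj K = K" "A = H + \<i> *\<^sub>C K"
    using hermitian_parts[OF A] .
  show ?thesis unfolding HK(5) using HK by (intro add smul herm) auto
qed

lemma unit_induct:
  assumes A: "A \<in> corner m" and units: "\<And>i j. i < m \<Longrightarrow> j < m \<Longrightarrow> P (E i j)"
    and add: "\<And>A B. A \<in> corner m \<Longrightarrow> B \<in> corner m \<Longrightarrow> P A \<Longrightarrow> P B \<Longrightarrow> P (A + B)"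
    and smul: "\<And>c A. A \<in> corner m \<Longrightarrow> P A \<Longrightarrow> P (c *\<^sub>C A)" and zero: "P 0"
  shows "P A"
proof -
  have sum: "P (\<Sum>x\<in>S. f x)" if "\<And>x. x \<in> S \<Longrightarrow> P (f x) \<and> f x \<in> corner m" for S :: "nat set" and f
    using that
  proof (induction S rule: infinite_finite_induct)
    case (insert x S)
    then have "(\<Sum>x\<in>S. f x) \<in> corner m" by blast
    then show ?case using insert add by simp
  qed (simp_all add: zero)
  show ?thesis
    by (subst corner_expand[OF A], intro sum conjI rect_sum) (auto intro: smul units)
qed

text \<open>Polarization among Hermitian matrices gives the Jordan product of the two parts of \<open>A = H + i K\<close>.\<close>

lemma jordan_of_hermitian:
  assumes g: "star_linear m N g" and sq: "\<And>H. H \<in> corner m \<Longrightarrow> adj H = H \<Longrightarrow> g (H * H) = g H * g H"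
  shows "jordan m N g"
  unfolding jordan_def
proof (intro conjI ballI g)
  fix A assume A: "A \<in> corner m"
  obtain H K where HK: "H \<in> corner m" "K \<in> corner m" "adj H = H" "adj K = K" "A = H + \<i> *\<^sub>C K"
    using hermitian_parts[OF A] .
  note l = star_linearD[OF g]
  have "g ((H + K) * (H + K)) = (g H + g K) * (g H + g K)" using sq[of "H + K"] HK by (simp add: l)
  then have "g (H * H) + g (H * K + K * H) + g (K * K) = g H * g H + (g H * g K + g K * g H) + g K * g K"
    using HK by (simp add: l distrib_left distrib_right add_ac)
  then have c: "g (H * K + K * H) = g H * g K + g K * g H" using sq HK by simp
  have "A * A = (H * H - K * K) + \<i> *\<^sub>C (H * K + K * H)"
    by (simp add: HK(5) distrib_left distrib_right smul_simps)
  then have "g (A * A) = (g (H * H) - g (K * K)) + \<i> *\<^sub>C g (H * K + K * H)" using HK by (simp add: l)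
  also have "\<dots> = (g H + \<i> *\<^sub>C g K) * (g H + \<i> *\<^sub>C g K)"
    using sq HK c by (simp add: distrib_left distrib_right smul_simps)
  also have "g H + \<i> *\<^sub>C g K = g A" using HK by (simp add: l)
  finally show "g (A * A) = g A * g A" .
qed

lemma jordan_comm:
  assumes g: "jordan m N g" and AB: "A \<in> corner m" "B \<in> corner m"
  shows "g (A * B + B * A) = g A * g B + g B * g A"
proof -
  have g': "star_linear m N g" and sq: "\<And>A. A \<in> corner m \<Longrightarrow> g (A * A) = g A * g A" using g by (auto simp: jordan_def)
  note l = star_linearD[OF g']
  have "g ((A + B) * (A + B)) = (g A + g B) * (g A + g B)" using sq[of "A + B"] AB by (simp add: l)
  then have "g (A * A) + g (A * B + B * A) + g (B * B) = g A * g A + (g A * g B + g B * g A) + g B * g B"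
    using AB by (simp add: l distrib_left distrib_right add_ac)
  then show ?thesis using sq AB by simp
qed

text \<open>\<open>2 A B A = A (A B + B A) + (A B + B A) A - (A\<^sup>2 B + B A\<^sup>2)\<close> writes the triple product in terms of
  Jordan products.\<close>

lemma jordan_triple:
  assumes g: "jordan m N g" and AB: "A \<in> corner m" "B \<in> corner m"
  shows "g (A * B * A) = g A * g B * g A"
proof -
  have g': "star_linear m N g" and sq: "\<And>A. A \<in> corner m \<Longrightarrow> g (A * A) = g A * g A" using g by (auto simp: jordan_def)
  note l = star_linearD[OF g']
  let ?C = "A * B + B * A"
  have "g (A * ?C + ?C * A) = g A * (g A * g B + g B * g A) + (g A * g B + g B * g A) * g A"
    using jordan_comm[OF g, of A ?C] jordan_comm[OF g AB] AB by simp
  moreover have "A * ?C + ?C * A = (A * A * B + B * (A * A)) + 2 *\<^sub>C (A * B * A)"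
    by (simp add: distrib_left distrib_right mult.assoc smul_simps(1)[of 1 1, simplified])
  moreover have "g ((A * A * B + B * (A * A)) + 2 *\<^sub>C (A * B * A)) = (g A * g A * g B + g B * (g A * g A)) + 2 *\<^sub>C g (A * B * A)"
    using jordan_comm[OF g, of "A * A" B] sq AB by (simp add: l)
  ultimately have "2 *\<^sub>C g (A * B * A) = 2 *\<^sub>C (g A * g B * g A)"
    by (simp add: distrib_left distrib_right mult.assoc add_ac smul_simps(1)[of 1 1, simplified])
  then show ?thesis by simp
qed

lemma jordan_trn: assumes "jordan m N g" shows "jordan m N (\<lambda>A. g (trn A))"
proof -
  have g: "star_linear m N g" "\<And>A. A \<in> corner m \<Longrightarrow> g (A * A) = g A * g A" using assms by (auto simp: jordan_def)
  show ?thesis unfolding jordan_def star_linear_def by (simp add: g(2) star_linearD[OF g(1)])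
qed

text \<open>A Jordan homomorphism sending the diagonal matrix units to rank one projections sends
  every off-diagonal unit either into the same block or into the transposed one; all units
  make the same choice, so the map is a homomorphism or an antihomomorphism.\<close>

locale jordan_units =
  fixes m N :: nat and g :: "fmat \<Rightarrow> fmat"
  assumes m0: "0 < m" and jordan: "jordan m N g" and diag: "i < m \<Longrightarrow> atom (g (E i i))"
begin

lemma g_lin: "star_linear m N g" using jordan by (simp add: jordan_def)

abbreviation "Z i j \<equiv> g (E i j)"

lemma Z_adj: "i < m \<Longrightarrow> j < m \<Longrightarrow> adj (Z i j) = Z j i"
  using star_linearD(2)[OF g_lin, of "E i j"] by simp

lemma Z_comm:
  assumes "i < m" "j < m" "k < m" "l < m"
  shows "Z i j * Z k l + Z k l * Z i j = (if j = k then Z i l else 0) + (if l = i then Z k j else 0)"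
proof -
  have "g (E i j * E k l + E k l * E i j) = Z i j * Z k l + Z k l * Z i j"
    by (rule jordan_comm[OF jordan]) (use assms in auto)
  then show ?thesis using assms star_linearD(5)[OF g_lin] star_linearD(4)[OF g_lin, of "E i l" "E k j"] by auto
qed

lemma diag_idem: "i < m \<Longrightarrow> Z i i * Z i i = Z i i" "i < m \<Longrightarrow> Z i i * (Z i i * A) = Z i i * A"
  using diag[of i] by auto

lemma diag_orth: assumes "i < m" "j < m" "i \<noteq> j" shows "Z i i * Z j j = 0" "Z i i * (Z j j * A) = 0"
proof -
  have "Z i i * Z j j + Z j j * Z i i = 0" using Z_comm[of i i j j] assms by simp
  then have "tr (Z i i * Z j j) + tr (Z j j * Z i i) = 0" by (metis tr_lin(1,5))
  then have "tr (Z i i * Z j j) = 0" using tr_mult[of "Z i i" "Z j j"] by simp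
  then show 1: "Z i i * Z j j = 0" using tr_proj_proj(3)[of "Z i i" "Z j j"] diag assms by simp
  show "Z i i * (Z j j * A) = 0" by (simp add: 1 mult.assoc[symmetric])
qed

text \<open>With respect to the orthogonal projections \<open>P\<close> and \<open>R\<close> at \<open>i\<close> and \<open>j\<close>, the image \<open>Z\<close> of the matrix unit has only
  the corners \<open>Y = P Z = P Z R\<close> and \<open>Y' = Z P = R Z P\<close>.  As \<open>Z\<^sup>2 = 0\<close> gives \<open>Y Y' = 0\<close> and both corners are one by
  one, one of them vanishes.\<close>

lemma off_diag:
  assumes "i < m" "j < m" "i \<noteq> j"
  shows "Z i i * Z i j + Z i j * Z i i = Z i j" "Z j j * Z i j + Z i j * Z j j = Z i j"
    "Z i i * Z i j = 0 \<or> Z i j * Z i i = 0"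
proof -
  let ?P = "Z i i" and ?R = "Z j j" and ?Z = "Z i j"
  show 1: "?P * ?Z + ?Z * ?P = ?Z" using Z_comm[of i i i j] assms by simp
  show 2: "?R * ?Z + ?Z * ?R = ?Z" using Z_comm[of j j i j] assms by simp
  note o = diag_orth[OF assms] diag_orth[OF assms(2,1) assms(3)[symmetric]]
  have "?P * ?Z = ?P * (?R * ?Z + ?Z * ?R)" using 2 by simp
  also have "\<dots> = ?P * ?Z * ?R" by (simp only: distrib_left o mult.assoc add_0_left)
  finally have X: "?P * ?Z = ?P * ?Z * ?R" .
  have "?Z * ?P = (?R * ?Z + ?Z * ?R) * ?P" using 2 by simp
  also have "\<dots> = ?R * ?Z * ?P" by (simp only: distrib_right o mult.assoc mult_zero_right add_0_right)
  finally have X': "?Z * ?P = ?R * ?Z * ?P" .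
  define Y where "Y = ?P * ?Z"
  define Y' where "Y' = ?Z * ?P"
  have PY: "?P * Y = Y" "?P * Y' = 0" "?R * Y' = Y'" "Y * ?R = Y" "Y * ?P = 0" "Y' * ?P = Y'"
  proof -
    show "?P * Y = Y" "Y' * ?P = Y'" using assms by (simp_all add: Y_def Y'_def diag_idem mult.assoc)
    have "?P * Y' = ?P * (?R * ?Z * ?P)" unfolding Y'_def by (rule arg_cong[OF X'])
    then show "?P * Y' = 0" by (simp add: mult.assoc o)
    show "?R * Y' = Y'" using X' by (simp add: Y'_def mult.assoc)
    show "Y * ?R = Y" unfolding Y_def by (rule X[symmetric])
    have "Y * ?P = ?P * ?Z * ?R * ?P" unfolding Y_def by (rule arg_cong[OF X])
    then show "Y * ?P = 0" by (simp add: mult.assoc o)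
  qed
  have "?Z * ?Z = 0"
    using Z_comm[of i j i j] assms by (simp add: fm.scale_left_distrib[of 1 1, simplified, symmetric])
  moreover have "?Z = Y + Y'" using 1 by (simp add: Y_def Y'_def)
  ultimately have "?P * ((Y + Y') * (Y + Y')) * ?P = 0" by simp
  also have "?P * ((Y + Y') * (Y + Y')) * ?P = (?P * Y + ?P * Y') * (Y * ?P + Y' * ?P)"
    by (simp add: distrib_left distrib_right mult.assoc)
  finally have YY': "Y * Y' = 0" by (simp add: PY)
  have "adj Y * Y = ?R * (adj Y * Y) * ?R"
  proof -
    have "adj (Y * ?R) = ?R * adj Y" using diag[OF assms(2)] by simp
    then have "?R * adj Y = adj Y" by (simp add: PY)
    then show ?thesis by (simp add: mult.assoc PY) (simp add: mult.assoc[symmetric])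
  qed
  then obtain c where c: "adj Y * Y = c *\<^sub>C ?R" using atom_sandwich[OF diag[OF assms(2)]] by metis
  have "adj Y * Y * Y' = 0" by (simp add: mult.assoc YY')
  then have "c *\<^sub>C Y' = 0" by (simp add: c PY)
  then have "c = 0 \<or> Y' = 0" by simp
  then show "?P * ?Z = 0 \<or> ?Z * ?P = 0"
    using c tr_adj_eq_0[of Y] by (auto simp: Y_def Y'_def)
qed

lemma off_diag_nz: assumes "i < m" "j < m" "i \<noteq> j" shows "Z i j \<noteq> 0"
proof
  assume "Z i j = 0"
  then have "Z i i + Z j j = 0" using Z_comm[of i j j i] assms by simp
  then have "tr (Z i i) + tr (Z j j) = 0" by (metis tr_lin(1,5))
  then show False using diag assms by simp
qed

text \<open>If the units \<open>0 j\<close> and \<open>0 l\<close> were sent to opposite corners, the image of the unit \<open>j l\<close>, which is the Jordan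
  product of the units \<open>j 0\<close> and \<open>0 l\<close>, would vanish.\<close>

lemma same_choice:
  assumes "j < m" "l < m" "j \<noteq> 0" "l \<noteq> 0" and j: "Z 0 j * Z 0 0 = 0" and l: "Z 0 0 * Z 0 l = 0"
  shows False
proof (cases "j = l")
  case True
  then have "Z 0 j = 0" using off_diag(1)[of 0 j] assms m0 by simp
  then show False using off_diag_nz[of 0 j] assms m0 by simp
next
  case False
  have l': "Z 0 l * Z 0 0 = Z 0 l" using off_diag(1)[of 0 l] assms m0 by simp
  have "adj (Z 0 j * Z 0 0) = 0" using j by simp
  then have j1: "Z 0 0 * Z j 0 = 0" using Z_adj m0 assms(1) by simp
  have "adj (Z 0 0 * Z 0 j + Z 0 j * Z 0 0) = adj (Z 0 j)" using off_diag(1)[of 0 j] assms m0 by simp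
  then have j2: "Z j 0 * Z 0 0 = Z j 0" using Z_adj m0 assms(1) j1 by simp
  have "Z j 0 * Z 0 l = Z j 0 * (Z 0 0 * Z 0 l)" by (simp add: mult.assoc[symmetric] j2)
  moreover have "Z 0 l * Z j 0 = Z 0 l * (Z 0 0 * Z j 0)" by (simp add: mult.assoc[symmetric] l')
  moreover have "Z j 0 * Z 0 l + Z 0 l * Z j 0 = Z j l" using Z_comm[of j 0 0 l] assms m0 False by simp
  ultimately have "Z j l = 0" by (simp add: l j1)
  then show False using off_diag_nz False assms by blast
qed

text \<open>The images of the first row and column multiply like matrix units, and \<open>Z i j = Z i 0 * Z 0 j\<close> extends
  this to all units.\<close>

lemma hom_of_first_row:
  assumes row: "\<And>j. j < m \<Longrightarrow> j \<noteq> 0 \<Longrightarrow> Z 0 j * Z 0 0 = 0"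
    and AB: "A \<in> corner m" "B \<in> corner m"
  shows "g (A * B) = g A * g B"
proof -
  let ?P = "Z 0 0"
  have PZ: "?P * Z 0 j = Z 0 j" if "j < m" for j
    using row[OF that] off_diag(1)[of 0 j] that m0 diag_idem by (cases "j = 0") auto
  have ZP: "Z j 0 * ?P = Z j 0" if "j < m" for j
    using arg_cong[OF PZ[OF that], of adj] Z_adj m0 that by simp
  have PZ0: "?P * Z j 0 = 0" if "j < m" "j \<noteq> 0" for j
    using arg_cong[OF row[OF that], of adj] Z_adj m0 that by simp
  have Pij: "?P * Z j i = 0" if ij: "i < m" "j < m" "i \<noteq> 0" "j \<noteq> 0" for i j
  proof -
    have z: "?P * Z j i * ?P = 0"
      using jordan_triple[OF jordan, of "E 0 0" "E j i"] ij m0 star_linearD(5)[OF g_lin] by simp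
    have "?P * Z j i + Z j i * ?P = 0" using Z_comm[of 0 0 j i] ij m0 by simp
    then have "?P * (?P * Z j i + Z j i * ?P) = 0" by simp
    then show ?thesis using z m0 by (simp add: distrib_left diag_idem mult.assoc)
  qed
  have prod: "Z 0 i * Z j 0 = (if i = j then ?P else 0)" if ij: "i < m" "j < m" for i j
  proof -
    consider "i = 0" "j = 0" | "i = 0" "j \<noteq> 0" | "i \<noteq> 0" "j = 0" | "i \<noteq> 0" "j \<noteq> 0" by blast
    then show ?thesis
    proof cases
      case 4
      have "Z 0 i * Z j 0 + Z j 0 * Z 0 i = (if i = j then ?P else 0) + Z j i" using Z_comm[of 0 i j 0] ij m0 by simp
      then have "?P * (Z 0 i * Z j 0 + Z j 0 * Z 0 i) = ?P * ((if i = j then ?P else 0) + Z j i)" by simp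
      then show ?thesis using PZ[OF ij(1)] PZ0[OF ij(2) 4(2)] Pij[OF ij 4] m0
        by (simp add: distrib_left mult.assoc[symmetric] diag_idem split: if_splits)
    qed (use ij m0 diag_idem PZ0 row in auto)
  qed
  have fac: "Z i j = Z i 0 * Z 0 j" if ij: "i < m" "j < m" for i j
  proof -
    consider "i = 0" | "j = 0" | "i \<noteq> 0" "j \<noteq> 0" by blast
    then show ?thesis
    proof cases
      case 3
      have "Z 0 j * Z i 0 + Z i 0 * Z 0 j = (if j = i then ?P else 0) + Z i j" using Z_comm[of 0 j i 0] ij m0 by simp
      then show ?thesis using prod[of j i] ij by simp
    qed (use ij PZ ZP in auto)
  qed
  have units: "Z i j * Z k l = g (E i j * E k l)" if "i < m" "j < m" "k < m" "l < m" for i j k l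
  proof -
    have "Z i j * Z k l = (Z i 0 * Z 0 j) * (Z k 0 * Z 0 l)"
      using fac[OF that(1,2)] fac[OF that(3,4)] by (rule arg_cong2[of _ _ _ _ "(*)"])
    also have "\<dots> = Z i 0 * (Z 0 j * Z k 0) * Z 0 l" by (simp only: mult.assoc)
    also have "\<dots> = g (E i j * E k l)"
    proof (cases "j = k")
      case True
      then have "Z i 0 * (Z 0 j * Z k 0) * Z 0 l = Z i 0 * ?P * Z 0 l" using prod[of j k] that by simp
      also have "\<dots> = Z i l" using fac[OF that(1,4)] by (simp only: ZP[OF that(1)])
      finally show ?thesis using True by simp
    next
      case False
      then show ?thesis using prod[of j k] that star_linearD(5)[OF g_lin] by simp
    qed
    finally show ?thesis .
  qed
  note L = star_linearD[OF g_lin]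
  show ?thesis using AB(1)
  proof (rule unit_induct)
    fix i j assume ij: "i < m" "j < m"
    then have Eij: "E i j \<in> corner m" by simp
    show "g (E i j * B) = Z i j * g B" using AB(2)
    proof (rule unit_induct)
      show "g (E i j * E k l) = Z i j * Z k l" if "k < m" "l < m" for k l using units[OF ij that] ..
    qed (use Eij in \<open>auto simp: L distrib_left\<close>)
  qed (use AB in \<open>auto simp: L distrib_right\<close>)
qed

lemma first_row_cases:
  "(\<forall>j<m. j \<noteq> 0 \<longrightarrow> Z 0 j * Z 0 0 = 0) \<or> (\<forall>j<m. j \<noteq> 0 \<longrightarrow> Z 0 0 * Z 0 j = 0)"
  using off_diag(3) same_choice m0 by metis

text \<open>Precomposing with the transposition exchanges the two cases.\<close>

lemma hom_or_antihom:
  "(\<forall>A\<in>corner m. \<forall>B\<in>corner m. g (A * B) = g A * g B) \<or>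
   (\<forall>A\<in>corner m. \<forall>B\<in>corner m. g (A * B) = g B * g A)"
  using first_row_cases
proof
  assume "\<forall>j<m. j \<noteq> 0 \<longrightarrow> Z 0 j * Z 0 0 = 0"
  then show ?thesis using hom_of_first_row by blast
next
  assume row: "\<forall>j<m. j \<noteq> 0 \<longrightarrow> Z 0 0 * Z 0 j = 0"
  interpret t: jordan_units m N "\<lambda>A. g (trn A)"
    by unfold_locales (use m0 jordan_trn[OF jordan] diag in auto)
  have r: "g (trn (E 0 j)) * g (trn (E 0 0)) = 0" if "j < m" "j \<noteq> 0" for j
  proof -
    have "adj (Z 0 0 * Z 0 j) = 0" using row that by simp
    then show ?thesis using Z_adj m0 that by simp
  qed
  have "g (A * B) = g B * g A" if "A \<in> corner m" "B \<in> corner m" for A B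
    using t.hom_of_first_row[OF r, of "trn B" "trn A"] that by simp
  then show ?thesis by blast
qed

end


section \<open>Structure of the maps preserving product states\<close>

text \<open>Two commuting homomorphisms whose product sends one product of matrix units to a rank one
  projection are simultaneously implemented by a unitary: transporting a unit vector of that
  projection by the images of the matrix units gives an orthonormal basis.\<close>

lemma unitary_implementation:
  fixes a b :: "fmat \<Rightarrow> fmat"
  assumes a: "star_linear m (m * n) a" "\<And>A B. A \<in> corner m \<Longrightarrow> B \<in> corner m \<Longrightarrow> a (A * B) = a A * a B"
    and b: "star_linear n (m * n) b" "\<And>A B. A \<in> corner n \<Longrightarrow> B \<in> corner n \<Longrightarrow> b (A * B) = b A * b B"
    and comm: "\<And>A B. A \<in> corner m \<Longrightarrow> B \<in> corner n \<Longrightarrow> a A * b B = b B * a A"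
    and unital: "a (Idm m) = Idm (m * n)" "b (Idm n) = Idm (m * n)"
    and at: "atom (a (E 0 0) * b (E 0 0))" and m0: "0 < m" and n0: "0 < n"
  obtains U where "U \<in> corner (m * n)" "adj U * U = Idm (m * n)" "U * adj U = Idm (m * n)"
    "\<And>A B. A \<in> corner m \<Longrightarrow> B \<in> corner n \<Longrightarrow> a A * b B = U * kron n A B * adj U"
proof -
  let ?N = "m * n" and ?Q = "a (E 0 0) * b (E 0 0)"
  have EN: "x div n < m" "x mod n < n" "x div n * n + x mod n = x" if "x < ?N" for x
    using that n0 by (simp_all add: div_less_iff_less_mult)
  have Em: "\<And>i j. i < m \<Longrightarrow> j < m \<Longrightarrow> E i j \<in> corner m" and En: "\<And>i j. i < n \<Longrightarrow> j < n \<Longrightarrow> E i j \<in> corner n" by auto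
  have "?Q \<in> corner ?N" using star_linearD(1)[OF a(1)] star_linearD(1)[OF b(1)] Em En m0 n0 by simp
  then obtain X where X: "X \<in> rect ?N 1" "adj X * X = Idm 1" "X * adj X = ?Q"
    using proj_isometry[of ?Q ?N 1] at by auto
  have XE: "X * E 0 0 = X" "E 0 0 * adj X = adj X" 
    using rect_Idm(2)[OF X(1)] rect_Idm(1)[OF rect_closed(6)[OF X(1)]] unfolding Idm_1 by blast+
  have QX: "?Q * X = X" using X Idm_1 by (simp only: X(3)[symmetric] mult.assoc XE)
  define g where "g i j k l = a (E i j) * b (E k l)" for i j k l
  have gm: "g i j k l * g i' j' k' l' = (if j = i' \<and> l = k' then g i j' k l' else 0)"
    if "i < m" "j < m" "i' < m" "j' < m" "k < n" "l < n" "k' < n" "l' < n" for i j k l i' j' k' l'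
  proof -
    have "g i j k l * g i' j' k' l' = a (E i j) * (b (E k l) * a (E i' j')) * b (E k' l')"
      by (simp only: g_def mult.assoc)
    also have "b (E k l) * a (E i' j') = a (E i' j') * b (E k l)" by (rule comm[symmetric]) (use that in auto)
    also have "a (E i j) * (a (E i' j') * b (E k l)) * b (E k' l') = a (E i j * E i' j') * b (E k l * E k' l')"
      using that by (simp only: a(2) b(2) Em En mult.assoc)
    finally show ?thesis using star_linearD(5)[OF a(1)] star_linearD(5)[OF b(1)] by (auto simp: g_def)
  qed
  have ga: "adj (g i j k l) = g j i l k" if "i < m" "j < m" "k < n" "l < n" for i j k l
  proof -
    have "adj (g i j k l) = adj (b (E k l)) * adj (a (E i j))" by (simp add: g_def)
    also have "adj (b (E k l)) = b (E l k)" using star_linearD(2)[OF b(1) En[of k l]] that by simp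
    also have "adj (a (E i j)) = a (E j i)" using star_linearD(2)[OF a(1) Em[of i j]] that by simp
    also have "b (E l k) * a (E j i) = a (E j i) * b (E l k)" by (rule comm[symmetric]) (use that in auto)
    finally show ?thesis by (simp add: g_def)
  qed
  (* the orthonormal basis: the unit vector X moved by the images of the matrix units *)
  define V where "V x = g (x div n) 0 (x mod n) 0 * X" for x
  have gV: "g i j k l * V y = (if j = y div n \<and> l = y mod n then g i 0 k 0 * X else 0)"
    if "i < m" "j < m" "k < n" "l < n" "y < ?N" for i j k l y
    using gm[OF that(1,2) EN(1)[OF that(5)] m0 that(3,4) EN(2)[OF that(5)] n0] by (simp add: V_def mult.assoc[symmetric])
  have VV: "adj (V x) * V y = (if x = y then E 0 0 else 0)" if "x < ?N" "y < ?N" for x y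
  proof -
    have "adj (V x) * V y = adj X * (g 0 (x div n) 0 (x mod n) * V y)"
      using ga[OF EN(1)[OF that(1)] m0 EN(2)[OF that(1)] n0] by (simp add: V_def mult.assoc)
    also have "\<dots> = (if x = y then adj X * (g 0 0 0 0 * X) else 0)"
    proof -
      have "x div n = y div n \<and> x mod n = y mod n \<longleftrightarrow> x = y" using EN(3)[OF that(1)] EN(3)[OF that(2)] by metis
      then show ?thesis using gV[OF m0 EN(1)[OF that(1)] n0 EN(2)[OF that(1)] that(2)] by simp
    qed
    also have "g 0 0 0 0 * X = X" by (simp only: g_def QX)
    finally show ?thesis by (simp add: X(2)[unfolded Idm_1])
  qed
  (* the columns of U are the vectors V x *)
  define U where "U = (\<Sum>x<?N. V x * E 0 x)"
  have EU: "E 0 0 * (E 0 y) = E 0 y" for y by simp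
  have EadjU: "E z x * adj U = E z 0 * adj (V x)" if "x < ?N" for x z
  proof -
    have "E z x * adj U = (\<Sum>y<?N. if y = x then E z 0 * adj (V x) else 0)"
      unfolding U_def adj_sum sum_distrib_left by (intro sum.cong) (auto simp: mult.assoc[symmetric])
    then show ?thesis using that by simp
  qed
  have "adj U * U = (\<Sum>y<?N. \<Sum>x<?N. if x = y then E y y else 0)"
  proof -
    have "adj U * U = (\<Sum>y<?N. \<Sum>x<?N. E x 0 * (adj (V x) * V y) * E 0 y)"
      unfolding U_def adj_sum sum_distrib_left sum_distrib_right by (simp add: mult.assoc)
    also have "\<dots> = (\<Sum>y<?N. \<Sum>x<?N. if x = y then E y y else 0)"
      by (intro sum.cong refl) (simp add: VV)
    finally show ?thesis .
  qed
  then have UU: "adj U * U = Idm ?N" by (simp add: Idm_def)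
  have ginv: "V x * adj (V x) = g (x div n) (x div n) (x mod n) (x mod n)" if "x < ?N" for x
  proof -
    have "V x * adj (V x) = g (x div n) 0 (x mod n) 0 * (X * adj X) * g 0 (x div n) 0 (x mod n)"
      using ga[OF EN(1)[OF that] m0 EN(2)[OF that] n0] by (simp add: V_def mult.assoc)
    also have "X * adj X = g 0 0 0 0" by (simp only: X(3) g_def)
    finally show ?thesis using gm EN(1,2)[OF that] m0 n0 by simp
  qed
  have "U * adj U = (\<Sum>x<?N. V x * (E 0 x * adj U))"
    by (subst (1) U_def) (simp add: sum_distrib_right mult.assoc)
  also have "\<dots> = (\<Sum>x<?N. g (x div n) (x div n) (x mod n) (x mod n))"
  proof (rule sum.cong)
    fix x assume "x \<in> {..<?N}"
    then have x: "x < ?N" by simp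
    have "V x * (E 0 x * adj U) = V x * E 0 0 * adj (V x)" by (simp only: EadjU[OF x] mult.assoc)
    also have "V x * E 0 0 = V x" by (simp add: V_def mult.assoc XE)
    finally show "V x * (E 0 x * adj U) = g (x div n) (x div n) (x mod n) (x mod n)" using ginv[OF x] by simp
  qed simp
  also have "\<dots> = (\<Sum>i<m. \<Sum>k<n. g i i k k)" by (rule sum_div_mod) (rule n0)
  also have "\<dots> = a (Idm m) * b (Idm n)"
  proof -
    have "a (Idm m) = (\<Sum>i<m. a (E i i))" "b (Idm n) = (\<Sum>k<n. b (E k k))"
      unfolding Idm_def by (rule star_linear_sum[OF a(1)], simp, rule star_linear_sum[OF b(1)], simp)
    then show ?thesis by (simp add: g_def sum_product)
  qed
  finally have UU': "U * adj U = Idm ?N" by (simp add: unital)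
  have VN: "V x * E 0 x \<in> corner ?N" if "x < ?N" for x
  proof (rule rect_mult)
    have "g (x div n) 0 (x mod n) 0 \<in> corner ?N"
      using star_linearD(1)[OF a(1)] star_linearD(1)[OF b(1)] Em En EN[OF that] m0 n0 by (simp add: g_def)
    then show "V x \<in> rect ?N 1" unfolding V_def using X(1) by (rule rect_mult)
    show "E 0 x \<in> rect 1 ?N" using that by simp
  qed
  then have UN: "U \<in> corner ?N" unfolding U_def by blast
  have units: "a (E i j) * b (E k l) * U = U * kron n (E i j) (E k l)" if ij: "i < m" "j < m" "k < n" "l < n" for i j k l
  proof -
    have lt: "p * n + q < ?N" if "p < m" "q < n" for p q
    proof -
      have "p * n + q < Suc p * n" using that by simp
      also have "\<dots> \<le> ?N" using that by (intro mult_le_mono1) simp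
      finally show ?thesis .
    qed
    have "g i j k l * U = (\<Sum>x<?N. g i j k l * V x * E 0 x)" by (simp add: U_def sum_distrib_left mult.assoc)
    also have "\<dots> = (\<Sum>x<?N. if x = j * n + l then g i 0 k 0 * X * E 0 (j * n + l) else 0)"
    proof (rule sum.cong)
      fix x assume "x \<in> {..<?N}"
      then have x: "x < ?N" by simp
      have "x = j * n + l \<longleftrightarrow> j = x div n \<and> l = x mod n" using ij EN(3)[OF x] by auto
      then show "g i j k l * V x * E 0 x = (if x = j * n + l then g i 0 k 0 * X * E 0 (j * n + l) else 0)"
        using gV[OF ij x] by auto
    qed simp
    also have "\<dots> = g i 0 k 0 * X * E 0 (j * n + l)" using lt[OF ij(2,4)] by simp
    also have "\<dots> = V (i * n + k) * E 0 (j * n + l)" using ij by (simp add: V_def)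
    also have "\<dots> = (\<Sum>x<?N. if x = i * n + k then V (i * n + k) * E 0 (j * n + l) else 0)" using lt[OF ij(1,3)] by simp
    also have "\<dots> = (\<Sum>x<?N. V x * E 0 x * E (i * n + k) (j * n + l))"
      by (intro sum.cong) (auto simp: mult.assoc)
    also have "\<dots> = U * kron n (E i j) (E k l)" using ij by (simp add: U_def sum_distrib_right kron_E)
    finally show ?thesis by (simp add: g_def)
  qed
  note La = star_linearD[OF a(1)] and Lb = star_linearD[OF b(1)]
  have inter: "a A * b B * U = U * kron n A B" if A: "A \<in> corner m" and B: "B \<in> corner n" for A B
    using A
  proof (rule unit_induct)
    fix i j assume ij: "i < m" "j < m"
    show "a (E i j) * b B * U = U * kron n (E i j) B"
      using B
    proof (rule unit_induct)
      show "a (E i j) * b (E k l) * U = U * kron n (E i j) (E k l)" if "k < n" "l < n" for k l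
        using units[OF ij that] .
    qed (auto simp: Lb distrib_left distrib_right kron_lin)
  qed (auto simp: La distrib_left distrib_right kron_lin)
  show ?thesis
  proof (rule that[OF UN UU UU'])
    fix A B assume AB: "A \<in> corner m" "B \<in> corner n"
    have "a A * b B = a A * b B * (U * adj U)" using UU' La(1)[OF AB(1)] Lb(1)[OF AB(2)] by simp
    also have "\<dots> = U * kron n A B * adj U" using inter[OF AB] by (simp only: mult.assoc[symmetric])
    finally show "a A * b B = U * kron n A B * adj U" .
  qed
qed

context atom_preserver
begin

abbreviation "\<alpha> A \<equiv> F A (Idm n)"

abbreviation "\<beta> B \<equiv> F (Idm m) B"

lemma swapped: "atom_preserver n m N (\<lambda>b a. F a b)"
  by unfold_locales (auto simp: closed add1 add2 smul1 smul2 m0 n0 unital atoms)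

text \<open>The images of a product basis are projections with sum \<open>I\<close>.\<close>

lemma frames:
  assumes p: "frame m p" and q: "frame n q" and ij: "i < m" "j < n" "i' < m" "j' < n"
  shows "F (p i) (q j) * F (p i') (q j') = (if i = i' \<and> j = j' then F (p i) (q j) else 0)"
proof -
  let ?I = "{..<m} \<times> {..<n}" and ?Q = "\<lambda>x. F (p (fst x)) (q (snd x))"
  have at: "atom (?Q x)" "?Q x \<in> corner N" if "x \<in> ?I" for x
    using that frameD(1,2)[OF p] frameD(1,2)[OF q] by (auto intro!: atoms closed)
  have "(\<Sum>x\<in>?I. ?Q x) = (\<Sum>i<m. \<Sum>j<n. F (p i) (q j))" by (simp add: sum.cartesian_product case_prod_beta)
  also have "\<dots> = (\<Sum>i<m. F (p i) (Idm n))"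
  proof (rule sum.cong)
    fix i assume "i \<in> {..<m}"
    then show "(\<Sum>j<n. F (p i) (q j)) = F (p i) (Idm n)"
      using sum2[of "{..<n}" q "p i"] frameD(2)[OF p] frameD(2)[OF q] by (simp add: frameD(4)[OF q])
  qed simp
  also have "\<dots> = Idm N"
    using sum1[of "{..<m}" p "Idm n"] frameD(2)[OF p] by (simp add: frameD(4)[OF p] unital)
  finally have sum: "(\<Sum>x\<in>?I. ?Q x) = Idm N" .
  show ?thesis
  proof (cases "i = i' \<and> j = j'")
    case True
    then show ?thesis using at(1)[of "(i, j)"] ij by simp
  next
    case False
    then show ?thesis
      using projections_sum_orthogonal[of ?I ?Q N "(i, j)" "(i', j')"] at sum ij by auto
  qed
qed

lemma alpha_expand: "frame n q \<Longrightarrow> A \<in> corner m \<Longrightarrow> \<alpha> A = (\<Sum>j<n. F A (q j))"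
  using sum2[of "{..<n}" q A] frameD(2,4)[of n q] by simp

lemma beta_expand: "frame m p \<Longrightarrow> B \<in> corner n \<Longrightarrow> \<beta> B = (\<Sum>i<m. F (p i) B)"
  using sum1[of "{..<m}" p B] frameD(2,4)[of m p] by simp

text \<open>Extend \<open>a\<close> and \<open>b\<close> to orthonormal bases and expand both identities: of the products of images of basis
  elements only the square of \<open>F(a, b)\<close> survives.\<close>

lemma alpha_beta_atoms:
  assumes a: "atom a" "a \<in> corner m" and b: "atom b" "b \<in> corner n"
  shows "\<alpha> a * \<beta> b = F a b"
proof -
  obtain p where p: "frame m p" "p 0 = a" using frame_with_atom[OF a m0] .
  obtain q where q: "frame n q" "q 0 = b" using frame_with_atom[OF b n0] .
  have "\<alpha> a * \<beta> b = (\<Sum>j<n. \<Sum>i<m. F (p 0) (q j) * F (p i) (q 0))"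
    using alpha_expand[OF q(1) a(2)] beta_expand[OF p(1) b(2)]
    by (simp add: p(2) q(2) sum_distrib_left sum_distrib_right) (rule sum.swap)
  also have "\<dots> = (\<Sum>j<n. \<Sum>i<m. if i = 0 \<and> j = 0 then F a b else 0)"
    using frames[OF p(1) q(1) m0 _ _ n0] p(2) q(2) by (intro sum.cong) auto
  also have "\<dots> = (\<Sum>j<n. if j = 0 then F a b else 0)"
    using m0 by (intro sum.cong) auto
  also have "\<dots> = F a b" using n0 by simp
  finally show ?thesis .
qed

lemma beta_alpha_atoms:
  assumes a: "atom a" "a \<in> corner m" and b: "atom b" "b \<in> corner n"
  shows "\<beta> b * \<alpha> a = F a b"
  using atom_preserver.alpha_beta_atoms[OF swapped b a] .

lemma alpha_beta: "A \<in> corner m \<Longrightarrow> B \<in> corner n \<Longrightarrow> \<alpha> A * \<beta> B = F A B"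
  and beta_alpha: "A \<in> corner m \<Longrightarrow> B \<in> corner n \<Longrightarrow> \<beta> B * \<alpha> A = F A B"
proof -
  assume A: "A \<in> corner m" and B: "B \<in> corner n"
  have "\<alpha> A * \<beta> B = F A B \<and> \<beta> B * \<alpha> A = F A B" using A
  proof (rule atom_induct)
    fix a assume a: "atom a" "a \<in> corner m"
    show "\<alpha> a * \<beta> B = F a B \<and> \<beta> B * \<alpha> a = F a B" using B
    proof (rule atom_induct)
      show "\<alpha> a * \<beta> b = F a b \<and> \<beta> b * \<alpha> a = F a b" if "atom b" "b \<in> corner n" for b
        using alpha_beta_atoms[OF a that] beta_alpha_atoms[OF a that] by simp
    qed (use a in \<open>auto simp: add2 smul2 zero2 distrib_left distrib_right\<close>)
  qed (use B in \<open>auto simp: add1 smul1 zero1 distrib_left distrib_right\<close>)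
  then show "\<alpha> A * \<beta> B = F A B" "\<beta> B * \<alpha> A = F A B" by auto
qed

lemma jordan_alpha: "jordan m N \<alpha>"
proof (rule jordan_of_hermitian)
  show "star_linear m N \<alpha>"
    unfolding star_linear_def
  proof (intro ballI conjI allI)
    fix A assume A: "A \<in> corner m"
    show "\<alpha> A \<in> corner N" using A by (simp add: closed)
    show "\<alpha> (c *\<^sub>C A) = c *\<^sub>C \<alpha> A" for c using A by (simp add: smul1)
    show "\<alpha> (A + B) = \<alpha> A + \<alpha> B" if "B \<in> corner m" for B using A that by (simp add: add1)
    show "\<alpha> (adj A) = adj (\<alpha> A)" using A
    proof (rule atom_induct)
      fix a assume a: "atom a" "a \<in> corner m"
      have "adj (F a (E j j)) = F a (E j j)" if "j < n" for j using atoms[OF a, of "E j j"] that by simp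
      then have "adj (\<alpha> a) = \<alpha> a" unfolding alpha_expand[OF frame_E a(2)] adj_sum by (intro sum.cong) auto
      then show "\<alpha> (adj a) = adj (\<alpha> a)" using a by simp
    qed (auto simp: add1 smul1 zero1)
  qed
next
  fix H assume H: "H \<in> corner m" "adj H = H"
  obtain p l where p: "frame m p" "H = (\<Sum>i<m. complex_of_real (l i) *\<^sub>C p i)" using spectral[OF H] .
  have pm: "\<And>i. i < m \<Longrightarrow> p i \<in> corner m" using frameD(2)[OF p(1)] .
  have pp: "\<alpha> (p i) * \<alpha> (p j) = (if i = j then \<alpha> (p i) else 0)" if ij: "i < m" "j < m" for i j
  proof -
    have "\<alpha> (p i) * \<alpha> (p j) = (\<Sum>k<n. \<Sum>l<n. F (p i) (E k k) * F (p j) (E l l))"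
      using alpha_expand[OF frame_E] pm ij by (simp add: sum_product)
    also have "\<dots> = (\<Sum>k<n. \<Sum>l<n. if l = k then (if i = j then F (p i) (E k k) else 0) else 0)"
      using frames[OF p(1) frame_E ij(1) _ ij(2)] by (intro sum.cong) auto
    also have "\<dots> = (\<Sum>k<n. if i = j then F (p i) (E k k) else 0)" by simp
    finally show ?thesis using alpha_expand[OF frame_E] pm ij by simp
  qed
  have e: "\<alpha> (\<Sum>i<m. c i *\<^sub>C p i) = (\<Sum>i<m. c i *\<^sub>C \<alpha> (p i))" for c
    using pm by (subst sum1) (auto simp: smul1)
  have "H * H = (\<Sum>i<m. \<Sum>j<m. if j = i then (complex_of_real (l i) * complex_of_real (l i)) *\<^sub>C p i else 0)"
    unfolding p(2) sum_product using frame_mult[OF p(1)] by (intro sum.cong) auto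
  also have "\<dots> = (\<Sum>i<m. (complex_of_real (l i) * complex_of_real (l i)) *\<^sub>C p i)" by simp
  finally have "\<alpha> (H * H) = (\<Sum>i<m. (complex_of_real (l i) * complex_of_real (l i)) *\<^sub>C \<alpha> (p i))" by (simp only: e)
  also have "\<dots> = (\<Sum>i<m. \<Sum>j<m. if j = i then (complex_of_real (l i) * complex_of_real (l i)) *\<^sub>C \<alpha> (p i) else 0)" by simp
  also have "\<dots> = \<alpha> H * \<alpha> H"
    unfolding p(2) e sum_product using pp by (intro sum.cong) auto
  finally show "\<alpha> (H * H) = \<alpha> H * \<alpha> H" .
qed

lemma jordan_beta: "jordan n N \<beta>"
  using atom_preserver.jordan_alpha[OF swapped] .

text \<open>Multiplying by \<open>\<beta> (E j j)\<close> cuts \<open>\<alpha>\<close> down to a Jordan homomorphism with rank one values.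
  Conjugation by the image under \<open>\<beta>\<close> of the flip of \<open>0\<close> and \<open>j\<close> commutes with \<open>\<alpha>\<close> and carries
  the cut at \<open>0\<close> to the cut at \<open>j\<close>, so all cuts are of the same kind.\<close>

lemma alpha_hom_or_antihom:
  "(\<forall>A\<in>corner m. \<forall>B\<in>corner m. \<alpha> (A * B) = \<alpha> A * \<alpha> B) \<or>
   (\<forall>A\<in>corner m. \<forall>B\<in>corner m. \<alpha> (A * B) = \<alpha> B * \<alpha> A)"
proof -
  let ?b = "\<lambda>j. \<beta> (E j j)"
  have sa: "star_linear m N \<alpha>" and sqa: "\<And>A. A \<in> corner m \<Longrightarrow> \<alpha> (A * A) = \<alpha> A * \<alpha> A"
    using jordan_alpha by (auto simp: jordan_def)
  note La = star_linearD[OF sa]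
  have sb: "star_linear n N \<beta>" using jordan_beta by (simp add: jordan_def)
  have comm: "\<alpha> A * \<beta> B = \<beta> B * \<alpha> A" if "A \<in> corner m" "B \<in> corner n" for A B
    using alpha_beta[OF that] beta_alpha[OF that] by simp
  have E: "E 0 0 \<in> corner n" using n0 by simp
  have pb: "proj (?b 0)"
    using jordan_beta star_linearD(2)[OF sb E] E unfolding proj_def jordan_def by force
  have c0: "\<alpha> A * ?b 0 = ?b 0 * \<alpha> A" if "A \<in> corner m" for A using comm[OF that E] .
  have cut: "(\<alpha> A * ?b 0) * (\<alpha> B * ?b 0) = \<alpha> A * \<alpha> B * ?b 0" if "A \<in> corner m" "B \<in> corner m" for A B
  proof -
    have "(\<alpha> A * ?b 0) * (\<alpha> B * ?b 0) = \<alpha> A * (?b 0 * \<alpha> B) * ?b 0" by (simp only: mult.assoc)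
    also have "\<dots> = \<alpha> A * \<alpha> B * (?b 0 * ?b 0)" by (simp only: c0[OF that(2), symmetric] mult.assoc)
    finally show ?thesis using pb by simp
  qed
  interpret c: jordan_units m N "\<lambda>A. \<alpha> A * ?b 0"
  proof unfold_locales
    show "0 < m" by (rule m0)
    show "atom (\<alpha> (E i i) * ?b 0)" if "i < m" for i using that n0 by (simp add: alpha_beta atoms)
    have adj: "\<alpha> (adj A) * ?b 0 = adj (\<alpha> A * ?b 0)" if "A \<in> corner m" for A
    proof -
      have "adj (\<alpha> A * ?b 0) = ?b 0 * \<alpha> (adj A)" using pb La(2)[OF that] by simp
      then show ?thesis using c0[of "adj A"] that by simp
    qed
    have cN: "?b 0 \<in> corner N" using E by (simp add: closed)
    show "jordan m N (\<lambda>A. \<alpha> A * ?b 0)"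
      unfolding jordan_def star_linear_def
      using La(1,3,4) cN sqa cut adj by (auto simp: distrib_right)
  qed
  have lift: "\<alpha> C = D"
    if C: "C \<in> corner m" and D: "D \<in> corner N" "\<And>j. j < n \<Longrightarrow> D * \<beta> (E 0 j + E j 0) = \<beta> (E 0 j + E j 0) * D"
      and e: "\<alpha> C * ?b 0 = D * ?b 0" for C D
  proof -
    have j: "\<alpha> C * ?b j = D * ?b j" if jn: "j < n" for j
    proof (cases "j = 0")
      case False
      (* the flip of the basis vectors 0 and j *)
      let ?w = "E 0 j + E j 0"
      have w: "?w \<in> corner n" using jn n0 by simp
      have "?w * E 0 0 * ?w = E j j" using False by (simp add: distrib_left distrib_right mult.assoc)
      then have W: "?b j = \<beta> ?w * ?b 0 * \<beta> ?w" using jordan_triple[OF jordan_beta w E] by simp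
      have "\<alpha> C * ?b j = \<beta> ?w * (\<alpha> C * ?b 0) * \<beta> ?w"
        unfolding W by (simp only: mult.assoc[symmetric] comm[OF C w])
      also have "\<dots> = D * ?b j" unfolding W e by (simp only: mult.assoc[symmetric] D(2)[OF jn])
      finally show ?thesis .
    qed (simp add: e)
    have I: "(\<Sum>j<n. ?b j) = Idm N"
      using star_linear_sum[OF sb, of "{..<n}" "\<lambda>j. E j j"] unital by (simp add: Idm_def[of n])
    have "\<alpha> C = \<alpha> C * (\<Sum>j<n. ?b j)" using La(1)[OF C] by (simp add: I)
    also have "\<dots> = D * (\<Sum>j<n. ?b j)" using j by (simp add: sum_distrib_left)
    finally show ?thesis using D(1) by (simp add: I)
  qed
  have pc: "\<alpha> A * \<alpha> B * \<beta> (E 0 j + E j 0) = \<beta> (E 0 j + E j 0) * (\<alpha> A * \<alpha> B)"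
    if "A \<in> corner m" "B \<in> corner m" "j < n" for A B j
  proof -
    have w: "E 0 j + E j 0 \<in> corner n" using that n0 by simp
    show ?thesis by (simp only: mult.assoc comm[OF that(2) w]) (simp only: mult.assoc[symmetric] comm[OF that(1) w])
  qed
  show ?thesis using c.hom_or_antihom
  proof
    assume h: "\<forall>A\<in>corner m. \<forall>B\<in>corner m. \<alpha> (A * B) * ?b 0 = \<alpha> A * ?b 0 * (\<alpha> B * ?b 0)"
    have "\<alpha> (A * B) = \<alpha> A * \<alpha> B" if "A \<in> corner m" "B \<in> corner m" for A B
      using that h by (intro lift) (auto simp: La(1) pc cut)
    then show ?thesis by blast
  next
    assume h: "\<forall>A\<in>corner m. \<forall>B\<in>corner m. \<alpha> (A * B) * ?b 0 = \<alpha> B * ?b 0 * (\<alpha> A * ?b 0)"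
    have "\<alpha> (A * B) = \<alpha> B * \<alpha> A" if "A \<in> corner m" "B \<in> corner m" for A B
      using that h by (intro lift) (auto simp: La(1) pc cut)
    then show ?thesis by blast
  qed
qed

end

lemma star_linear_trn: "star_linear m N g \<Longrightarrow> star_linear m N (\<lambda>A. g (trn A))"
  unfolding star_linear_def by simp

text \<open>The transpositions \<open>s\<close> and \<open>t\<close> turn \<open>\<alpha>\<close> and \<open>\<beta>\<close> into homomorphisms, which one unitary implements.\<close>

theorem (in atom_preserver) product_structure:
  assumes N: "N = m * n"
  obtains U s t where "U \<in> corner N" "adj U * U = Idm N" "U * adj U = Idm N"
    "s = id \<or> s = trn" "t = id \<or> t = trn"
    "\<And>A B. A \<in> corner m \<Longrightarrow> B \<in> corner n \<Longrightarrow> F A B = U * kron n (s A) (t B) * adj U"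
proof -
  have sa: "star_linear m N \<alpha>" and sb: "star_linear n N \<beta>"
    using jordan_alpha jordan_beta by (auto simp: jordan_def)
  have "\<exists>s. (s = id \<or> s = trn) \<and> (\<forall>A\<in>corner m. \<forall>B\<in>corner m. \<alpha> (s (A * B)) = \<alpha> (s A) * \<alpha> (s B))"
    using alpha_hom_or_antihom
  proof
    assume "\<forall>A\<in>corner m. \<forall>B\<in>corner m. \<alpha> (A * B) = \<alpha> A * \<alpha> B"
    then show ?thesis by (intro exI[of _ id]) simp
  next
    assume "\<forall>A\<in>corner m. \<forall>B\<in>corner m. \<alpha> (A * B) = \<alpha> B * \<alpha> A"
    then show ?thesis by (intro exI[of _ trn]) simp
  qed
  then obtain s where s: "s = id \<or> s = trn"
    and hs: "\<forall>A\<in>corner m. \<forall>B\<in>corner m. \<alpha> (s (A * B)) = \<alpha> (s A) * \<alpha> (s B)" by blast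
  have "\<exists>t. (t = id \<or> t = trn) \<and> (\<forall>A\<in>corner n. \<forall>B\<in>corner n. \<beta> (t (A * B)) = \<beta> (t A) * \<beta> (t B))"
    using atom_preserver.alpha_hom_or_antihom[OF swapped]
  proof
    assume "\<forall>A\<in>corner n. \<forall>B\<in>corner n. \<beta> (A * B) = \<beta> A * \<beta> B"
    then show ?thesis by (intro exI[of _ id]) simp
  next
    assume "\<forall>A\<in>corner n. \<forall>B\<in>corner n. \<beta> (A * B) = \<beta> B * \<beta> A"
    then show ?thesis by (intro exI[of _ trn]) simp
  qed
  then obtain t where t: "t = id \<or> t = trn"
    and ht: "\<forall>A\<in>corner n. \<forall>B\<in>corner n. \<beta> (t (A * B)) = \<beta> (t A) * \<beta> (t B)" by blast
  have st: "s A \<in> corner m" if "A \<in> corner m" for A using s that by auto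
  have tt: "t B \<in> corner n" if "B \<in> corner n" for B using t that by auto
  have ss: "s (s A) = A" "t (t A) = A" for A using s t by auto
  have e: "s (Idm m) = Idm m" "t (Idm n) = Idm n" "s (E 0 0) = E 0 0" "t (E 0 0) = E 0 0" using s t by auto
  obtain U where U: "U \<in> corner (m * n)" "adj U * U = Idm (m * n)" "U * adj U = Idm (m * n)"
    "\<And>A B. A \<in> corner m \<Longrightarrow> B \<in> corner n \<Longrightarrow> \<alpha> (s A) * \<beta> (t B) = U * kron n A B * adj U"
  proof (rule unitary_implementation[of m n "\<lambda>A. \<alpha> (s A)" "\<lambda>B. \<beta> (t B)"])
    show "star_linear m (m * n) (\<lambda>A. \<alpha> (s A))" using s sa star_linear_trn[OF sa] N by auto
    show "star_linear n (m * n) (\<lambda>A. \<beta> (t A))" using t sb star_linear_trn[OF sb] N by auto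
    show "\<alpha> (s (Idm m)) = Idm (m * n)" "\<beta> (t (Idm n)) = Idm (m * n)" by (simp_all add: e unital N)
    show "atom (\<alpha> (s (E 0 0)) * \<beta> (t (E 0 0)))" using m0 n0 by (simp add: e alpha_beta atoms)
    show "0 < m" "0 < n" by (rule m0, rule n0)
  qed (use hs ht st tt alpha_beta beta_alpha in auto)
  show ?thesis
  proof (rule that[OF _ _ _ s t])
    show "F A B = U * kron n (s A) (t B) * adj U" if "A \<in> corner m" "B \<in> corner n" for A B
      using U(4)[OF st[OF that(1)] tt[OF that(2)]] that by (simp add: ss alpha_beta)
  qed (use U N in auto)
qed


section \<open>Invariance of the ranges\<close>

lemma krange_unitary_subset:
  assumes U: "U \<in> corner N" "adj U * U = Idm N" "U * adj U = Idm N" and A: "A \<in> corner N"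
  shows "krange N k (U * A * adj U) \<subseteq> krange N k A"
proof
  fix z assume "z \<in> krange N k (U * A * adj U)"
  then obtain R where R: "kproj N k R" "z = tr (R * (U * A * adj U))" by (auto simp: krange_def)
  have U': "adj (adj U) * adj U = Idm N" "adj U \<in> rect N N" using U by simp_all
  have "kproj N k (adj U * R * U)"
    using isometry_image(1,2)[OF U'(2,1) kprojD(2)[OF R(1)]] tr_conj[OF U'(1) kprojD(2)[OF R(1)]] kprojD[OF R(1)]
    by (simp add: kproj_def)
  moreover have "z = tr (adj U * R * U * A)"
    using R(2) tr_mult[of "R * U * A" "adj U"] by (simp add: mult.assoc)
  ultimately show "z \<in> krange N k A" by (auto simp: krange_def)
qed

lemma krange_unitary:
  assumes U: "U \<in> corner N" "adj U * U = Idm N" "U * adj U = Idm N" and A: "A \<in> corner N"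
  shows "krange N k (U * A * adj U) = krange N k A"
proof
  have "adj U * (U * A * adj U) * adj (adj U) = (adj U * U) * A * (adj U * U)" by (simp add: mult.assoc)
  then have "adj U * (U * A * adj U) * adj (adj U) = A" using U(2) A by simp
  then show "krange N k A \<subseteq> krange N k (U * A * adj U)"
    using krange_unitary_subset[of "adj U" N "U * A * adj U" k] U A by simp
qed (rule krange_unitary_subset[OF assms])

lemma krange_trn_subset: "krange N k (trn A) \<subseteq> krange N k A"
proof
  fix z assume "z \<in> krange N k (trn A)"
  then obtain R where R: "kproj N k R" "z = tr (R * trn A)" by (auto simp: krange_def)
  have "adj (trn R) = trn R" "trn R * trn R = trn R"
    using kprojD(1)[OF R(1)] trn_simps(9)[of R] trn_mult[of R R] by simp_all
  then have "proj (trn R)" unfolding proj_def by blast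
  then have "kproj N k (trn R)" using R(1) by (simp add: kproj_def)
  moreover have "z = tr (trn R * A)"
    using R(2) tr_lin(4)[of "R * trn A"] tr_mult[of A "trn R"] by simp
  ultimately show "z \<in> krange N k A" by (auto simp: krange_def)
qed

lemma krange_trn: "krange N k (trn A) = krange N k A"
  using krange_trn_subset[of N k A] krange_trn_subset[of N k "trn A"] by simp

text \<open>For \<open>N = 2k\<close> the complement of a projection of rank \<open>k\<close> has rank \<open>k\<close> again.\<close>

lemma krange_compl_half_subset:
  assumes "A \<in> corner N" "N = 2 * k" "1 \<le> k"
  shows "krange N k ((tr A / of_nat k) *\<^sub>C Idm N - A) \<subseteq> krange N k A"
proof
  fix z assume "z \<in> krange N k ((tr A / of_nat k) *\<^sub>C Idm N - A)"
  then obtain R where R: "kproj N k R" "z = tr (R * ((tr A / of_nat k) *\<^sub>C Idm N - A))" by (auto simp: krange_def)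
  have "kproj N k (Idm N - R)" using kproj_compl[OF R(1)] assms by simp
  moreover have "z = tr ((Idm N - R) * A)"
    using R assms by (simp add: right_diff_distrib left_diff_distrib kproj_def)
  ultimately show "z \<in> krange N k A" by (auto simp: krange_def)
qed

lemma krange_compl_half:
  assumes A: "A \<in> corner N" and N: "N = 2 * k" "1 \<le> k"
  shows "krange N k ((tr A / of_nat k) *\<^sub>C Idm N - A) = krange N k A"
proof -
  let ?B = "(tr A / of_nat k) *\<^sub>C Idm N - A"
  have "tr ?B = tr A" using N by simp
  then have "(tr ?B / of_nat k) *\<^sub>C Idm N - ?B = A" by simp
  moreover have "?B \<in> corner N" using A by simp
  ultimately show ?thesis
    using krange_compl_half_subset[OF A N] krange_compl_half_subset[of ?B N k] N by simp
qed

text \<open>Taking complements of projections exchanges the ranks \<open>k\<close> and \<open>N - k\<close>, so in comparing matrices of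
  equal trace one may assume \<open>2k \<le> N\<close>.\<close>

lemma krange_complementary:
  assumes "A \<in> corner N" "B \<in> corner N" "tr A = tr B" "k \<le> N" "krange N k A = krange N k B"
  shows "krange N (N - k) A = krange N (N - k) B"
proof -
  have sub: "krange N (N - k) A \<subseteq> krange N (N - k) B"
    if AB: "A \<in> corner N" "B \<in> corner N" "tr A = tr B" "krange N k A = krange N k B" for A B
  proof
    fix z assume "z \<in> krange N (N - k) A"
    then obtain R where R: "kproj N (N - k) R" "z = tr (R * A)" by (auto simp: krange_def)
    have "kproj N k (Idm N - R)" using kproj_compl[OF R(1)] assms(4) by simp
    then have "tr ((Idm N - R) * A) \<in> krange N k B" using AB(4) by (auto simp: krange_def)
    then obtain S where S: "kproj N k S" "tr ((Idm N - R) * A) = tr (S * B)" by (auto simp: krange_def)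
    have "tr B - z = tr (S * B)" using S(2) R(2) AB by (simp add: left_diff_distrib)
    then have "z = tr ((Idm N - S) * B)" using AB(2) by (simp add: left_diff_distrib flip: \<open>tr B - z = tr (S * B)\<close>)
    then show "z \<in> krange N (N - k) B" using kproj_compl[OF S(1) assms(4)] by (auto simp: krange_def)
  qed
  show ?thesis using sub[of A B] sub[of B A] assms by auto
qed

subsection \<open>Two by two matrices and their transposes\<close>

lemma corner2_eqI:
  assumes "A \<in> corner 2" "B \<in> corner 2" "ent A 0 0 = ent B 0 0" "ent A 0 1 = ent B 0 1"
    "ent A 1 0 = ent B 1 0" "ent A 1 1 = ent B 1 1"
  shows "A = B"
proof (rule fmat_eqI)
  fix i j :: nat
  show "ent A i j = ent B i j"
  proof (cases "i < 2 \<and> j < 2")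
    case True
    then have "(i = 0 \<or> i = 1) \<and> (j = 0 \<or> j = 1)" by auto
    then show ?thesis using assms by auto
  next
    case False
    then show ?thesis using rectD[OF assms(1), of i j] rectD[OF assms(2), of i j] by force
  qed
qed

lemma ent_mult2: "A \<in> corner 2 \<Longrightarrow> ent (A * B) i j = ent A i 0 * ent B 0 j + ent A i 1 * ent B 1 j"
  by (simp add: ent_mult[of A 2 2] numeral_2_eq_2)

text \<open>Two real linear equations in three unknowns have a nontrivial solution: the cross product of the
  coefficient vectors, or, if these are dependent, a solution of one of the equations.\<close>

lemma common_orthogonal:
  fixes a1 a2 a3 b1 b2 b3 :: real
  obtains x y z where "x\<^sup>2 + y\<^sup>2 + z\<^sup>2 = 1" "a1 * x + a2 * y + a3 * z = 0" "b1 * x + b2 * y + b3 * z = 0"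
proof -
  have "\<exists>x y z. (x, y, z) \<noteq> (0, 0, 0) \<and> a1 * x + a2 * y + a3 * z = 0 \<and> b1 * x + b2 * y + b3 * z = 0"
  proof (cases "a2 * b3 - a3 * b2 = 0 \<and> a3 * b1 - a1 * b3 = 0 \<and> a1 * b2 - a2 * b1 = 0")
    case False
    then show ?thesis
      by (intro exI[of _ "a2 * b3 - a3 * b2"] exI[of _ "a3 * b1 - a1 * b3"] exI[of _ "a1 * b2 - a2 * b1"])
         (auto simp: algebra_simps)
  next
    case dep: True
    have one: "\<exists>x y z. (x, y, z) \<noteq> (0, 0, 0) \<and> c1 * x + c2 * y + c3 * z = 0" for c1 c2 c3 :: real
    proof (cases "c1 = 0")
      case True
      then show ?thesis by (intro exI[of _ 1] exI[of _ 0]) simp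
    next
      case False
      then show ?thesis by (intro exI[of _ "- c2"] exI[of _ c1] exI[of _ 0]) simp
    qed
    show ?thesis
    proof (cases "a1 = 0 \<and> a2 = 0 \<and> a3 = 0")
      case True
      then show ?thesis using one[of b1 b2 b3] by simp
    next
      case False
      obtain x y z where xyz: "(x, y, z) \<noteq> (0, 0, 0)" "a1 * x + a2 * y + a3 * z = 0" using one[of a1 a2 a3] by blast
      have "a1 * (b1 * x + b2 * y + b3 * z) = b1 * (a1 * x + a2 * y + a3 * z)"
        "a2 * (b1 * x + b2 * y + b3 * z) = b2 * (a1 * x + a2 * y + a3 * z)"
        "a3 * (b1 * x + b2 * y + b3 * z) = b3 * (a1 * x + a2 * y + a3 * z)"
      proof -
        have d: "a2 * b3 = a3 * b2" "a3 * b1 = a1 * b3" "a1 * b2 = a2 * b1" using dep by simp_all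
        have "a1 * (b1 * x + b2 * y + b3 * z) = b1 * (a1 * x) + (a1 * b2) * y + (a1 * b3) * z" by (simp add: algebra_simps)
        also have "\<dots> = b1 * (a1 * x + a2 * y + a3 * z)" unfolding d(3) d(2)[symmetric] by (simp add: algebra_simps)
        finally show "a1 * (b1 * x + b2 * y + b3 * z) = b1 * (a1 * x + a2 * y + a3 * z)" .
        have "a2 * (b1 * x + b2 * y + b3 * z) = (a2 * b1) * x + b2 * (a2 * y) + (a2 * b3) * z" by (simp add: algebra_simps)
        also have "\<dots> = b2 * (a1 * x + a2 * y + a3 * z)" unfolding d(3)[symmetric] d(1) by (simp add: algebra_simps)
        finally show "a2 * (b1 * x + b2 * y + b3 * z) = b2 * (a1 * x + a2 * y + a3 * z)" .
        have "a3 * (b1 * x + b2 * y + b3 * z) = (a3 * b1) * x + (a3 * b2) * y + b3 * (a3 * z)" by (simp add: algebra_simps)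
        also have "\<dots> = b3 * (a1 * x + a2 * y + a3 * z)" unfolding d(2) d(1)[symmetric] by (simp add: algebra_simps)
        finally show "a3 * (b1 * x + b2 * y + b3 * z) = b3 * (a1 * x + a2 * y + a3 * z)" .
      qed
      then have "b1 * x + b2 * y + b3 * z = 0" using xyz(2) False by auto
      then show ?thesis using xyz by blast
    qed
  qed
  then obtain x y z where xyz: "(x, y, z) \<noteq> (0, 0, 0)" "a1 * x + a2 * y + a3 * z = 0" "b1 * x + b2 * y + b3 * z = 0" by blast
  define r where "r = sqrt (x\<^sup>2 + y\<^sup>2 + z\<^sup>2)"
  have r2: "r\<^sup>2 = x\<^sup>2 + y\<^sup>2 + z\<^sup>2" unfolding r_def by simp
  have r0: "r \<noteq> 0" using xyz(1) r2 by (auto simp: add_nonneg_eq_0_iff)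
  show ?thesis
  proof (rule that[of "x / r" "y / r" "z / r"])
    show "(x / r)\<^sup>2 + (y / r)\<^sup>2 + (z / r)\<^sup>2 = 1"
      using r0 by (simp add: power_divide r2[symmetric] add_divide_distrib[symmetric])
    show "a1 * (x / r) + a2 * (y / r) + a3 * (z / r) = 0" "b1 * (x / r) + b2 * (y / r) + b3 * (z / r) = 0"
      using xyz(2,3) r0 by (simp_all add: add_divide_distrib[symmetric])
  qed
qed

text \<open>A Hermitian unitary \<open>S\<close> of trace zero with \<open>tr (S A) = 0\<close> satisfies \<open>S A + A S = tr A S\<close>
  by the polarized Cayley-Hamilton identity, so it conjugates \<open>A\<close> into its adjugate \<open>tr A - A\<close>, and the
  second Pauli matrix conjugates the adjugate into the transpose.  The traceless Hermitian
  matrices form a real space of dimension three and \<open>tr (S A) = 0\<close> is two real equations.\<close>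

lemma two_by_two_transpose:
  assumes A: "A \<in> corner 2"
  obtains V where "V \<in> corner 2" "adj V * V = Idm 2" "V * adj V = Idm 2" "V * A * adj V = trn A"
proof -
  let ?a = "ent A 0 0" and ?b = "ent A 0 1" and ?c = "ent A 1 0" and ?d = "ent A 1 1"
  obtain x y z where xyz: "x\<^sup>2 + y\<^sup>2 + z\<^sup>2 = 1"
    "Re (?b + ?c) * x + Re (\<i> * (?b - ?c)) * y + Re (?a - ?d) * z = 0"
    "Im (?b + ?c) * x + Im (\<i> * (?b - ?c)) * y + Im (?a - ?d) * z = 0" using common_orthogonal .
  define w where "w = Complex x y"
  have eq: "of_real z * (?a - ?d) + cnj w * ?c + w * ?b = 0"
    using xyz(2,3) by (simp add: w_def complex_eq_iff algebra_simps)
  have nrm: "of_real z * of_real z + cnj w * w = 1" "w * cnj w + of_real z * of_real z = 1"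
    using xyz(1) by (simp_all add: w_def complex_eq_iff algebra_simps power2_eq_square)
  (* z, x, y are the coordinates in the basis of the Pauli matrices *)
  define S where "S = of_real z *\<^sub>C E 0 0 + cnj w *\<^sub>C E 0 1 + w *\<^sub>C E 1 0 - of_real z *\<^sub>C E 1 1"
  define Y where "Y = (- \<i>) *\<^sub>C E 0 1 + \<i> *\<^sub>C E 1 0"
  have SN: "S \<in> corner 2" "Y \<in> corner 2" by (auto simp: S_def Y_def)
  have Ss: "ent S 0 0 = of_real z" "ent S 0 1 = cnj w" "ent S 1 0 = w" "ent S 1 1 = - of_real z"
    and Ys: "ent Y 0 0 = 0" "ent Y 0 1 = - \<i>" "ent Y 1 0 = \<i>" "ent Y 1 1 = 0"
    by (simp_all add: S_def Y_def)
  note Ss = Ss Ss[unfolded One_nat_def] and Ys = Ys Ys[unfolded One_nat_def]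
  have aS: "adj S = S" and aY: "adj Y = Y" by (rule corner2_eqI; use SN Ss Ys in simp)+
  have SS: "S * S = Idm 2" by (rule corner2_eqI) (use SN nrm in \<open>simp_all add: ent_mult2 Ss mult.commute\<close>)
  have YY: "Y * Y = Idm 2" by (rule corner2_eqI) (use SN in \<open>simp_all add: ent_mult2 Ys\<close>)
  have "S * A + A * S = (?a + ?d) *\<^sub>C S"
  proof (rule corner2_eqI)
    have "ent (S * A + A * S) 0 0 - ent ((?a + ?d) *\<^sub>C S) 0 0 = of_real z * (?a - ?d) + cnj w * ?c + w * ?b"
      "ent (S * A + A * S) 1 1 - ent ((?a + ?d) *\<^sub>C S) 1 1 = of_real z * (?a - ?d) + cnj w * ?c + w * ?b"
      using SN A by (simp_all add: ent_mult2 Ss algebra_simps)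
    then show "ent (S * A + A * S) 0 0 = ent ((?a + ?d) *\<^sub>C S) 0 0" "ent (S * A + A * S) 1 1 = ent ((?a + ?d) *\<^sub>C S) 1 1"
      unfolding eq by simp_all
  qed (use SN A in \<open>simp_all add: ent_mult2 Ss algebra_simps\<close>)
  then have "(S * A + A * S) * S = (?a + ?d) *\<^sub>C (S * S)" by simp
  then have SAS: "S * A * S = (?a + ?d) *\<^sub>C Idm 2 - A" using A by (simp add: distrib_right mult.assoc SS eq_diff_eq)
  have ii: "\<i> * u * \<i> = - u" for u by (simp add: complex_eq_iff)
  have YAY: "Y * ((?a + ?d) *\<^sub>C Idm 2 - A) * Y = trn A"
    by (rule corner2_eqI) (use SN A in \<open>simp_all add: ent_mult2 Ys ii\<close>)
  show ?thesis
  proof (rule that[of "Y * S"])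
    show "Y * S \<in> corner 2" using SN by simp
    have "S * Y * (Y * S) = S * (Y * Y) * S" "Y * S * (S * Y) = Y * (S * S) * Y" by (simp_all only: mult.assoc)
    then show "adj (Y * S) * (Y * S) = Idm 2" "Y * S * adj (Y * S) = Idm 2"
      using SN by (simp_all add: aS aY YY SS)
    have "Y * S * A * (S * Y) = Y * (S * A * S) * Y" by (simp only: mult.assoc)
    then show "Y * S * A * adj (Y * S) = trn A" by (simp only: adj_mult aS aY SAS YAY)
  qed
qed

text \<open>If \<open>V A V\<^sup>* = A\<^sup>t\<close>, then \<open>V \<otimes> I\<close> conjugates \<open>A \<otimes> B\<close> into \<open>A\<^sup>t \<otimes> B\<close>.  Transposing the whole
  product exchanges the two partial transpositions.\<close>

lemma krange_partial_transpose:
  assumes "m = 2 \<or> n = 2" "0 < n" and A: "A \<in> corner m" and B: "B \<in> corner n"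
  shows "krange (m * n) k (kron n A (trn B)) = krange (m * n) k (kron n A B)"
    "krange (m * n) k (kron n (trn A) B) = krange (m * n) k (kron n A B)"
proof -
  have left: "krange (m * n) k (kron n (trn A) B) = krange (m * n) k (kron n A B)"
    if h: "m = 2" "A \<in> corner m" "B \<in> corner n" for A B
  proof -
    obtain V where V: "V \<in> corner m" "adj V * V = Idm m" "V * adj V = Idm m" "V * A * adj V = trn A"
      by (rule two_by_two_transpose[OF h(2)[unfolded h(1)], folded h(1)]) (rule that)
    let ?U = "kron n V (Idm n)"
    have "?U * kron n A B * adj ?U = kron n (trn A) B"
      using V(4) h \<open>0 < n\<close> by (simp add: kron_mult)
    moreover have "?U \<in> corner (m * n)" "adj ?U * ?U = Idm (m * n)" "?U * adj ?U = Idm (m * n)"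
      using V \<open>0 < n\<close> by (simp_all add: kron_rect kron_mult kron_Idm)
    ultimately show ?thesis using krange_unitary[of ?U "m * n" "kron n A B" k] h by (simp add: kron_rect)
  qed
  have right: "krange (m * n) k (kron n A (trn B)) = krange (m * n) k (kron n A B)"
    if h: "n = 2" "A \<in> corner m" "B \<in> corner n" for A B
  proof -
    obtain V where V: "V \<in> corner n" "adj V * V = Idm n" "V * adj V = Idm n" "V * B * adj V = trn B"
      by (rule two_by_two_transpose[OF h(3)[unfolded h(1)], folded h(1)]) (rule that)
    let ?U = "kron n (Idm m) V"
    have "?U * kron n A B * adj ?U = kron n A (trn B)"
      using V(1,4) h \<open>0 < n\<close> by (simp add: kron_mult)
    moreover have "?U \<in> corner (m * n)" "adj ?U * ?U = Idm (m * n)" "?U * adj ?U = Idm (m * n)"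
      using V \<open>0 < n\<close> by (simp_all add: kron_rect kron_mult kron_Idm)
    ultimately show ?thesis using krange_unitary[of ?U "m * n" "kron n A B" k] h by (simp add: kron_rect)
  qed
  have t: "krange (m * n) k (kron n A (trn B)) = krange (m * n) k (kron n (trn A) B)" for A B
    using krange_trn[of "m * n" k "kron n (trn A) B"] by simp
  show "krange (m * n) k (kron n A (trn B)) = krange (m * n) k (kron n A B)"
    "krange (m * n) k (kron n (trn A) B) = krange (m * n) k (kron n A B)"
    using assms(1) left[OF _ A B] right[OF _ A B] t[of A B] by auto
qed

section \<open>Partial transposition in dimension at least three\<close>

text \<open>The maximum of \<open>tr (R K)\<close> over the projections of rank \<open>k\<close> is the sum of the \<open>k\<close> largest eigenvalues; here the
  only nonzero eigenvalues of \<open>K\<close> are \<open>\<plusminus>c0, \<plusminus>c1, \<plusminus>c2\<close>, so from rank three to rank \<open>N - 3\<close> the maximum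
  stays the same.\<close>

lemma six_atoms:
  fixes q :: "nat \<Rightarrow> fmat"
  assumes q: "orthofam N {..<6} q" and c: "0 \<le> c2" "c2 \<le> c1" "c1 \<le> (c0 :: real)"
    and K: "K = complex_of_real c0 *\<^sub>C (q 0 - q 1) + complex_of_real c1 *\<^sub>C (q 2 - q 3) + complex_of_real c2 *\<^sub>C (q 4 - q 5)"
  shows "kproj N 1 R \<Longrightarrow> Re (tr (R * K)) \<le> c0" "kproj N 2 R \<Longrightarrow> Re (tr (R * K)) \<le> c0 + c1"
    "kproj N k R \<Longrightarrow> Re (tr (R * K)) \<le> c0 + c1 + c2"
    "\<exists>R. kproj N 1 R \<and> tr (R * K) = of_real c0" "\<exists>R. kproj N 2 R \<and> tr (R * K) = of_real (c0 + c1)"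
    "3 \<le> k \<Longrightarrow> k + 3 \<le> N \<Longrightarrow> \<exists>R. kproj N k R \<and> tr (R * K) = of_real (c0 + c1 + c2)"
proof -
  define t where "t R i = Re (tr (R * q i))" for R i
  have b: "t R i \<ge> 0" "t R i \<le> 1" if "kproj N k R" "i < 6" for R i k
    using tr_proj_proj(1)[OF kprojD(1)[OF that(1)], of "q i"] tr_proj_le(1)[OF that(1), of "q i"]
      orthofamD(2,3)[OF q, of i] that(2) by (auto simp: t_def)
  have trK: "Re (tr (R * K)) = c0 * (t R 0 - t R 1) + c1 * (t R 2 - t R 3) + c2 * (t R 4 - t R 5)" for R
    by (simp add: K t_def distrib_left right_diff_distrib)
  have s: "t R 0 + t R 2 + t R 4 \<le> k" if R: "kproj N k R" for R k
  proof -
    have S: "{0, 2, 4} \<subseteq> {..<6::nat}" by auto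
    let ?P = "\<Sum>i\<in>{0, 2, 4}. q i"
    have P: "kproj N (card {0, 2, 4 :: nat}) ?P" using orthofam_sum(1)[OF q S] .
    have "Re (tr (?P * R)) \<le> Re (tr R)" using tr_proj_le(1)[OF P kprojD(1,2)[OF R]] .
    then show ?thesis using kprojD(3)[OF R] tr_mult[of ?P R] by (simp add: t_def distrib_left)
  qed
  have up: "Re (tr (R * K)) \<le> c0 * t R 0 + c1 * t R 2 + c2 * t R 4" if "kproj N k R" for R k
  proof -
    have "0 \<le> c0 * t R 1" "0 \<le> c1 * t R 3" "0 \<le> c2 * t R 5" using b(1)[OF that] c by auto
    then show ?thesis unfolding trK by (simp add: algebra_simps)
  qed
  show "Re (tr (R * K)) \<le> c0" if R: "kproj N 1 R"
  proof -
    have "c1 * t R 2 \<le> c0 * t R 2" "c2 * t R 4 \<le> c0 * t R 4" using b(1)[OF R] c by (auto intro: mult_right_mono)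
    then have "Re (tr (R * K)) \<le> c0 * (t R 0 + t R 2 + t R 4)" using up[OF R] by (simp add: algebra_simps)
    also have "\<dots> \<le> c0 * 1" using s[OF R] c by (intro mult_left_mono) auto
    finally show ?thesis by simp
  qed
  show "Re (tr (R * K)) \<le> c0 + c1" if R: "kproj N 2 R"
  proof -
    have "c2 * t R 4 \<le> c1 * t R 4" "(c0 - c1) * t R 0 \<le> c0 - c1"
      using b[OF R] c by (auto intro: mult_right_mono mult_left_le)
    then have "Re (tr (R * K)) \<le> c0 - c1 + c1 * (t R 0 + t R 2 + t R 4)" using up[OF R] by (simp add: algebra_simps)
    also have "c1 * (t R 0 + t R 2 + t R 4) \<le> c1 * 2" using s[OF R] c by (intro mult_left_mono) auto
    finally show ?thesis by simp
  qed
  show "Re (tr (R * K)) \<le> c0 + c1 + c2" if R: "kproj N k R"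
  proof -
    have "c0 * t R 0 \<le> c0" "c1 * t R 2 \<le> c1" "c2 * t R 4 \<le> c2"
      using b(2)[OF R] c by (auto intro!: mult_left_le)
    then show ?thesis using up[OF R] by simp
  qed
  have val: "tr ((\<Sum>i\<in>S. q i) * q j) = (if j \<in> S then 1 else 0)" if "S \<subseteq> {..<6}" "j < 6" for S j
    using orthofam_sum(2)[OF q that(1), of j] orthofamD(2)[OF q, of j] that(2) by simp
  have trK': "tr (R * K) = complex_of_real c0 * (tr (R * q 0) - tr (R * q 1)) + complex_of_real c1 * (tr (R * q 2) - tr (R * q 3)) +
    complex_of_real c2 * (tr (R * q 4) - tr (R * q 5))" for R
    by (simp add: K distrib_left right_diff_distrib)
  have S0: "{0} \<subseteq> {..<6::nat}" and S2: "{0, 2} \<subseteq> {..<6::nat}" and S4: "{0, 2, 4} \<subseteq> {..<6::nat}" by auto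
  show "\<exists>R. kproj N 1 R \<and> tr (R * K) = of_real c0"
    using orthofam_sum(1)[OF q S0] val[OF S0] by (intro exI[of _ "\<Sum>i\<in>{0}. q i"]) (simp add: trK')
  show "\<exists>R. kproj N 2 R \<and> tr (R * K) = of_real (c0 + c1)"
    using orthofam_sum(1)[OF q S2] val[OF S2] by (intro exI[of _ "\<Sum>i\<in>{0, 2}. q i"]) (simp add: trK' numeral_2_eq_2 del: sum.insert)
  show "\<exists>R. kproj N k R \<and> tr (R * K) = of_real (c0 + c1 + c2)" if k: "3 \<le> k" "k + 3 \<le> N"
  proof -
    let ?S = "\<Sum>i<6. q i" and ?R = "\<Sum>i\<in>{0, 2, 4}. q i"
    have S: "kproj N 6 ?S" using orthofam_sum(1)[OF q, of "{..<6}"] by simp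
    have R: "kproj N 3 ?R" using orthofam_sum(1)[OF q S4] by (simp add: numeral_3_eq_3)
    have D: "kproj N (N - 6) (Idm N - ?S)" using kproj_compl[OF S] k by simp
    (* rank k is reached by a projection orthogonal to all six eigenvectors *)
    obtain C where C: "proj C" "C \<in> corner N" "tr C = of_nat (k - 3)" "(Idm N - ?S) * C = C"
      by (rule sub_projection[OF kprojD[OF D], of "k - 3"]) (use k in auto)
    have SC: "?S * C = 0" using C by (simp add: left_diff_distrib)
    have qC: "q i * C = 0" if "i < 6" for i
    proof -
      have "?S * q i = q i" using orthofam_sum(2)[OF q, of "{..<6}" i] that by simp
      then have "q i * ?S = q i" using proj_commute[OF kprojD(1)[OF S], of "q i"] orthofamD(2)[OF q, of i] that by simp
      then have "q i * C = q i * (?S * C)" by (metis mult.assoc)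
      then show ?thesis by (simp add: SC)
    qed
    have Cq: "C * q i = 0" if "i < 6" for i
      using qC[OF that] proj_orth_commute[OF C(1), of "q i"] orthofamD(2)[OF q, of i] that by simp
    have "?R * C = 0" using qC by (simp add: distrib_right)
    then have "proj (?R + C)" using proj_add[OF kprojD(1)[OF R] C(1)] by blast
    moreover have "tr (?R + C) = of_nat k" using kprojD(3)[OF R] C(3) k by (simp add: of_nat_diff)
    moreover have "?R + C \<in> corner N" using kprojD(2)[OF R] C(2) by blast
    ultimately have "kproj N k (?R + C)" by (simp only: kproj_def)
    moreover have "tr ((?R + C) * q j) = (if j \<in> {0, 2, 4} then 1 else 0)" if "j < 6" for j
      using val[OF S4 that] Cq[OF that] by (simp only: distrib_right) simp
    then have "tr ((?R + C) * K) = of_real (c0 + c1 + c2)" unfolding trK' by simp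
    ultimately show ?thesis by blast
  qed
qed

text \<open>Normalizing a column \<open>x\<close> with \<open>x\<^sup>* x = c\<close>.\<close>

lemma outer_atom:
  assumes x: "x \<in> rect N 1" "adj x * x = c *\<^sub>C E 0 0" and c: "c \<noteq> 0" "cnj c = c"
  shows "atom ((1 / c) *\<^sub>C (x * adj x))" "(1 / c) *\<^sub>C (x * adj x) \<in> corner N"
proof -
  let ?P = "(1 / c) *\<^sub>C (x * adj x)"
  have xE: "x * E 0 0 = x" using rect_Idm(2)[OF x(1)] by (simp only: Idm_1)
  have "x * adj x * (x * adj x) = x * (adj x * x) * adj x" by (simp only: mult.assoc)
  also have "\<dots> = c *\<^sub>C (x * adj x)" by (simp only: x(2) smul_mult xE)
  finally have "?P * ?P = ?P" using c by simp
  moreover have "adj ?P = ?P" using c by simp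
  moreover have "tr ?P = 1" using tr_mult[of x "adj x"] c by (simp add: x(2))
  ultimately show "atom ?P" unfolding atom_def proj_def by blast
  show "?P \<in> corner N" using rect_mult[OF x(1) rect_closed(6)[OF x(1)]] by simp
qed

lemma outer_orth: "adj x * y = 0 \<Longrightarrow> (c *\<^sub>C (x * adj x)) * (d *\<^sub>C (y * adj y)) = 0"
proof -
  assume a: "adj x * y = 0"
  have "x * adj x * (y * adj y) = x * (adj x * y) * adj y" by (simp only: mult.assoc)
  then show ?thesis by (simp add: a)
qed

text \<open>On the path \<open>p0 - p1 - p2\<close> with weights \<open>u, v\<close> the adjacency matrix has the eigenvalues \<open>\<plusminus>r\<close> with eigenvectors
  \<open>(u, \<plusminus>r, v)\<close>, where \<open>r\<^sup>2 = u\<^sup>2 + v\<^sup>2\<close>; on a single edge it has the eigenvalues \<open>\<plusminus>1\<close>.  The Hermitian part of a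
  tensor product of two weighted shifts of size three is a sum of such pieces.\<close>

lemma chain_spectrum:
  fixes u v r :: real
  assumes d: "distinct [p0, p1, p2, p3, p4, p5, p6]" and N: "p0 < N" "p1 < N" "p2 < N" "p3 < N" "p4 < N" "p5 < N" "p6 < N"
    and r: "r * r = u * u + v * v" "r > 0"
  obtains q :: "nat \<Rightarrow> fmat" where "orthofam N {..<6} q"
    "complex_of_real r *\<^sub>C (q 0 - q 1) = complex_of_real u *\<^sub>C (E p0 p1 + E p1 p0) + complex_of_real v *\<^sub>C (E p1 p2 + E p2 p1)"
    "q 2 - q 3 = E p3 p4 + E p4 p3" "q 4 - q 5 = E p5 p6 + E p6 p5"
proof -
  let ?u = "complex_of_real u" and ?v = "complex_of_real v" and ?r = "complex_of_real r"
  have rr: "?r * ?r = ?u * ?u + ?v * ?v" using r(1) by (simp flip: of_real_mult of_real_add)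
  have r0: "?r \<noteq> 0" using r(2) by simp
  (* the unnormalized eigenvectors, as first columns; c i is the squared norm of x i *)
  define x where "x i = (if i = 0 then ?u *\<^sub>C E p0 0 + ?r *\<^sub>C E p1 0 + ?v *\<^sub>C E p2 0
    else if i = 1 then ?u *\<^sub>C E p0 0 - ?r *\<^sub>C E p1 0 + ?v *\<^sub>C E p2 0
    else if i = 2 then E p3 0 + E p4 0 else if i = 3 then E p3 0 - E p4 0
    else if i = 4 then E p5 0 + E p6 0 else E p5 0 - E p6 0)" for i :: nat
  define c where "c i = (if i < 2 then 2 * (?r * ?r) else 2)" for i :: nat
  define q where "q i = (1 / c i) *\<^sub>C (x i * adj (x i))" for i
  have neq: "p0 \<noteq> p1" "p0 \<noteq> p2" "p0 \<noteq> p3" "p0 \<noteq> p4" "p0 \<noteq> p5" "p0 \<noteq> p6" "p1 \<noteq> p2" "p1 \<noteq> p3" "p1 \<noteq> p4" "p1 \<noteq> p5" "p1 \<noteq> p6"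
    "p2 \<noteq> p3" "p2 \<noteq> p4" "p2 \<noteq> p5" "p2 \<noteq> p6" "p3 \<noteq> p4" "p3 \<noteq> p5" "p3 \<noteq> p6" "p4 \<noteq> p5" "p4 \<noteq> p6" "p5 \<noteq> p6"
    using d by auto
  note ne = neq neq[symmetric]
  have cases6: "i = 0 \<or> i = 1 \<or> i = 2 \<or> i = 3 \<or> i = 4 \<or> i = 5" if "i < 6" for i :: nat using that by linarith
  have xr: "x i \<in> rect N 1" for i using N by (simp add: x_def)
  have xx: "adj (x i) * x i = c i *\<^sub>C E 0 0" if "i < 6" for i
  proof (cases "i < 2")
    case True
    then have "i = 0 \<or> i = 1" by linarith
    then have "adj (x i) * x i = (?u * ?u + ?r * ?r + ?v * ?v) *\<^sub>C E 0 0"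
      by (elim disjE; simp add: x_def ne distrib_left distrib_right left_diff_distrib right_diff_distrib smul_simps add_ac)
    also have "?u * ?u + ?r * ?r + ?v * ?v = c i" using True by (simp add: c_def rr)
    finally show ?thesis .
  next
    case False
    then have "i = 2 \<or> i = 3 \<or> i = 4 \<or> i = 5" using that by linarith
    then have "adj (x i) * x i = E 0 0 + E 0 0"
      by (elim disjE; simp add: x_def ne distrib_left distrib_right left_diff_distrib right_diff_distrib)
    also have "\<dots> = c i *\<^sub>C E 0 0" using False by (intro fmat_eqI) (simp add: c_def)
    finally show ?thesis .
  qed
  have xy: "adj (x i) * x j = 0" if "i < 6" "j < 6" "i \<noteq> j" for i j
    using cases6[OF that(1)] cases6[OF that(2)] that(3)
    by (elim disjE; simp add: x_def ne distrib_left distrib_right left_diff_distrib right_diff_distrib smul_simps rr)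
  have c0: "c i \<noteq> 0" "cnj (c i) = c i" for i using r0 by (simp_all add: c_def)
  have "orthofam N {..<6} q"
    unfolding orthofam_def q_def using outer_atom[OF xr xx c0] outer_orth[OF xy] by auto
  moreover have "?r *\<^sub>C (q 0 - q 1) = ?u *\<^sub>C (E p0 p1 + E p1 p0) + ?v *\<^sub>C (E p1 p2 + E p2 p1)"
  proof -
    have "x 0 * adj (x 0) - x 1 * adj (x 1) = (2 * ?r) *\<^sub>C (?u *\<^sub>C (E p0 p1 + E p1 p0) + ?v *\<^sub>C (E p1 p2 + E p2 p1))"
      by (simp add: x_def distrib_left distrib_right left_diff_distrib right_diff_distrib smul_simps) (rule fmat_eqI; simp)
    moreover have "?r *\<^sub>C (q 0 - q 1) = (?r / c 0) *\<^sub>C (x 0 * adj (x 0) - x 1 * adj (x 1))"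
      by (simp add: q_def c_def smul_simps)
    ultimately show ?thesis using r0 by (simp add: c_def)
  qed
  moreover have "q 2 - q 3 = E p3 p4 + E p4 p3" "q 4 - q 5 = E p5 p6 + E p6 p5"
    by (simp_all add: q_def c_def x_def distrib_left distrib_right left_diff_distrib right_diff_distrib smul_simps)
       (rule fmat_eqI; simp)+
  ultimately show ?thesis using that by blast
qed

lemma orthofam_reindex:
  "orthofam N I q \<Longrightarrow> f ` I \<subseteq> I \<Longrightarrow> inj_on f I \<Longrightarrow> orthofam N I (\<lambda>i. q (f i))"
proof -
  assume q: "orthofam N I q" and f: "f ` I \<subseteq> I" "inj_on f I"
  have "q (f i) * q (f j) = 0" if "i \<in> I" "j \<in> I" "i \<noteq> j" for i j
    using orthofamD(4)[OF q, of "f i" "f j"] f that by (auto simp: inj_on_def)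
  then show ?thesis using q f(1) by (auto simp: orthofam_def)
qed

text \<open>For \<open>A = 4 E01 + 7 E12\<close> and \<open>B = 5 E01 + 3 E12\<close> twice the Hermitian part of \<open>A \<otimes> B\<close> has the nonzero
  eigenvalues \<open>\<plusminus>35, \<plusminus>29, \<plusminus>12\<close>, while that of \<open>A \<otimes> B\<^sup>t\<close> has \<open>\<plusminus>37, \<plusminus>21, \<plusminus>20\<close>: the weights
  \<open>20, 21, 12, 35\<close> are the legs of two Pythagorean triangles of equal area.  The sums of the largest
  one, two or at least three eigenvalues all differ.\<close>

lemma partial_transpose_not_preserving:
  assumes m: "3 \<le> m" and n: "3 \<le> n" and k: "1 \<le> k" "k < m * n"
  shows "\<exists>A\<in>corner m. \<exists>B\<in>corner n. krange (m * n) k (kron n A (trn B)) \<noteq> krange (m * n) k (kron n A B)"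
proof -
  let ?N = "m * n"
  define A where "A = 4 *\<^sub>C E 0 1 + 7 *\<^sub>C E 1 2"
  define B where "B = 5 *\<^sub>C E 0 1 + 3 *\<^sub>C E 1 2"
  have AB: "A \<in> corner m" "B \<in> corner n" using m n by (auto simp: A_def B_def)
  define X where "X = kron n A B"
  define Y where "Y = kron n A (trn B)"
  have XY: "X \<in> corner ?N" "Y \<in> corner ?N" using AB by (auto simp: X_def Y_def kron_rect)
  have lt: "p * n + q < ?N" if "p < 3" "q < 3" for p q
  proof -
    have "p * n + q < Suc p * n" using that n by simp
    also have "\<dots> \<le> ?N" using that m by (intro mult_le_mono1) simp
    finally show ?thesis .
  qed
  have l: "2 < ?N" "1 < ?N" "n < ?N" "n + 1 < ?N" "n + 2 < ?N" "2 * n < ?N" "2 * n + 1 < ?N" "2 * n + 2 < ?N" "0 < ?N"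
    using lt[of 0 2] lt[of 0 1] lt[of 1 0] lt[of 1 1] lt[of 1 2] lt[of 2 0] lt[of 2 1] lt[of 2 2] by simp_all
  have Xe: "X = 20 *\<^sub>C E 0 (n + 1) + 12 *\<^sub>C E 1 (n + 2) + 35 *\<^sub>C E n (2 * n + 1) + 21 *\<^sub>C E (n + 1) (2 * n + 2)"
    using n by (simp add: X_def A_def B_def kron_lin kron_E smul_simps numeral_2_eq_2)
  have Ye: "Y = 20 *\<^sub>C E 1 n + 12 *\<^sub>C E 2 (n + 1) + 35 *\<^sub>C E (n + 1) (2 * n) + 21 *\<^sub>C E (n + 2) (2 * n + 1)"
    using n by (simp add: Y_def A_def B_def kron_lin kron_E smul_simps numeral_2_eq_2)
  have trXY: "tr X = 0" "tr Y = 0" unfolding Xe Ye using n by auto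
  have nums: "29 * 29 = 20 * 20 + 21 * (21::real)" "(0::real) < 29" "37 * 37 = 12 * 12 + 35 * (35::real)" "(0::real) < 37" by simp_all
  have d: "distinct [0, n + 1, 2 * n + 2, 1, n + 2, n, 2 * n + 1]" "distinct [2, n + 1, 2 * n, n + 2, 2 * n + 1, 1, n]"
    using n by auto
  obtain q :: "nat \<Rightarrow> fmat" where q: "orthofam ?N {..<6} q"
    "complex_of_real 29 *\<^sub>C (q 0 - q 1) = complex_of_real 20 *\<^sub>C (E 0 (n + 1) + E (n + 1) 0) + complex_of_real 21 *\<^sub>C (E (n + 1) (2 * n + 2) + E (2 * n + 2) (n + 1))"
    "q 2 - q 3 = E 1 (n + 2) + E (n + 2) 1" "q 4 - q 5 = E n (2 * n + 1) + E (2 * n + 1) n"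
    by (rule chain_spectrum[OF d(1) l(9,4,8,2,5,3,7) nums(1,2)]) (rule that)
  obtain q' :: "nat \<Rightarrow> fmat" where q': "orthofam ?N {..<6} q'"
    "complex_of_real 37 *\<^sub>C (q' 0 - q' 1) = complex_of_real 12 *\<^sub>C (E 2 (n + 1) + E (n + 1) 2) + complex_of_real 35 *\<^sub>C (E (n + 1) (2 * n) + E (2 * n) (n + 1))"
    "q' 2 - q' 3 = E (n + 2) (2 * n + 1) + E (2 * n + 1) (n + 2)" "q' 4 - q' 5 = E 1 n + E n 1"
    by (rule chain_spectrum[OF d(2) l(1,4,6,5,7,2,3) nums(3,4)]) (rule that)
  (* puts the eigenvalues 35, 29, 12 of X + adj X into decreasing order *)
  define f where "f i = (i + 4) mod 6" for i :: nat
  have f: "f 0 = 4" "f 1 = 5" "f 2 = 0" "f 3 = 1" "f 4 = 2" "f 5 = 3" by (simp_all add: f_def)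
  have H: "X + adj X = complex_of_real 35 *\<^sub>C (q (f 0) - q (f 1)) + complex_of_real 29 *\<^sub>C (q (f 2) - q (f 3)) + complex_of_real 12 *\<^sub>C (q (f 4) - q (f 5))"
    unfolding f q(2-4) Xe by (simp add: smul_simps add_ac)
  have G: "Y + adj Y = complex_of_real 37 *\<^sub>C (q' 0 - q' 1) + complex_of_real 21 *\<^sub>C (q' 2 - q' 3) + complex_of_real 20 *\<^sub>C (q' 4 - q' 5)"
    unfolding q'(2-4) Ye by (simp add: smul_simps add_ac)
  have qf: "orthofam ?N {..<6} (\<lambda>i. q (f i))"
  proof (rule orthofam_reindex[OF q(1)])
    have six: "{..<6} = {0, 1, 2, 3, 4, 5 :: nat}" by auto
    show "f ` {..<6} \<subseteq> {..<6}" by (auto simp: f_def)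
    show "inj_on f {..<6}" unfolding six using f by (auto simp: inj_on_def)
  qed
  note hH = six_atoms[OF qf _ _ _ H, simplified] and hG = six_atoms[OF q'(1) _ _ _ G, simplified]
  have herm: "Re (tr (R * (Z + adj Z))) = 2 * Re (tr (R * Z))" if "proj R" for R Z
    using tr_lin(3)[of "R * Z"] tr_mult[of R "adj Z"] that by (simp add: distrib_left)
  have conflict: "krange ?N j Y \<noteq> krange ?N j X" if j: "1 \<le> j" "2 * j \<le> ?N" for j
  proof
    assume eq: "krange ?N j Y = krange ?N j X"
    have XtoY: "\<exists>S. kproj ?N j S \<and> Re (tr (S * (Y + adj Y))) = Re (tr (R * (X + adj X)))" if R: "kproj ?N j R" for R
    proof -
      have "tr (R * X) \<in> krange ?N j Y" using R eq by (auto simp: krange_def)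
      then obtain S where "kproj ?N j S" "tr (R * X) = tr (S * Y)" by (auto simp: krange_def)
      then show ?thesis using herm[of S Y] herm[of R X] kprojD(1) R by metis
    qed
    have YtoX: "\<exists>S. kproj ?N j S \<and> Re (tr (S * (X + adj X))) = Re (tr (R * (Y + adj Y)))" if R: "kproj ?N j R" for R
    proof -
      have "tr (R * Y) \<in> krange ?N j X" using R eq by (auto simp: krange_def)
      then obtain S where "kproj ?N j S" "tr (R * Y) = tr (S * X)" by (auto simp: krange_def)
      then show ?thesis using herm[of S X] herm[of R Y] kprojD(1) R by metis
    qed
    have N9: "9 \<le> ?N" using mult_le_mono[OF m n] by simp
    consider "j = 1" | "j = 2" | "3 \<le> j" using j by linarith
    then show False
    proof cases
      case 1
      obtain R where R: "kproj ?N j R" "tr (R * (Y + adj Y)) = 37" using hG(4) 1 by auto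
      obtain S where S: "kproj ?N j S" "Re (tr (S * (X + adj X))) = 37" using YtoX[OF R(1)] R(2) by auto
      show False using hH(1)[of S] S 1 by simp
    next
      case 2
      obtain R where R: "kproj ?N j R" "tr (R * (X + adj X)) = 64" using hH(5) 2 by auto
      obtain S where S: "kproj ?N j S" "Re (tr (S * (Y + adj Y))) = 64" using XtoY[OF R(1)] R(2) by auto
      show False using hG(2)[of S] S 2 by simp
    next
      case 3
      have "j + 3 \<le> ?N" using 3 j(2) N9 by linarith
      then obtain R where R: "kproj ?N j R" "tr (R * (Y + adj Y)) = 78" using hG(6)[of j] 3 by auto
      obtain S where S: "kproj ?N j S" "Re (tr (S * (X + adj X))) = 78" using YtoX[OF R(1)] R(2) by auto
      show False using hH(3)[of j S] S by simp
    qed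
  qed
  have "krange ?N k Y \<noteq> krange ?N k X"
  proof (cases "2 * k \<le> ?N")
    case True
    then show ?thesis using conflict k by blast
  next
    case False
    then have "krange ?N (?N - k) Y \<noteq> krange ?N (?N - k) X" using k by (intro conflict) linarith+
    then show ?thesis using krange_complementary[OF XY(2,1) _ _, of k] trXY k by auto
  qed
  then show ?thesis using AB by (auto simp: X_def Y_def)
qed


section \<open>Return to matrices of fixed dimension\<close>

text \<open>\<open>U U\<^sup>*\<close> is a projection of full trace.\<close>

lemma right_inverse_of_left:
  assumes "U \<in> corner N" "adj U * U = Idm N" shows "U * adj U = Idm N"
proof -
  have "U * adj U * (U * adj U) = U * (adj U * U) * adj U" by (simp only: mult.assoc)
  also have "\<dots> = U * adj U" using assms by simp
  finally have P: "proj (U * adj U)" unfolding proj_def by simp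
  have "U * adj U \<in> corner N" using assms by simp
  then have c: "proj (Idm N - U * adj U)" by (rule proj_compl[OF P])
  have "tr (Idm N - U * adj U) = 0" using tr_mult[of U "adj U"] by (simp add: assms)
  then show ?thesis using tr_proj(3)[OF c] by simp
qed

lemma krange_twisted:
  assumes st: "s = id \<or> s = trn" "t = id \<or> t = trn" "s = t \<or> m = 2 \<or> n = 2" and n: "0 < n"
    and ab: "a \<in> corner m" "b \<in> corner n"
  shows "krange (m * n) k (kron n (s a) (t b)) = krange (m * n) k (kron n a b)"
proof -
  consider "s = id" "t = id" | "s = trn" "t = trn" | "m = 2 \<or> n = 2" "s = id" "t = trn" | "m = 2 \<or> n = 2" "s = trn" "t = id"
    using st by auto
  then show ?thesis
  proof cases
    case 2
    then show ?thesis using krange_trn[of "m * n" k "kron n a b"] by simp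
  next
    case 3
    then show ?thesis using krange_partial_transpose(1)[OF 3(1) n ab] by simp
  next
    case 4
    then show ?thesis using krange_partial_transpose(2)[OF 4(1) n ab] by simp
  qed simp
qed

text \<open>The complement is taken after the similarity, so that both invariances apply in turn.\<close>

lemma krange_form:
  assumes U: "U \<in> corner N" "adj U * U = Idm N" "U * adj U = Idm N"
    and K: "K \<in> corner N" "K' \<in> corner N" "tr K' = tr K"
    and Z: "Z = U * K' * adj U \<or> N = 2 * k \<and> Z = (tr K / of_nat k) *\<^sub>C Idm N - U * K' * adj U" and k: "1 \<le> k"
  shows "krange N k Z = krange N k K'"
  using Z
proof
  assume Z: "N = 2 * k \<and> Z = (tr K / of_nat k) *\<^sub>C Idm N - U * K' * adj U"
  have "tr (U * K' * adj U) = tr K" using tr_conj[OF U(2) K(2)] K(3) by simp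
  then have "krange N k Z = krange N k (U * K' * adj U)"
    using Z krange_compl_half[of "U * K' * adj U" N k] U(1) K(2) k by simp
  then show ?thesis by (simp add: krange_unitary[OF U K(2)])
qed (simp add: krange_unitary[OF U K(2)])

text \<open>The form of \<open>F\<close> forces \<open>s(a) \<otimes> t(b)\<close> to have the range of \<open>a \<otimes> b\<close>.  Up to a transposition of the whole
  product, \<open>s \<noteq> t\<close> means that one factor is transposed, which changes some range if both sizes are
  at least three.\<close>

theorem (in range_preserver) range_preserver_form:
  obtains U s t where "U \<in> corner N" "adj U * U = Idm N" "s = id \<or> s = trn" "t = id \<or> t = trn"
    "s = t \<or> m = 2 \<or> n = 2"
    "(\<forall>a\<in>corner m. \<forall>b\<in>corner n. F a b = U * kron n (s a) (t b) * adj U) \<or>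
     N = 2 * k \<and> (\<forall>a\<in>corner m. \<forall>b\<in>corner n. F a b = (tr (kron n a b) / of_nat k) *\<^sub>C Idm N - U * kron n (s a) (t b) * adj U)"
proof -
  obtain U s t where U: "U \<in> corner N" "adj U * U = Idm N" "U * adj U = Idm N"
    and st: "s = id \<or> s = trn" "t = id \<or> t = trn"
    and form: "(\<forall>a\<in>corner m. \<forall>b\<in>corner n. F a b = U * kron n (s a) (t b) * adj U) \<or>
     N = 2 * k \<and> (\<forall>a\<in>corner m. \<forall>b\<in>corner n. F a b = (tr (kron n a b) / of_nat k) *\<^sub>C Idm N - U * kron n (s a) (t b) * adj U)"
    using atom_preserver_cases
  proof
    assume "atom_preserver m n N F"
    then interpret G: atom_preserver m n N F .
    show thesis
    proof (rule G.product_structure[OF refl])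
      fix U s t
      assume U: "U \<in> corner N" "adj U * U = Idm N" "U * adj U = Idm N" "s = id \<or> s = trn" "t = id \<or> t = trn"
        and eq: "\<And>A B. A \<in> corner m \<Longrightarrow> B \<in> corner n \<Longrightarrow> F A B = U * kron n (s A) (t B) * adj U"
      then show thesis using that[OF U] by blast
    qed
  next
    let ?G = "\<lambda>a b. (tr (kron n a b) / of_nat k) *\<^sub>C Idm N - F a b"
    assume G: "N = 2 * k \<and> atom_preserver m n N ?G"
    then interpret G: atom_preserver m n N ?G by blast
    show thesis
    proof (rule G.product_structure[OF refl])
      fix U s t
      assume U: "U \<in> corner N" "adj U * U = Idm N" "U * adj U = Idm N" "s = id \<or> s = trn" "t = id \<or> t = trn"
        and eq: "\<And>A B. A \<in> corner m \<Longrightarrow> B \<in> corner n \<Longrightarrow> ?G A B = U * kron n (s A) (t B) * adj U"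
      have "F a b = (tr (kron n a b) / of_nat k) *\<^sub>C Idm N - U * kron n (s a) (t b) * adj U"
        if "a \<in> corner m" "b \<in> corner n" for a b
        unfolding eq[OF that, symmetric] by simp
      then show thesis using that[OF U] G by blast
    qed
  qed
  have tw: "krange N k (kron n (s a) (t b)) = krange N k (kron n a b)" if ab: "a \<in> corner m" "b \<in> corner n" for a b
  proof -
    have c: "s a \<in> corner m" "t b \<in> corner n" "tr (s a) = tr a" "tr (t b) = tr b" using st ab by auto
    have "krange N k (F a b) = krange N k (kron n (s a) (t b))"
      by (rule krange_form[OF U, of "kron n a b"]) (use c ab form k1 in \<open>auto simp: kron_rect tr_kron n0\<close>)
    then show ?thesis using krange_F[OF ab] by simp
  qed
  have "s = t \<or> m = 2 \<or> n = 2"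
  proof (rule ccontr)
    assume "\<not> ?thesis"
    then have mn: "3 \<le> m" "3 \<le> n" and "s \<noteq> t" using m2 n2 by auto
    have "krange N k (kron n a (trn b)) = krange N k (kron n a b)" if ab: "a \<in> corner m" "b \<in> corner n" for a b
    proof (cases "s = id")
      case True
      then show ?thesis using tw[OF ab] st \<open>s \<noteq> t\<close> by auto
    next
      case False
      then have "s = trn" "t = id" using st \<open>s \<noteq> t\<close> by auto
      then show ?thesis using tw[OF ab] krange_trn[of N k "kron n (trn a) b"] by simp
    qed
    then show False using partial_transpose_not_preserving[OF mn k1 kN] by blast
  qed
  then show ?thesis using that U(1,2) st form by blast
qed

subsection \<open>Linear maps and ranges of matrices\<close>

lemma linear_mat_map_iff:
  "linear_mat_map N f \<longleftrightarrow> (\<forall>A\<in>carrier_mat N N. f A \<in> carrier_mat N N) \<and>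
     (\<forall>A\<in>carrier_mat N N. \<forall>B\<in>carrier_mat N N. f (A + B) = f A + f B) \<and>
     (\<forall>c. \<forall>A\<in>carrier_mat N N. f (c \<cdot>\<^sub>m A) = c \<cdot>\<^sub>m f A)"
  unfolding linear_mat_map_def LinearCombinations.module_hom_def by (auto simp: module_mat_simps)

text \<open>\<open>tr (X\<^sup>* A X) = tr (X X\<^sup>* A)\<close>, and the projections of rank \<open>k\<close> are exactly the matrices \<open>X X\<^sup>*\<close> with
  \<open>X\<^sup>* X = I\<close>.\<close>

lemma k_numerical_range_krange:
  assumes A: "A \<in> carrier_mat N N"
  shows "k_numerical_range k A = (\<lambda>z. z / of_nat k) ` krange N k (T A)"
proof -
  have val: "mat_trace (mat_adjoint X * A * X) = tr (T X * adj (T X) * T A)" if X: "X \<in> carrier_mat N k" for X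
  proof -
    have a: "mat_adjoint X \<in> carrier_mat k N" using X by simp
    have aA: "mat_adjoint X * A \<in> carrier_mat k N" using a A by simp
    have "mat_trace (mat_adjoint X * A * X) = tr (adj (T X) * T A * T X)"
      using aA X by (subst T_trace[of _ k]) (auto simp: T_mult[OF aA X] T_mult[OF a A] T_adj)
    also have "\<dots> = tr (T X * adj (T X) * T A)" using tr_mult[of "adj (T X) * T A" "T X"] by (simp add: mult.assoc)
    finally show ?thesis .
  qed
  have iso: "mat_adjoint X * X = 1\<^sub>m k \<longleftrightarrow> adj (T X) * T X = Idm k" if X: "X \<in> carrier_mat N k" for X
  proof -
    have a: "mat_adjoint X \<in> carrier_mat k N" using X by simp
    have "T (mat_adjoint X * X) = adj (T X) * T X" by (simp add: T_mult[OF a X] T_adj)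
    moreover have "mat_adjoint X * X \<in> carrier_mat k k" by (rule mult_carrier_mat[OF a X])
    ultimately show ?thesis using T_inj[of "mat_adjoint X * X" k k "1\<^sub>m k"] by (metis T_simps(4) one_carrier_mat)
  qed
  have dA: "dim_row A = N" using A by simp
  show ?thesis
  proof (intro equalityI subsetI)
    fix w assume "w \<in> k_numerical_range k A"
    then obtain X where X: "X \<in> carrier_mat N k" "mat_adjoint X * X = 1\<^sub>m k" "w = mat_trace (mat_adjoint X * A * X) / of_nat k"
      by (auto simp: k_numerical_range_def dA)
    have i: "adj (T X) * T X = Idm k" using iso[OF X(1)] X(2) by simp
    have Xr: "T X \<in> rect N k" using X(1) by simp
    have e: "T X * Idm k * adj (T X) = T X * adj (T X)" using rect_Idm(2)[OF Xr] by simp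
    have "kproj N k (T X * adj (T X))"
      using isometry_image(1,2)[OF Xr i, of "Idm k"] tr_conj[OF i, of "Idm k"] unfolding e by (simp add: kproj_def)
    then show "w \<in> (\<lambda>z. z / of_nat k) ` krange N k (T A)" using X(3) val[OF X(1)] by (auto simp: krange_def)
  next
    fix w assume "w \<in> (\<lambda>z. z / of_nat k) ` krange N k (T A)"
    then obtain R where R: "kproj N k R" "w = tr (R * T A) / of_nat k" by (auto simp: krange_def)
    obtain X where X: "X \<in> rect N k" "adj X * X = Idm k" "X * adj X = R" using proj_isometry[OF kprojD[OF R(1)]] .
    have "J N k X \<in> carrier_mat N k" "mat_adjoint (J N k X) * J N k X = 1\<^sub>m k"
      "w = mat_trace (mat_adjoint (J N k X) * A * J N k X) / of_nat k"
      using iso[of "J N k X"] val[of "J N k X"] X R(2) by simp_all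
    then show "w \<in> k_numerical_range k A" unfolding k_numerical_range_def dA by blast
  qed
qed

lemma k_numerical_range_eq_iff:
  assumes "A \<in> carrier_mat N N" "B \<in> carrier_mat N N" "1 \<le> k"
  shows "k_numerical_range k A = k_numerical_range k B \<longleftrightarrow> krange N k (T A) = krange N k (T B)"
proof -
  have "inj (\<lambda>z::complex. z / of_nat k)" using assms(3) by (auto simp: inj_on_def)
  then show ?thesis using assms by (simp add: k_numerical_range_krange inj_image_eq_iff)
qed

lemma kronecker_carrier [simp]:
  "A \<in> carrier_mat m m \<Longrightarrow> B \<in> carrier_mat n n \<Longrightarrow> kronecker A B \<in> carrier_mat (m * n) (m * n)"
  by (simp add: kronecker_def)

text \<open>The transposition of the second factor has to be a linear map on all of \<open>M\<^sub>N\<close>, so it is defined by moving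
  the entries: in the indices \<open>a n + b\<close> and \<open>c n + d\<close> it exchanges \<open>b\<close> and \<open>d\<close>.\<close>

definition partial_transpose :: "nat \<Rightarrow> nat \<Rightarrow> complex mat \<Rightarrow> complex mat" where
  "partial_transpose N n M = mat N N (\<lambda>(i, j). M $$ (i div n * n + j mod n, j div n * n + i mod n))"

lemma div_mod_bound: "i < m * n \<Longrightarrow> i div n * n + j mod n < m * n" for i j m n :: nat
proof -
  assume i: "i < m * n"
  then have n: "0 < n" by (cases n) auto
  then have "i div n < m" using i by (simp add: div_less_iff_less_mult)
  then have "Suc (i div n) * n \<le> m * n" by (intro mult_le_mono1) simp
  moreover have "j mod n < n" using n by simp
  ultimately show ?thesis by simp
qed

lemma partial_transpose_kronecker:
  assumes "A \<in> carrier_mat m m" "B \<in> carrier_mat n n" "0 < n"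
  shows "partial_transpose (m * n) n (kronecker A B) = kronecker A (transpose_mat B)"
  using assms by (intro eq_matI) (auto simp: partial_transpose_def kronecker_def div_mod_bound)

lemma transpose_kronecker:
  assumes "A \<in> carrier_mat m m" "B \<in> carrier_mat n n" "0 < n"
  shows "transpose_mat (kronecker A B) = kronecker (transpose_mat A) (transpose_mat B)"
  using assms by (intro eq_matI) (auto simp: kronecker_def div_less_iff_less_mult)

lemma linear_partial_transpose: "linear_mat_map (m * n) (partial_transpose (m * n) n)"
  unfolding linear_mat_map_iff by (auto simp: partial_transpose_def div_mod_bound intro!: eq_matI)

lemma linear_transpose: "linear_mat_map N transpose_mat"
  unfolding linear_mat_map_iff by (auto intro!: eq_matI)

lemma linear_compose: "linear_mat_map N f \<Longrightarrow> linear_mat_map N g \<Longrightarrow> linear_mat_map N (\<lambda>A. f (g A))"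
  unfolding linear_mat_map_iff by auto

lemma linear_id: "linear_mat_map N (\<lambda>A. A)"
  unfolding linear_mat_map_iff by auto

lemma twist_exists:
  assumes st: "s = id \<or> s = trn" "t = id \<or> t = trn" and n: "0 < n"
  obtains \<psi> where "linear_mat_map (m * n) \<psi>"
    "\<And>A B. A \<in> carrier_mat m m \<Longrightarrow> B \<in> carrier_mat n n \<Longrightarrow>
       \<psi> (kronecker A B) = kronecker (if s = id then A else transpose_mat A) (if t = id then B else transpose_mat B)"
proof -
  consider "s = id" "t = id" | "s \<noteq> id" "t \<noteq> id" | "s = id" "t \<noteq> id" | "s \<noteq> id" "t = id" by blast
  then show ?thesis
  proof cases
    case 1
    then show ?thesis using linear_id by (intro that[of "\<lambda>A. A"]) auto
  next
    case 2
    then show ?thesis using linear_transpose n by (intro that[of transpose_mat]) (auto simp: transpose_kronecker)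
  next
    case 3
    then show ?thesis using linear_partial_transpose n
      by (intro that[of "partial_transpose (m * n) n"]) (auto simp: partial_transpose_kronecker)
  next
    case 4
    have "transpose_mat (partial_transpose (m * n) n (kronecker A B)) = kronecker (transpose_mat A) B"
      if "A \<in> carrier_mat m m" "B \<in> carrier_mat n n" for A B
      using that n by (simp add: partial_transpose_kronecker[OF that n] transpose_kronecker[of _ m _ n])
    then show ?thesis using 4 linear_compose[OF linear_transpose linear_partial_transpose]
      by (intro that[of "\<lambda>M. transpose_mat (partial_transpose (m * n) n M)"]) auto
  qed
qed

lemma T_kronecker_twist:
  assumes "s = id \<or> s = trn" "t = id \<or> t = trn" "0 < n" "A \<in> carrier_mat m m" "B \<in> carrier_mat n n"
  shows "T (kronecker (if s = id then A else transpose_mat A) (if t = id then B else transpose_mat B)) = kron n (s (T A)) (t (T B))"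
proof -
  have nid: "trn \<noteq> id"
  proof
    assume "trn = id"
    then have "trn (E 0 1) = E 0 1" by simp
    then have "ent (E 1 0) 0 1 = ent (E 0 1) 0 1" by simp
    then show False by simp
  qed
  have c: "(if s = id then A else transpose_mat A) \<in> carrier_mat m m" "(if t = id then B else transpose_mat B) \<in> carrier_mat n n"
    using assms(4,5) by auto
  show ?thesis unfolding T_kronecker[OF c assms(3)] using assms(1,2) nid by (auto simp: T_simps)
qed

text \<open>As the Kronecker product is bilinear, a linear relation between products in one factor is one between
  elements of \<open>M\<^sub>N\<close>, where the given map is linear.\<close>

lemma range_preserver_of_map:
  fixes \<phi> :: "complex mat \<Rightarrow> complex mat"
  assumes mn: "2 \<le> m" "2 \<le> n" and k: "1 \<le> k" "k < m * n" and lin: "linear_mat_map (m * n) \<phi>"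
    and pres: "\<forall>A\<in>carrier_mat m m. \<forall>B\<in>carrier_mat n n. k_numerical_range k (\<phi> (kronecker A B)) = k_numerical_range k (kronecker A B)"
  shows "range_preserver m n (\<lambda>a b. T (\<phi> (kronecker (J m m a) (J n n b)))) k"
proof -
  let ?K = "\<lambda>a b. kronecker (J m m a) (J n n b)"
  have n0: "0 < n" using mn by simp
  have KN: "?K a b \<in> carrier_mat (m * n) (m * n)" for a b by simp
  have L: "\<And>A. A \<in> carrier_mat (m * n) (m * n) \<Longrightarrow> \<phi> A \<in> carrier_mat (m * n) (m * n)"
    "\<And>A B. A \<in> carrier_mat (m * n) (m * n) \<Longrightarrow> B \<in> carrier_mat (m * n) (m * n) \<Longrightarrow> \<phi> (A + B) = \<phi> A + \<phi> B"
    "\<And>c A. A \<in> carrier_mat (m * n) (m * n) \<Longrightarrow> \<phi> (c \<cdot>\<^sub>m A) = c \<cdot>\<^sub>m \<phi> A"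
    using lin unfolding linear_mat_map_iff by blast+
  have TK: "T (?K a b) = kron n a b" if "a \<in> corner m" "b \<in> corner n" for a b
    using that by (simp add: T_kronecker[of _ m _ n] n0)
  have add: "T (\<phi> (?K a b)) = T (\<phi> (?K a' b')) + T (\<phi> (?K a'' b''))"
    if "kron n a b = kron n a' b' + kron n a'' b''" "a \<in> corner m" "b \<in> corner n" "a' \<in> corner m" "b' \<in> corner n" "a'' \<in> corner m" "b'' \<in> corner n"
    for a b a' b' a'' b''
  proof -
    have "?K a b = ?K a' b' + ?K a'' b''"
      by (rule T_inj[of _ "m * n" "m * n"]) (use KN that in \<open>simp_all add: T_simps(1)[OF KN KN] TK\<close>)
    then show ?thesis using L(1,2) KN T_simps(1) by metis
  qed
  have scale: "T (\<phi> (?K a b)) = c *\<^sub>C T (\<phi> (?K a' b'))"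
    if "kron n a b = c *\<^sub>C kron n a' b'" "a \<in> corner m" "b \<in> corner n" "a' \<in> corner m" "b' \<in> corner n" for a b a' b' c
  proof -
    have "?K a b = c \<cdot>\<^sub>m ?K a' b'"
      by (rule T_inj[of _ "m * n" "m * n"]) (use KN that in \<open>simp_all add: T_simps(3) TK\<close>)
    then show ?thesis using L(3)[OF KN] T_simps(3) by metis
  qed
  show ?thesis
  proof unfold_locales
    fix a b assume ab: "a \<in> corner m" "b \<in> corner n"
    show "T (\<phi> (?K a b)) \<in> corner (m * n)" using L(1)[OF KN] by simp
    show "krange (m * n) k (T (\<phi> (?K a b))) = krange (m * n) k (kron n a b)"
      using pres k_numerical_range_eq_iff[OF L(1)[OF KN] KN k(1), of a b a b] TK[OF ab] by simp
  qed (use mn k in \<open>auto intro!: add scale simp: kron_lin\<close>)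
qed

theorem theorem1p1:
  fixes m n k :: nat and \<phi> :: "complex mat \<Rightarrow> complex mat"
  assumes "m \<ge> 2" and "n \<ge> 2" and "k \<in> {1..m * n - 1}"
    and "linear_mat_map (m * n) \<phi>"
  shows
    "(\<forall>A \<in> carrier_mat m m. \<forall>B \<in> carrier_mat n n.
        k_numerical_range k (\<phi> (kronecker A B)) = k_numerical_range k (kronecker A B))
     \<longleftrightarrow>
     (\<exists>U \<psi>. unitary_mat (m * n) U \<and> linear_mat_map (m * n) \<psi> \<and>
        ((\<forall>A \<in> carrier_mat m m. \<forall>B \<in> carrier_mat n n.
            \<psi> (kronecker A B) = kronecker A B) \<or>
         (\<forall>A \<in> carrier_mat m m. \<forall>B \<in> carrier_mat n n.
            \<psi> (kronecker A B) = transpose_mat (kronecker A B)) \<or>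
         (min m n \<le> 2 \<and>
           ((\<forall>A \<in> carrier_mat m m. \<forall>B \<in> carrier_mat n n.
               \<psi> (kronecker A B) = kronecker A (transpose_mat B)) \<or>
            (\<forall>A \<in> carrier_mat m m. \<forall>B \<in> carrier_mat n n.
               \<psi> (kronecker A B) = kronecker (transpose_mat A) B)))) \<and>
        ((\<forall>A \<in> carrier_mat m m. \<forall>B \<in> carrier_mat n n.
            \<phi> (kronecker A B) = U * \<psi> (kronecker A B) * mat_adjoint U) \<or>
         (m * n = 2 * k \<and>
           (\<forall>A \<in> carrier_mat m m. \<forall>B \<in> carrier_mat n n.
              \<phi> (kronecker A B) =
                (mat_trace (kronecker A B) / of_nat k) \<cdot>\<^sub>m 1\<^sub>m (m * n)
                - U * \<psi> (kronecker A B) * mat_adjoint U))))"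
    (is "?pres \<longleftrightarrow> (\<exists>U \<psi>. ?form U \<psi>)")
proof
  let ?N = "m * n"
  have k: "1 \<le> k" "k < ?N" and n0: "0 < n" using assms(1-3) by auto
  have L: "\<phi> A \<in> carrier_mat ?N ?N" if "A \<in> carrier_mat ?N ?N" for A
    using assms(4) that unfolding linear_mat_map_iff by blast
  have T_conj: "T (V * M * mat_adjoint V) = T V * T M * adj (T V)" "V * M * mat_adjoint V \<in> carrier_mat ?N ?N"
    if VM: "V \<in> carrier_mat ?N ?N" "M \<in> carrier_mat ?N ?N" for V M :: "complex mat"
  proof -
    have a: "V * M \<in> carrier_mat ?N ?N" "mat_adjoint V \<in> carrier_mat ?N ?N" using VM by simp_all
    show "T (V * M * mat_adjoint V) = T V * T M * adj (T V)"
      by (simp only: T_mult[OF a] T_mult[OF VM] T_adj)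
    show "V * M * mat_adjoint V \<in> carrier_mat ?N ?N" using a by simp
  qed
  have tr_eq: "mat_trace (kronecker A B) = tr (kron n (T A) (T B))" "T (kronecker A B) = kron n (T A) (T B)"
    if "A \<in> carrier_mat m m" "B \<in> carrier_mat n n" for A B
    using T_trace[OF kronecker_carrier[OF that]] T_kronecker[OF that n0] by simp_all
  {
    assume ?pres
    then interpret F: range_preserver m n "\<lambda>a b. T (\<phi> (kronecker (J m m a) (J n n b)))" k
      using range_preserver_of_map[OF assms(1,2) k assms(4)] by blast
    obtain U s t where U: "U \<in> corner ?N" "adj U * U = Idm ?N" and st: "s = id \<or> s = trn" "t = id \<or> t = trn"
      and twist: "s = t \<or> m = 2 \<or> n = 2"
      and form: "(\<forall>a\<in>corner m. \<forall>b\<in>corner n. T (\<phi> (kronecker (J m m a) (J n n b))) = U * kron n (s a) (t b) * adj U) \<or>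
       ?N = 2 * k \<and> (\<forall>a\<in>corner m. \<forall>b\<in>corner n. T (\<phi> (kronecker (J m m a) (J n n b)))
         = (tr (kron n a b) / of_nat k) *\<^sub>C Idm ?N - U * kron n (s a) (t b) * adj U)"
      by (rule F.range_preserver_form) (rule that)
    obtain \<psi> where \<psi>: "linear_mat_map ?N \<psi>" "\<And>A B. A \<in> carrier_mat m m \<Longrightarrow> B \<in> carrier_mat n n \<Longrightarrow>
       \<psi> (kronecker A B) = kronecker (if s = id then A else transpose_mat A) (if t = id then B else transpose_mat B)"
      using twist_exists[OF st n0] by blast
    define V where "V = J ?N ?N U"
    have V: "V \<in> carrier_mat ?N ?N" "T V = U" using U(1) by (simp_all add: V_def)
    have aV: "mat_adjoint V \<in> carrier_mat ?N ?N" using V(1) by simp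
    have "mat_adjoint V * V = 1\<^sub>m ?N"
    proof (rule T_inj)
      show "T (mat_adjoint V * V) = T (1\<^sub>m ?N)" by (simp only: T_mult[OF aV V(1)] T_adj V(2) U(2) T_simps(4))
      show "mat_adjoint V * V \<in> carrier_mat ?N ?N" by (rule mult_carrier_mat[OF aV V(1)])
    qed simp
    then have un: "unitary_mat ?N V" using V(1) by (simp add: unitary_mat_def)
    have psiN: "\<psi> (kronecker A B) \<in> carrier_mat ?N ?N" if "A \<in> carrier_mat m m" "B \<in> carrier_mat n n" for A B
      using \<psi>(1) kronecker_carrier[OF that] unfolding linear_mat_map_iff by blast
    have Tpsi: "T (V * \<psi> (kronecker A B) * mat_adjoint V) = U * kron n (s (T A)) (t (T B)) * adj U"
      if "A \<in> carrier_mat m m" "B \<in> carrier_mat n n" for A B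
      using T_conj(1)[OF V(1) psiN[OF that]] \<psi>(2)[OF that] T_kronecker_twist[OF st n0 that] V(2) by simp
    have "?form V \<psi>"
    proof (intro conjI un \<psi>(1))
      consider "s = id" "t = id" | "s \<noteq> id" "t \<noteq> id" | "m = 2 \<or> n = 2" "s = id" "t \<noteq> id" | "m = 2 \<or> n = 2" "s \<noteq> id" "t = id"
        using twist by blast
      then show "(\<forall>A \<in> carrier_mat m m. \<forall>B \<in> carrier_mat n n. \<psi> (kronecker A B) = kronecker A B) \<or>
         (\<forall>A \<in> carrier_mat m m. \<forall>B \<in> carrier_mat n n. \<psi> (kronecker A B) = transpose_mat (kronecker A B)) \<or>
         (min m n \<le> 2 \<and>
           ((\<forall>A \<in> carrier_mat m m. \<forall>B \<in> carrier_mat n n. \<psi> (kronecker A B) = kronecker A (transpose_mat B)) \<or>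
            (\<forall>A \<in> carrier_mat m m. \<forall>B \<in> carrier_mat n n. \<psi> (kronecker A B) = kronecker (transpose_mat A) B)))"
        by cases (use \<psi>(2) n0 in \<open>auto simp: transpose_kronecker\<close>)
      show "(\<forall>A \<in> carrier_mat m m. \<forall>B \<in> carrier_mat n n. \<phi> (kronecker A B) = V * \<psi> (kronecker A B) * mat_adjoint V) \<or>
         (m * n = 2 * k \<and> (\<forall>A \<in> carrier_mat m m. \<forall>B \<in> carrier_mat n n. \<phi> (kronecker A B) =
                (mat_trace (kronecker A B) / of_nat k) \<cdot>\<^sub>m 1\<^sub>m (m * n) - V * \<psi> (kronecker A B) * mat_adjoint V))"
        using form
      proof
        assume f: "\<forall>a\<in>corner m. \<forall>b\<in>corner n. T (\<phi> (kronecker (J m m a) (J n n b))) = U * kron n (s a) (t b) * adj U"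
        have "\<phi> (kronecker A B) = V * \<psi> (kronecker A B) * mat_adjoint V" if AB: "A \<in> carrier_mat m m" "B \<in> carrier_mat n n" for A B
        proof (rule T_inj[OF L[OF kronecker_carrier[OF AB]] T_conj(2)[OF V(1) psiN[OF AB]]])
          show "T (\<phi> (kronecker A B)) = T (V * \<psi> (kronecker A B) * mat_adjoint V)"
            using f[rule_format, of "T A" "T B"] AB by (simp add: Tpsi[OF AB])
        qed
        then show ?thesis by blast
      next
        assume f: "?N = 2 * k \<and> (\<forall>a\<in>corner m. \<forall>b\<in>corner n. T (\<phi> (kronecker (J m m a) (J n n b)))
         = (tr (kron n a b) / of_nat k) *\<^sub>C Idm ?N - U * kron n (s a) (t b) * adj U)"
        have "\<phi> (kronecker A B) = (mat_trace (kronecker A B) / of_nat k) \<cdot>\<^sub>m 1\<^sub>m ?N - V * \<psi> (kronecker A B) * mat_adjoint V"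
          (is "_ = ?c \<cdot>\<^sub>m _ - ?W") if AB: "A \<in> carrier_mat m m" "B \<in> carrier_mat n n" for A B
        proof (rule T_inj[OF L[OF kronecker_carrier[OF AB]]])
          have c: "?c \<cdot>\<^sub>m 1\<^sub>m ?N \<in> carrier_mat ?N ?N" by simp
          note W = T_conj(2)[OF V(1) psiN[OF AB]]
          show "?c \<cdot>\<^sub>m 1\<^sub>m ?N - ?W \<in> carrier_mat ?N ?N" by (rule minus_carrier_mat[OF W])
          have "T (\<phi> (kronecker A B)) = (tr (kron n (T A) (T B)) / of_nat k) *\<^sub>C Idm ?N - U * kron n (s (T A)) (t (T B)) * adj U"
            using f[THEN conjunct2, rule_format, of "T A" "T B"] AB by simp
          then show "T (\<phi> (kronecker A B)) = T (?c \<cdot>\<^sub>m 1\<^sub>m ?N - ?W)"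
            unfolding T_simps(2)[OF c W] by (simp only: T_simps(3,4) Tpsi[OF AB] tr_eq[OF AB])
        qed
        then show ?thesis using f by blast
      qed
    qed
    then show "\<exists>U \<psi>. ?form U \<psi>" by blast
  next
    assume "\<exists>U \<psi>. ?form U \<psi>"
    then obtain V \<psi> where F: "?form V \<psi>" by blast
    have V: "V \<in> carrier_mat ?N ?N" "mat_adjoint V * V = 1\<^sub>m ?N" using F by (auto simp: unitary_mat_def)
    have aV: "mat_adjoint V \<in> carrier_mat ?N ?N" using V(1) by simp
    define U where "U = T V"
    have "adj U * U = T (mat_adjoint V * V)" by (simp only: U_def T_mult[OF aV V(1)] T_adj)
    then have U: "U \<in> corner ?N" "adj U * U = Idm ?N" using V by (simp_all add: U_def T_simps)
    note U = U right_inverse_of_left[OF U]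
    have psiN: "\<psi> (kronecker A B) \<in> carrier_mat ?N ?N" if "A \<in> carrier_mat m m" "B \<in> carrier_mat n n" for A B
      using F kronecker_carrier[OF that] unfolding linear_mat_map_iff by blast
    have m2: "min m n \<le> 2 \<Longrightarrow> m = 2 \<or> n = 2" using assms(1,2) by linarith
    have "\<exists>s t. (s = id \<or> s = trn) \<and> (t = id \<or> t = trn) \<and> (s = t \<or> m = 2 \<or> n = 2) \<and>
      (\<forall>A \<in> carrier_mat m m. \<forall>B \<in> carrier_mat n n. T (\<psi> (kronecker A B)) = kron n (s (T A)) (t (T B)))"
    proof -
      consider "\<forall>A \<in> carrier_mat m m. \<forall>B \<in> carrier_mat n n. \<psi> (kronecker A B) = kronecker A B"
        | "\<forall>A \<in> carrier_mat m m. \<forall>B \<in> carrier_mat n n. \<psi> (kronecker A B) = transpose_mat (kronecker A B)"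
        | "min m n \<le> 2" "\<forall>A \<in> carrier_mat m m. \<forall>B \<in> carrier_mat n n. \<psi> (kronecker A B) = kronecker A (transpose_mat B)"
        | "min m n \<le> 2" "\<forall>A \<in> carrier_mat m m. \<forall>B \<in> carrier_mat n n. \<psi> (kronecker A B) = kronecker (transpose_mat A) B"
        using F by blast
      then show ?thesis
      proof cases
        case 1
        then show ?thesis by (intro exI[of _ id]) (simp add: tr_eq)
      next
        case 2
        then show ?thesis by (intro exI[of _ trn]) (simp add: tr_eq T_simps)
      next
        case 3
        then show ?thesis using m2 n0
          by (intro exI[of _ id] exI[of _ trn]) (auto simp: T_kronecker[of _ m _ n] T_simps)
      next
        case 4
        then show ?thesis using m2 n0
          by (intro exI[of _ trn] exI[of _ id]) (auto simp: T_kronecker[of _ m _ n] T_simps)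
      qed
    qed
    then obtain s t where st: "s = id \<or> s = trn" "t = id \<or> t = trn" "s = t \<or> m = 2 \<or> n = 2"
      and Tpsi: "\<And>A B. A \<in> carrier_mat m m \<Longrightarrow> B \<in> carrier_mat n n \<Longrightarrow> T (\<psi> (kronecker A B)) = kron n (s (T A)) (t (T B))"
      by blast
    show ?pres
    proof (intro ballI)
      fix A B :: "complex mat" assume AB: "A \<in> carrier_mat m m" "B \<in> carrier_mat n n"
      let ?a = "T A" and ?b = "T B" and ?Z = "T (\<phi> (kronecker A B))"
      have ab: "?a \<in> corner m" "?b \<in> corner n" using AB by simp_all
      have c: "s ?a \<in> corner m" "t ?b \<in> corner n" "tr (s ?a) = tr ?a" "tr (t ?b) = tr ?b" using st ab by auto
      let ?W = "V * \<psi> (kronecker A B) * mat_adjoint V"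
      have W: "T ?W = U * kron n (s ?a) (t ?b) * adj U" "?W \<in> carrier_mat ?N ?N"
        using T_conj[OF V(1) psiN[OF AB]] Tpsi[OF AB] by (simp_all add: U_def)
      have i: "(tr (kron n ?a ?b) / of_nat k) \<cdot>\<^sub>m 1\<^sub>m ?N \<in> carrier_mat ?N ?N" by simp
      have "?Z = U * kron n (s ?a) (t ?b) * adj U \<or>
        ?N = 2 * k \<and> ?Z = (tr (kron n ?a ?b) / of_nat k) *\<^sub>C Idm ?N - U * kron n (s ?a) (t ?b) * adj U"
      proof -
        have "\<phi> (kronecker A B) = ?W \<or> ?N = 2 * k \<and> \<phi> (kronecker A B) = (tr (kron n ?a ?b) / of_nat k) \<cdot>\<^sub>m 1\<^sub>m ?N - ?W"
          using F AB tr_eq(1)[OF AB] by auto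
        then show ?thesis using W(1) T_simps(2)[OF i W(2)] by (auto simp: T_simps(3,4))
      qed
      then have "krange ?N k ?Z = krange ?N k (kron n (s ?a) (t ?b))"
        by (intro krange_form[OF U, of "kron n ?a ?b"]) (use c ab k n0 in \<open>auto simp: kron_rect tr_kron\<close>)
      also have "\<dots> = krange ?N k (kron n ?a ?b)" by (rule krange_twisted[OF st n0 ab])
      finally show "k_numerical_range k (\<phi> (kronecker A B)) = k_numerical_range k (kronecker A B)"
        using k_numerical_range_eq_iff[OF L[OF kronecker_carrier[OF AB]] kronecker_carrier[OF AB] k(1)] tr_eq(2)[OF AB] by simp
    qed
  }
qed

end
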